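(* Let $(M,g_R)$ be a Riemannian manifold, $E$ a closed unitary vector field on $M$, $\omega=g_R(E,\cdot)$, and $g_L=g_R-2\,\omega\otimes\omega$ the standard canonical variation along $E$. (1) If $\Pi$ is a nondegenerate plane for $g_L$, then $$-\cos(2\theta)K_L(\Pi)=K_R(\Pi)+2\sin^2(\theta)\left(\hat{K}_R(\mathfrak{p}(\Pi))-K_R(\mathfrak{p}(\Pi))\right),$$ where $\theta$ is the angle between $E$ and $\Pi$, $\hat K_R$ is the induced (sectional) curvature on the orthogonal leaves of $E$, and $\mathfrak{p}$ is the orthogonal projection onto $E^\perp$. In particular, $K_L(\Pi)=-K_R(\Pi)$ for any plane $\Pi$ containing $E$. (2) If $\Pi$ is a degenerate plane for $g_L$, then $$\mathcal{K}^E_L(\Pi)=2K_R(\Pi)+2\left(\hat K_R(\mathfrak{p}(\Pi))-K_R(\mathfrak{p}(\Pi))\right).$$ (3) For any $v\in TM$, $$Ric_L(v,v)=Ric_R(v,v)+2g_R(A_E(v),v)\,div_R E-2g_R(A_E(v),A_E(v))-2g_R(R^R_{vE}E,v).$$ (4) $S_L=S_R+4E(div_R E)+2\left(||A_E||^2+(div_R E)^2\right)$.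
   Context: Subscripts/superscripts $L$ and $R$ refer to $g_L$ and $g_R$: $K$, $Ric$, $S$ are sectional, Ricci and scalar curvature, $R^R$ the curvature tensor with $R_{UV}W=\nabla_U\nabla_VW-\nabla_V\nabla_UW-\nabla_{[U,V]}W$ (so $K(\mathrm{span}(u,v))=g(R_{uv}v,u)/(g(u,u)g(v,v)-g(u,v)^2)$). Closed means $d\omega=0$; unitary means $g_R(E,E)=1$. The orthogonal leaves of $E$ are the leaves of the integrable distribution $E^\perp$, with the metric induced by $g_R$. Angles and projections are taken with respect to $g_R$. When $E\in\Pi$, $\theta=0$ and the term multiplied by $\sin^2\theta$ in (1) is read as zero. $A_E(V)=\nabla^R_VE$, and $||A_E||^2=\sum_i g_R(A_E(e_i),A_E(e_i))$ for a $g_R$-orthonormal frame. A plane is degenerate for $g_L$ if the restriction of $g_L$ to it is degenerate; for such a plane, $\mathcal{K}^E_L(\Pi)$ denotes its lightlike sectional curvature with respect to $E$: $\mathcal{K}^E_L(\Pi)=\dfrac{g_L(R^L_{xu}u,x)}{g_L(x,x)}$, where $u\in\Pi$ is the lightlike vector normalized by $|g_L(u,E)|=1$ and $x\in\Pi$ is any vector not proportional to $u$. *)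

theory Defs
  imports "HOL-Analysis.Analysis"
begin

section \<open>Smooth manifolds\<close>

text \<open>For an open subset of a Euclidean space this is the usual \<open>C\<^sup>k\<close> condition, phrased through
  iterated directional derivatives.\<close>

primrec Ck_on :: "nat \<Rightarrow> 'b::euclidean_space set \<Rightarrow> ('b \<Rightarrow> 'e::real_normed_vector) \<Rightarrow> bool" where
  "Ck_on 0 S f \<longleftrightarrow> continuous_on S f"
| "Ck_on (Suc k) S f \<longleftrightarrow>
     (\<forall>x\<in>S. f differentiable (at x)) \<and> (\<forall>v. Ck_on k S (\<lambda>x. frechet_derivative f (at x) v))"

definition smooth_on :: "'b::euclidean_space set \<Rightarrow> ('b \<Rightarrow> 'e::real_normed_vector) \<Rightarrow> bool" where
  "smooth_on S f \<longleftrightarrow> (\<forall>k. Ck_on k S f)"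

type_synonym ('a, 'b) chart = "'a set \<times> ('a \<Rightarrow> 'b)"

definition chart_inv :: "('a, 'b) chart \<Rightarrow> 'b \<Rightarrow> 'a" where
  "chart_inv c = inv_into (fst c) (snd c)"

record ('a, 'b) manifold =
  mtop :: "'a topology"
  atlas :: "('a, 'b) chart set"

abbreviation points :: "('a, 'b) manifold \<Rightarrow> 'a set" where
  "points M \<equiv> topspace (mtop M)"

text \<open>The dimension of the manifold is \<open>DIM('b)\<close>. The atlas need not be maximal.\<close>

definition smooth_manifold :: "('a, 'b::euclidean_space) manifold \<Rightarrow> bool" where
  "smooth_manifold M \<longleftrightarrow>
     Hausdorff_space (mtop M) \<and> second_countable (mtop M) \<and>
     (\<Union>c\<in>atlas M. fst c) = points M \<and>
     (\<forall>c\<in>atlas M. openin (mtop M) (fst c) \<and> open (snd c ` fst c) \<and>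
        homeomorphic_map (subtopology (mtop M) (fst c)) (top_of_set (snd c ` fst c)) (snd c)) \<and>
     (\<forall>c\<in>atlas M. \<forall>c'\<in>atlas M. smooth_on (snd c ` (fst c \<inter> fst c')) (snd c' \<circ> chart_inv c))"

text \<open>Every point carries a preferred chart. The tangent space at \<open>p\<close> is the model space \<open>'b\<close>,
  a vector being represented by its components in the preferred chart at \<open>p\<close>; hence a vector
  field is a function \<open>'a \<Rightarrow> 'b\<close>, and its values at two points may refer to different charts.
  Components of a field \<open>X\<close> in a fixed chart \<open>c\<close> are given by \<open>field_rep M c X\<close> below.\<close>

definition chart_at :: "('a, 'b) manifold \<Rightarrow> 'a \<Rightarrow> ('a, 'b) chart" where
  "chart_at M p = (SOME c. c \<in> atlas M \<and> p \<in> fst c)"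

text \<open>Differential at \<open>p\<close> of a function into a normed space, applied to a tangent vector. For a real
  function \<open>f\<close> this is the derivative \<open>v(f)\<close>.\<close>

definition mdiff ::
  "('a, 'b::euclidean_space) manifold \<Rightarrow> ('a \<Rightarrow> 'e::real_normed_vector) \<Rightarrow> 'a \<Rightarrow> 'b \<Rightarrow> 'e" where
  "mdiff M f p v =
     frechet_derivative (f \<circ> chart_inv (chart_at M p)) (at (snd (chart_at M p) p)) v"

definition field_rep ::
  "('a, 'b::euclidean_space) manifold \<Rightarrow> ('a, 'b) chart \<Rightarrow> ('a \<Rightarrow> 'b) \<Rightarrow> 'a \<Rightarrow> 'b" where
  "field_rep M c X q = mdiff M (snd c) q (X q)"

text \<open>The field with constant components \<open>u\<close> in the chart \<open>c\<close>, i.e. a constant linear combination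
  of the coordinate fields of \<open>c\<close>. For \<open>c = chart_at M p\<close> its value at \<open>p\<close> is \<open>u\<close>.\<close>

definition coord_field ::
  "('a, 'b::euclidean_space) manifold \<Rightarrow> ('a, 'b) chart \<Rightarrow> 'b \<Rightarrow> 'a \<Rightarrow> 'b" where
  "coord_field M c u q =
     frechet_derivative (snd (chart_at M q) \<circ> chart_inv c) (at (snd c q)) u"

definition smooth_fun_on ::
  "('a, 'b::euclidean_space) manifold \<Rightarrow> 'a set \<Rightarrow> ('a \<Rightarrow> real) \<Rightarrow> bool" where
  "smooth_fun_on M W f \<longleftrightarrow>
     openin (mtop M) W \<and> (\<forall>c\<in>atlas M. smooth_on (snd c ` (fst c \<inter> W)) (f \<circ> chart_inv c))"

definition smooth_field_on ::
  "('a, 'b::euclidean_space) manifold \<Rightarrow> 'a set \<Rightarrow> ('a \<Rightarrow> 'b) \<Rightarrow> bool" where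
  "smooth_field_on M W X \<longleftrightarrow>
     openin (mtop M) W \<and>
     (\<forall>c\<in>atlas M. smooth_on (snd c ` (fst c \<inter> W)) (field_rep M c X \<circ> chart_inv c))"

definition local_fun :: "('a, 'b::euclidean_space) manifold \<Rightarrow> 'a \<Rightarrow> ('a \<Rightarrow> real) \<Rightarrow> bool" where
  "local_fun M p f \<longleftrightarrow> (\<exists>W. p \<in> W \<and> smooth_fun_on M W f)"

definition local_field :: "('a, 'b::euclidean_space) manifold \<Rightarrow> 'a \<Rightarrow> ('a \<Rightarrow> 'b) \<Rightarrow> bool" where
  "local_field M p X \<longleftrightarrow> (\<exists>W. p \<in> W \<and> smooth_field_on M W X)"

text \<open>Lie bracket \<open>[U, V]\<close> with components \<open>U(V\<^sub>i) - V(U\<^sub>i)\<close>.\<close>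

definition lie_bracket ::
  "('a, 'b::euclidean_space) manifold \<Rightarrow> ('a \<Rightarrow> 'b) \<Rightarrow> ('a \<Rightarrow> 'b) \<Rightarrow> 'a \<Rightarrow> 'b" where
  "lie_bracket M U V p =
     mdiff M (field_rep M (chart_at M p) V) p (U p) - mdiff M (field_rep M (chart_at M p) U) p (V p)"

text \<open>Exterior derivative of a 1-form, \<open>d\<alpha>(U,V) = U(\<alpha>(V)) - V(\<alpha>(U)) - \<alpha>([U,V])\<close>. It is tensorial,
  so it may be evaluated on tangent vectors after extending them by coordinate fields.\<close>

definition ext_deriv ::
  "('a, 'b::euclidean_space) manifold \<Rightarrow> ('a \<Rightarrow> 'b \<Rightarrow> real) \<Rightarrow> 'a \<Rightarrow> 'b \<Rightarrow> 'b \<Rightarrow> real" where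
  "ext_deriv M \<alpha> p u v =
     (let U = coord_field M (chart_at M p) u; V = coord_field M (chart_at M p) v in
      mdiff M (\<lambda>q. \<alpha> q (V q)) p u - mdiff M (\<lambda>q. \<alpha> q (U q)) p v - \<alpha> p (lie_bracket M U V p))"

definition smooth_map ::
  "('l, 'c::euclidean_space) manifold \<Rightarrow> ('a, 'b::euclidean_space) manifold \<Rightarrow> ('l \<Rightarrow> 'a) \<Rightarrow> bool" where
  "smooth_map N M F \<longleftrightarrow>
     continuous_map (mtop N) (mtop M) F \<and>
     (\<forall>c\<in>atlas N. \<forall>c'\<in>atlas M.
        smooth_on (snd c ` (fst c \<inter> F -` fst c')) (snd c' \<circ> F \<circ> chart_inv c))"

definition tangent_map ::
  "('l, 'c::euclidean_space) manifold \<Rightarrow> ('a, 'b::euclidean_space) manifold \<Rightarrow> ('l \<Rightarrow> 'a) \<Rightarrow>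
   'l \<Rightarrow> 'c \<Rightarrow> 'b" where
  "tangent_map N M F y w = mdiff N (snd (chart_at M (F y)) \<circ> F) y w"


section \<open>Semi-Riemannian geometry\<close>

definition semi_riemannian_metric ::
  "('a, 'b::euclidean_space) manifold \<Rightarrow> ('a \<Rightarrow> 'b \<Rightarrow> 'b \<Rightarrow> real) \<Rightarrow> bool" where
  "semi_riemannian_metric M g \<longleftrightarrow>
     (\<forall>p\<in>points M. bilinear (g p) \<and> (\<forall>u v. g p u v = g p v u) \<and>
        (\<forall>u. u \<noteq> 0 \<longrightarrow> (\<exists>v. g p u v \<noteq> 0))) \<and>
     (\<forall>c\<in>atlas M. \<forall>u v. smooth_on (snd c ` fst c)
        ((\<lambda>q. g q (coord_field M c u q) (coord_field M c v q)) \<circ> chart_inv c))"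

definition riemannian_metric ::
  "('a, 'b::euclidean_space) manifold \<Rightarrow> ('a \<Rightarrow> 'b \<Rightarrow> 'b \<Rightarrow> real) \<Rightarrow> bool" where
  "riemannian_metric M g \<longleftrightarrow>
     semi_riemannian_metric M g \<and> (\<forall>p\<in>points M. \<forall>u. u \<noteq> 0 \<longrightarrow> g p u u > 0)"

text \<open>\<open>D p v X\<close> is the covariant derivative of the locally defined field \<open>X\<close> in the direction of the
  tangent vector \<open>v\<close> at \<open>p\<close>. The values of \<open>D p v X\<close> are irrelevant unless \<open>X\<close> is smooth near \<open>p\<close>.
  Since functions in the Leibniz rule are only required to be smooth near \<open>p\<close>, the value at \<open>p\<close>
  automatically depends on the germ of \<open>X\<close> only.\<close>

definition affine_connection ::
  "('a, 'b::euclidean_space) manifold \<Rightarrow> ('a \<Rightarrow> 'b \<Rightarrow> ('a \<Rightarrow> 'b) \<Rightarrow> 'b) \<Rightarrow> bool" where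
  "affine_connection M D \<longleftrightarrow>
     (\<forall>p\<in>points M. \<forall>X. local_field M p X \<longrightarrow> linear (\<lambda>v. D p v X)) \<and>
     (\<forall>p\<in>points M. \<forall>v X Y. local_field M p X \<longrightarrow> local_field M p Y \<longrightarrow>
        D p v (\<lambda>q. X q + Y q) = D p v X + D p v Y) \<and>
     (\<forall>p\<in>points M. \<forall>v f X. local_fun M p f \<longrightarrow> local_field M p X \<longrightarrow>
        D p v (\<lambda>q. f q *\<^sub>R X q) = mdiff M f p v *\<^sub>R X p + f p *\<^sub>R D p v X) \<and>
     (\<forall>p\<in>points M. \<forall>U X. local_field M p U \<longrightarrow> local_field M p X \<longrightarrow>
        local_field M p (\<lambda>q. D q (U q) X))"

definition levi_civita_connection ::
  "('a, 'b::euclidean_space) manifold \<Rightarrow> ('a \<Rightarrow> 'b \<Rightarrow> 'b \<Rightarrow> real) \<Rightarrow>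
   ('a \<Rightarrow> 'b \<Rightarrow> ('a \<Rightarrow> 'b) \<Rightarrow> 'b) \<Rightarrow> bool" where
  "levi_civita_connection M g D \<longleftrightarrow>
     affine_connection M D \<and>
     (\<forall>p\<in>points M. \<forall>U V. local_field M p U \<longrightarrow> local_field M p V \<longrightarrow>
        D p (U p) V - D p (V p) U = lie_bracket M U V p) \<and>
     (\<forall>p\<in>points M. \<forall>v X Y. local_field M p X \<longrightarrow> local_field M p Y \<longrightarrow>
        mdiff M (\<lambda>q. g q (X q) (Y q)) p v = g p (D p v X) (Y p) + g p (X p) (D p v Y))"

text \<open>The curvature tensor
  \<open>R\<^bsub>UV\<^esub>W = \<nabla>\<^sub>U\<nabla>\<^sub>VW - \<nabla>\<^sub>V\<nabla>\<^sub>UW - \<nabla>\<^bsub>[U,V]\<^esub>W\<close>, evaluated on tangent vectors after extending them by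
  coordinate fields of the preferred chart (by tensoriality the extension does not matter).\<close>

definition curvature_tensor ::
  "('a, 'b::euclidean_space) manifold \<Rightarrow> ('a \<Rightarrow> 'b \<Rightarrow> ('a \<Rightarrow> 'b) \<Rightarrow> 'b) \<Rightarrow>
   'a \<Rightarrow> 'b \<Rightarrow> 'b \<Rightarrow> 'b \<Rightarrow> 'b" where
  "curvature_tensor M D p u v w =
     (let U = coord_field M (chart_at M p) u;
          V = coord_field M (chart_at M p) v;
          W = coord_field M (chart_at M p) w
      in D p (U p) (\<lambda>q. D q (V q) W) - D p (V p) (\<lambda>q. D q (U q) W) - D p (lie_bracket M U V p) W)"

definition is_plane :: "'b::euclidean_space set \<Rightarrow> bool" where
  "is_plane P \<longleftrightarrow> subspace P \<and> dim P = 2"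

definition degenerate_on :: "('b::euclidean_space \<Rightarrow> 'b \<Rightarrow> real) \<Rightarrow> 'b set \<Rightarrow> bool" where
  "degenerate_on h P \<longleftrightarrow> (\<exists>u\<in>P. u \<noteq> 0 \<and> (\<forall>v\<in>P. h u v = 0))"

text \<open>The sectional curvature of a nondegenerate plane is the common value of the usual quotient for
  all bases of the plane.\<close>

definition sectional_curvature ::
  "('a, 'b::euclidean_space) manifold \<Rightarrow> ('a \<Rightarrow> 'b \<Rightarrow> 'b \<Rightarrow> real) \<Rightarrow>
   ('a \<Rightarrow> 'b \<Rightarrow> ('a \<Rightarrow> 'b) \<Rightarrow> 'b) \<Rightarrow> 'a \<Rightarrow> 'b set \<Rightarrow> real" where
  "sectional_curvature M g D p P =
     (THE k. \<forall>u v. span {u, v} = P \<longrightarrow>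
        k = g p (curvature_tensor M D p u v v) u / (g p u u * g p v v - (g p u v)\<^sup>2))"

text \<open>Lightlike sectional curvature, with respect to \<open>E\<close>, of a degenerate plane of a Lorentzian metric.
  The lightlike vector \<open>u\<close> is unique up to sign, and the value does not depend on \<open>u\<close> and \<open>x\<close>.\<close>

definition lightlike_curvature ::
  "('a, 'b::euclidean_space) manifold \<Rightarrow> ('a \<Rightarrow> 'b \<Rightarrow> 'b \<Rightarrow> real) \<Rightarrow>
   ('a \<Rightarrow> 'b \<Rightarrow> ('a \<Rightarrow> 'b) \<Rightarrow> 'b) \<Rightarrow> ('a \<Rightarrow> 'b) \<Rightarrow> 'a \<Rightarrow> 'b set \<Rightarrow> real" where
  "lightlike_curvature M g D E p P =
     (THE k. \<forall>u x. u \<in> P \<longrightarrow> u \<noteq> 0 \<longrightarrow> g p u u = 0 \<longrightarrow> \<bar>g p u (E p)\<bar> = 1 \<longrightarrow>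
        x \<in> P \<longrightarrow> x \<notin> span {u} \<longrightarrow> k = g p (curvature_tensor M D p x u u) x / g p x x)"

definition endo_trace :: "('b::euclidean_space \<Rightarrow> 'b) \<Rightarrow> real" where
  "endo_trace A = (\<Sum>b\<in>Basis. A b \<bullet> b)"

definition orthonormal_frame :: "('b::euclidean_space \<Rightarrow> 'b \<Rightarrow> real) \<Rightarrow> 'b set \<Rightarrow> bool" where
  "orthonormal_frame h B \<longleftrightarrow>
     finite B \<and> card B = DIM('b) \<and> (\<forall>e\<in>B. \<bar>h e e\<bar> = 1) \<and>
     (\<forall>e\<in>B. \<forall>e'\<in>B. e \<noteq> e' \<longrightarrow> h e e' = 0)"

text \<open>Metric trace of a bilinear form \<open>b\<close>: the sum of \<open>\<epsilon>\<^sub>i b(e\<^sub>i, e\<^sub>i)\<close> with \<open>\<epsilon>\<^sub>i = h(e\<^sub>i, e\<^sub>i)\<close>, for any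
  orthonormal frame of the nondegenerate form \<open>h\<close>.\<close>

definition metric_trace ::
  "('b::euclidean_space \<Rightarrow> 'b \<Rightarrow> real) \<Rightarrow> ('b \<Rightarrow> 'b \<Rightarrow> real) \<Rightarrow> real" where
  "metric_trace h b = (THE s. \<forall>B. orthonormal_frame h B \<longrightarrow> s = (\<Sum>e\<in>B. h e e * b e e))"

definition ricci ::
  "('a, 'b::euclidean_space) manifold \<Rightarrow> ('a \<Rightarrow> 'b \<Rightarrow> ('a \<Rightarrow> 'b) \<Rightarrow> 'b) \<Rightarrow> 'a \<Rightarrow> 'b \<Rightarrow> 'b \<Rightarrow> real" where
  "ricci M D p v w = endo_trace (\<lambda>x. curvature_tensor M D p x v w)"

definition scalar_curvature ::
  "('a, 'b::euclidean_space) manifold \<Rightarrow> ('a \<Rightarrow> 'b \<Rightarrow> 'b \<Rightarrow> real) \<Rightarrow>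
   ('a \<Rightarrow> 'b \<Rightarrow> ('a \<Rightarrow> 'b) \<Rightarrow> 'b) \<Rightarrow> 'a \<Rightarrow> real" where
  "scalar_curvature M g D p = metric_trace (g p) (ricci M D p)"

definition divergence ::
  "('a \<Rightarrow> 'b \<Rightarrow> ('a \<Rightarrow> 'b) \<Rightarrow> 'b) \<Rightarrow> ('a \<Rightarrow> 'b::euclidean_space) \<Rightarrow> 'a \<Rightarrow> real" where
  "divergence D X p = endo_trace (\<lambda>v. D p v X)"


section \<open>Closed unitary fields and the standard canonical variation\<close>

definition metric_dual :: "('a \<Rightarrow> 'b \<Rightarrow> 'b \<Rightarrow> real) \<Rightarrow> ('a \<Rightarrow> 'b) \<Rightarrow> 'a \<Rightarrow> 'b \<Rightarrow> real" where
  "metric_dual g E p v = g p (E p) v"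

definition closed_unitary_field ::
  "('a, 'b::euclidean_space) manifold \<Rightarrow> ('a \<Rightarrow> 'b \<Rightarrow> 'b \<Rightarrow> real) \<Rightarrow> ('a \<Rightarrow> 'b) \<Rightarrow> bool" where
  "closed_unitary_field M g E \<longleftrightarrow>
     smooth_field_on M (points M) E \<and>
     (\<forall>p\<in>points M. \<forall>u v. ext_deriv M (metric_dual g E) p u v = 0) \<and>
     (\<forall>p\<in>points M. g p (E p) (E p) = 1)"

definition canonical_variation ::
  "('a \<Rightarrow> 'b \<Rightarrow> 'b \<Rightarrow> real) \<Rightarrow> ('a \<Rightarrow> 'b) \<Rightarrow> 'a \<Rightarrow> 'b \<Rightarrow> 'b \<Rightarrow> real" where
  "canonical_variation g E p u v = g p u v - 2 * (metric_dual g E p u * metric_dual g E p v)"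

text \<open>The angle between a vector and a plane is the least angle between the vector and the nonzero
  vectors of the plane; it lies between \<open>0\<close> and \<open>pi / 2\<close>.\<close>

definition angle_plane :: "('b::euclidean_space \<Rightarrow> 'b \<Rightarrow> real) \<Rightarrow> 'b \<Rightarrow> 'b set \<Rightarrow> real" where
  "angle_plane h e P = (INF x\<in>P - {0}. arccos (h e x / (sqrt (h e e) * sqrt (h x x))))"

text \<open>Orthogonal projection onto the orthogonal complement of a unit vector \<open>e\<close>.\<close>

definition orth_proj :: "('b::euclidean_space \<Rightarrow> 'b \<Rightarrow> real) \<Rightarrow> 'b \<Rightarrow> 'b \<Rightarrow> 'b" where
  "orth_proj h e v = v - h e v *\<^sub>R e"

text \<open>\<open>F\<close> exhibits \<open>N\<close> as an injectively immersed integral manifold of the distribution orthogonal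
  to \<open>E\<close>. The leaves are the maximal connected ones; neither is required, since the curvature of
  the induced metric is local. The condition on the differential forces \<open>DIM('c) + 1 = DIM('b)\<close>.\<close>

definition orthogonal_integral_manifold ::
  "('a, 'b::euclidean_space) manifold \<Rightarrow> ('a \<Rightarrow> 'b \<Rightarrow> 'b \<Rightarrow> real) \<Rightarrow> ('a \<Rightarrow> 'b) \<Rightarrow>
   ('l, 'c::euclidean_space) manifold \<Rightarrow> ('l \<Rightarrow> 'a) \<Rightarrow> bool" where
  "orthogonal_integral_manifold M g E N F \<longleftrightarrow>
     smooth_manifold N \<and> smooth_map N M F \<and> inj_on F (points N) \<and>
     (\<forall>y\<in>points N. bij_betw (tangent_map N M F y) UNIV {w. g (F y) (E (F y)) w = 0})"

definition induced_metric ::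
  "('l, 'c::euclidean_space) manifold \<Rightarrow> ('a, 'b::euclidean_space) manifold \<Rightarrow> ('l \<Rightarrow> 'a) \<Rightarrow>
   ('a \<Rightarrow> 'b \<Rightarrow> 'b \<Rightarrow> real) \<Rightarrow> 'l \<Rightarrow> 'c \<Rightarrow> 'c \<Rightarrow> real" where
  "induced_metric N M F g y w w' = g (F y) (tangent_map N M F y w) (tangent_map N M F y w')"

text \<open>Sectional curvature at \<open>y\<close> of the metric induced on an immersed submanifold, for a plane \<open>P\<close>
  tangent to the image at \<open>F y\<close>; \<open>D\<close> is the Levi-Civita connection of the induced metric.\<close>

definition induced_curvature ::
  "('l, 'c::euclidean_space) manifold \<Rightarrow> ('a, 'b::euclidean_space) manifold \<Rightarrow> ('l \<Rightarrow> 'a) \<Rightarrow>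
   ('a \<Rightarrow> 'b \<Rightarrow> 'b \<Rightarrow> real) \<Rightarrow> ('l \<Rightarrow> 'c \<Rightarrow> ('l \<Rightarrow> 'c) \<Rightarrow> 'c) \<Rightarrow> 'l \<Rightarrow> 'b set \<Rightarrow> real" where
  "induced_curvature N M F g D y P =
     sectional_curvature N (induced_metric N M F g) D y (tangent_map N M F y -` P)"

end

theory Submission
  imports Defs
begin

text \<open>Write \<open>A(v) = \<nabla>\<^sub>vE\<close> and \<open>h(u, v) = g\<^sub>R(A(u), v)\<close> for the Riemannian connection \<open>\<nabla>\<close>. Since \<open>E\<close> is closed, \<open>h\<close> is
symmetric, and since \<open>E\<close> is unitary, \<open>h(E, \<cdot>) = 0\<close>. Two connections are then explicit
perturbations of \<open>\<nabla>\<close> in the direction of \<open>E\<close>: the Levi-Civita connection of \<open>g\<^sub>L\<close> is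
\<open>\<nabla>\<^sub>uv + 2 h(u, v) E\<close>, and on an integral manifold of \<open>E\<^sup>\<bottom>\<close> the induced connection is
\<open>\<nabla>\<^sub>uv + h(u, v) E\<close> (the Gauss formula). Both follow from the uniqueness of a torsion free metric
connection (\<open>variation_connection\<close>, \<open>leaf_connection\<close>).

A single computation (\<open>related_curvature\<close>) gives the curvature of a connection that is carried by a
map \<open>F\<close> to \<open>\<nabla>\<^sub>uv + \<kappa> h(u, v) E\<close>:
\<open>R'\<^bsub>uv\<^esub>w = R\<^bsub>uv\<^esub>w + \<kappa> g\<^sub>R(R\<^bsub>uv\<^esub>E, w) E + \<kappa> (h(v, w) A(u) - h(u, w) A(v))\<close>.
With \<open>\<kappa> = 2\<close> and \<open>F\<close> the identity it is the curvature of \<open>g\<^sub>L\<close>; with \<open>\<kappa> = 1\<close> and \<open>F\<close> the inclusion of a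
leaf it is the Gauss equation. Lowering an index removes the \<open>E\<close>-component:
\<open>g\<^sub>L(R\<^sup>L\<^bsub>uv\<^esub>w, z) = g\<^sub>R(R\<^bsub>uv\<^esub>w, z) + 2 (h(v, w) h(u, z) - h(u, w) h(v, z))\<close>, and the same with \<open>1\<close> in
place of \<open>2\<close> on a leaf. Hence, on a plane, \<open>R\<^sup>L\<close> differs from \<open>R\<close> by twice the term by which the
induced and the ambient curvature of the projected plane differ.

For the sectional curvatures a plane is given a \<open>g\<^sub>R\<close>-orthonormal basis \<open>x\<close>, \<open>y\<close> with \<open>x\<close> orthogonal to
\<open>E\<close> and \<open>g\<^sub>R(E, y) = cos \<theta>\<close> (\<open>plane_adapted_basis\<close>). Then \<open>g\<^sub>L(y, y) = - cos 2\<theta>\<close>, and the projected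
plane is spanned by \<open>x\<close> and a vector of squared length \<open>sin\<^sup>2 \<theta>\<close> on which \<open>h\<close> agrees with \<open>y\<close>. The Ricci
formula is a trace of the curvature formula. For the scalar curvature one sums over a frame that
contains \<open>E\<close>, which is orthonormal for both metrics, and uses the Bochner identity
\<open>Ric(E, E) = - tr A\<^sup>2 - E(div E)\<close>.

All differentiations are carried out in a chart, where a connection is a smooth family of bilinear
maps; in the preferred chart at a point the tangent space is the model space itself, so the
formulas can be read off without change.\<close>

section \<open>Derivatives and smooth maps\<close>

abbreviation fd :: "('b::real_normed_vector \<Rightarrow> 'e::real_normed_vector) \<Rightarrow> 'b \<Rightarrow> 'b \<Rightarrow> 'e" where
  "fd f x \<equiv> frechet_derivative f (at x)"

lemma fd_eq: "(f has_derivative f') (at x) \<Longrightarrow> fd f x = f'"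
  using frechet_derivative_at by metis

lemma fd_works: "f differentiable (at x) \<Longrightarrow> (f has_derivative fd f x) (at x)"
  by (simp add: frechet_derivative_works)

lemma differentiable_cong_open:
  assumes "open S" "x \<in> S" "\<And>y. y \<in> S \<Longrightarrow> f y = g y"
  shows "f differentiable (at x) \<longleftrightarrow> g differentiable (at x)"
  using assms unfolding differentiable_def
  by (metis has_derivative_transform_within_open)

text \<open>The predicate \<open>Ck_on\<close> and all chart expressions use derivatives at points of an open set, so two maps
that agree there may be exchanged although they are unrelated elsewhere. This is how the
arbitrary values of \<open>chart_inv\<close> outside a chart are kept harmless.\<close>

lemma fd_cong_open:
  assumes "open S" "x \<in> S" "\<And>y. y \<in> S \<Longrightarrow> f y = g y"
  shows "fd f x = fd g x"
proof -
  have "(f has_derivative f') (at x) \<longleftrightarrow> (g has_derivative f') (at x)" for f'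
    using assms by (metis has_derivative_transform_within_open)
  then show ?thesis unfolding frechet_derivative_def by simp
qed

text \<open>The mean value theorem, applied to \<open>s \<mapsto> f(x + su + tv) - f(x + su)\<close> on \<open>[0, t]\<close>, turns the second
difference into \<open>t\<close> times a difference of values of \<open>y \<mapsto> Df(y)u\<close>, and that is \<open>t\<close> times the
derivative in direction \<open>v\<close> up to \<open>o(t)\<close>.\<close>

lemma second_difference_quotient:
  fixes f :: "'b::real_normed_vector \<Rightarrow> real"
  assumes S: "open S" "x \<in> S" and f: "\<And>y. y \<in> S \<Longrightarrow> f differentiable (at y)"
    and D: "(\<lambda>y. fd f y u) differentiable (at x)"
  shows "((\<lambda>t. (f (x + t *\<^sub>R u + t *\<^sub>R v) - f (x + t *\<^sub>R u) - f (x + t *\<^sub>R v) + f x) / t\<^sup>2)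
           \<longlongrightarrow> fd (\<lambda>y. fd f y u) x v) (at_right 0)"
proof (rule tendstoI)
  fix e :: real assume e: "e > 0"
  define L where "L = fd (\<lambda>y. fd f y u) x"
  define K where "K = norm u + norm v + 1"
  have K: "K > 0" "norm u \<le> K" "norm u + norm v \<le> K" "norm v \<le> K"
    unfolding K_def by (auto intro: add_nonneg_pos)
  have "linear L" unfolding L_def using D by (rule linear_frechet_derivative)
  \<comment> \<open>The error below is \<open>2 e' K\<close>, so this leaves \<open>e / 2\<close>.\<close>
  define e' where "e' = e / (4 * K)"
  have e': "e' > 0" using e K by (simp add: e'_def)
  have "((\<lambda>y. fd f y u) has_derivative L) (at x)"
    unfolding L_def using D by (rule fd_works)
  then obtain d where d: "d > 0"
    "\<And>y. norm (y - x) < d \<Longrightarrow> norm (fd f y u - fd f x u - L (y - x)) \<le> e' * norm (y - x)"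
    unfolding has_derivative_at_alt using e' by blast
  obtain r where r: "r > 0" "ball x r \<subseteq> S" using S openE by blast
  \<comment> \<open>For \<open>t < t0\<close> the points \<open>x + su + tv\<close> stay in \<open>S\<close> and within the range of \<open>d\<close>.\<close>
  define t0 where "t0 = min d r / (K + 1)"
  have t0: "t0 > 0" using d(1) r(1) K(1) by (simp add: t0_def)
  have "dist ((f (x + t *\<^sub>R u + t *\<^sub>R v) - f (x + t *\<^sub>R u) - f (x + t *\<^sub>R v) + f x) / t\<^sup>2) (L v) < e"
    if t: "0 < t" "t < t0" for t
  proof -
    have tK: "t * K < min d r"
    proof -
      have "t * (K + 1) < min d r"
        using t K(1) by (simp add: t0_def pos_less_divide_eq)
      then show ?thesis using t(1) by (simp add: algebra_simps)
    qed
    have nrm: "norm (s *\<^sub>R u + t *\<^sub>R v) \<le> t * K" "norm (s *\<^sub>R u) \<le> t * K" if "0 \<le> s" "s \<le> t" for s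
    proof -
      have "norm (s *\<^sub>R u + t *\<^sub>R v) \<le> s * norm u + t * norm v"
        by (rule norm_triangle_le) (use that t in auto)
      also have "\<dots> \<le> t * norm u + t * norm v"
        using that by (intro add_right_mono mult_right_mono) auto
      also have "\<dots> \<le> t * K" using K(3) t(1) by (simp add: distrib_left [symmetric])
      finally show "norm (s *\<^sub>R u + t *\<^sub>R v) \<le> t * K" .
      have "norm (s *\<^sub>R u) \<le> t * norm u" using that by (auto intro: mult_right_mono)
      also have "\<dots> \<le> t * K" using K(2) t(1) by simp
      finally show "norm (s *\<^sub>R u) \<le> t * K" .
    qed
    have inS: "x + s *\<^sub>R u + t *\<^sub>R v \<in> S" "x + s *\<^sub>R u \<in> S" if "0 \<le> s" "s \<le> t" for s
    proof -
      have "dist x (x + a) = norm a" for a :: 'b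
        using norm_minus_cancel[of a] by (simp only: dist_norm) simp
      then have "x + (s *\<^sub>R u + t *\<^sub>R v) \<in> ball x r" "x + s *\<^sub>R u \<in> ball x r"
        unfolding mem_ball using nrm[OF that] tK by auto
      then show "x + s *\<^sub>R u + t *\<^sub>R v \<in> S" "x + s *\<^sub>R u \<in> S"
        using r(2) by (auto simp: add.assoc)
    qed
    define \<phi> where "\<phi> s = f (x + s *\<^sub>R u + t *\<^sub>R v) - f (x + s *\<^sub>R u)" for s
    have der: "(\<phi> has_real_derivative (fd f (x + s *\<^sub>R u + t *\<^sub>R v) u - fd f (x + s *\<^sub>R u) u)) (at s)"
      if s: "0 \<le> s" "s \<le> t" for s
    proof -
      have 1: "((\<lambda>s. f (x + s *\<^sub>R u + t *\<^sub>R v)) has_derivative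
          (\<lambda>h. fd f (x + s *\<^sub>R u + t *\<^sub>R v) (h *\<^sub>R u))) (at s)"
        by (rule has_derivative_compose[of "\<lambda>s. x + s *\<^sub>R u + t *\<^sub>R v"])
          (auto intro!: derivative_eq_intros fd_works f inS s)
      have 2: "((\<lambda>s. f (x + s *\<^sub>R u)) has_derivative
          (\<lambda>h. fd f (x + s *\<^sub>R u) (h *\<^sub>R u))) (at s)"
        by (rule has_derivative_compose[of "\<lambda>s. x + s *\<^sub>R u"])
          (auto intro!: derivative_eq_intros fd_works f inS s)
      have "linear (fd f (x + s *\<^sub>R u + t *\<^sub>R v))" "linear (fd f (x + s *\<^sub>R u))"
        using f inS s by (auto intro!: linear_frechet_derivative)
      then show ?thesis
        unfolding \<phi>_def has_field_derivative_def
        by (rule_tac has_derivative_eq_rhs[OF has_derivative_diff[OF 1 2]])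
          (auto simp: linear_cmul algebra_simps)
    qed
    obtain \<xi> where \<xi>: "0 < \<xi>" "\<xi> < t"
      "\<phi> t - \<phi> 0 = (t - 0) * (fd f (x + \<xi> *\<^sub>R u + t *\<^sub>R v) u - fd f (x + \<xi> *\<^sub>R u) u)"
      using MVT2[OF t(1), of \<phi> "\<lambda>s. fd f (x + s *\<^sub>R u + t *\<^sub>R v) u - fd f (x + s *\<^sub>R u) u"] der
      by blast
    let ?a = "\<xi> *\<^sub>R u + t *\<^sub>R v" and ?b = "\<xi> *\<^sub>R u"
    have na: "norm ?a \<le> t * K" "norm ?b \<le> t * K" using nrm[of \<xi>] \<xi> by auto
    have A: "\<bar>fd f (x + ?a) u - fd f x u - L ?a\<bar> \<le> e' * (t * K)"
      using d(2)[of "x + ?a"] mult_left_mono[OF na(1), of e'] na(1) tK e' by (simp only: add_diff_cancel_left' real_norm_def) linarith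
    have B: "\<bar>fd f (x + ?b) u - fd f x u - L ?b\<bar> \<le> e' * (t * K)"
      using d(2)[of "x + ?b"] mult_left_mono[OF na(2), of e'] na(2) tK e' by (simp only: add_diff_cancel_left' real_norm_def) linarith
    have Lab: "L ?a = L ?b + t * L v"
      using \<open>linear L\<close> by (simp add: linear_add linear_cmul)
    have AB: "\<bar>(fd f (x + ?a) u - fd f (x + ?b) u) - t * L v\<bar> \<le> 2 * e' * t * K"
      using A B Lab by (simp add: abs_le_iff)
    have "f (x + t *\<^sub>R u + t *\<^sub>R v) - f (x + t *\<^sub>R u) - f (x + t *\<^sub>R v) + f x = \<phi> t - \<phi> 0"
      by (simp add: \<phi>_def)
    also have "\<dots> = t * (fd f (x + ?a) u - fd f (x + ?b) u)"
      using \<xi>(3) by (simp add: add.assoc)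
    finally have num: "f (x + t *\<^sub>R u + t *\<^sub>R v) - f (x + t *\<^sub>R u) - f (x + t *\<^sub>R v) + f x
        = t * (fd f (x + ?a) u - fd f (x + ?b) u)" .
    have eq: "(f (x + t *\<^sub>R u + t *\<^sub>R v) - f (x + t *\<^sub>R u) - f (x + t *\<^sub>R v) + f x) / t\<^sup>2 - L v
        = ((fd f (x + ?a) u - fd f (x + ?b) u) - t * L v) / t"
      unfolding num using t(1) by (simp add: field_simps power2_eq_square)
    have "\<bar>((fd f (x + ?a) u - fd f (x + ?b) u) - t * L v) / t\<bar> \<le> 2 * e' * K"
      using AB t(1) by (simp add: abs_divide pos_divide_le_eq mult.commute mult.left_commute)
    also have "\<dots> < e" using e K by (simp add: e'_def)
    finally show ?thesis using eq by (simp add: dist_real_def)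
  qed
  then show "\<forall>\<^sub>F t in at_right 0. dist ((f (x + t *\<^sub>R u + t *\<^sub>R v) - f (x + t *\<^sub>R u) - f (x + t *\<^sub>R v) + f x)
      / t\<^sup>2) (fd (\<lambda>y. fd f y u) x v) < e"
    unfolding eventually_at_right_field L_def[symmetric] using t0 by blast
qed

lemma fd_linear_compose:
  assumes "bounded_linear L" "f differentiable (at x)"
  shows "fd (\<lambda>x. L (f x)) x v = L (fd f x v)"
  using fd_eq[OF bounded_linear.has_derivative[OF assms(1) fd_works[OF assms(2)]]] by simp

text \<open>The second difference of \<open>second_difference_quotient\<close> is symmetric in \<open>u\<close> and \<open>v\<close>, hence so is its
limit. Vector valued maps are treated by components.\<close>

lemma second_derivative_symmetric:
  fixes f :: "'b::real_normed_vector \<Rightarrow> 'e::euclidean_space"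
  assumes S: "open S" "x \<in> S" and f: "\<And>y. y \<in> S \<Longrightarrow> f differentiable (at y)"
    and D: "\<And>v. (\<lambda>y. fd f y v) differentiable (at x)"
  shows "fd (\<lambda>y. fd f y u) x v = fd (\<lambda>y. fd f y v) x u"
proof (rule euclidean_eqI)
  fix b :: 'e assume "b \<in> Basis"
  let ?f = "\<lambda>y. f y \<bullet> b"
  have f': "?f differentiable (at y)" if "y \<in> S" for y
    using f[OF that] by (auto intro: differentiable_compose bounded_linear_imp_differentiable bounded_linear_inner_left)
  have fd1: "fd ?f y v = fd f y v \<bullet> b" if "y \<in> S" for y v
    using fd_linear_compose[OF bounded_linear_inner_left f[OF that]] by simp
  have D': "(\<lambda>y. fd f y v \<bullet> b) differentiable (at x)" for v
    using D[of v] by (auto intro: differentiable_compose bounded_linear_imp_differentiable bounded_linear_inner_left)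
  have D1: "(\<lambda>y. fd ?f y v) differentiable (at x)" for v
    using D'[of v] differentiable_cong_open[OF S, of "\<lambda>y. fd ?f y v" "\<lambda>y. fd f y v \<bullet> b"] fd1 by simp
  have fd2: "fd (\<lambda>y. fd ?f y u) x v = fd (\<lambda>y. fd f y u) x v \<bullet> b" for u v
  proof -
    have "fd (\<lambda>y. fd ?f y u) x v = fd (\<lambda>y. fd f y u \<bullet> b) x v"
      using fd_cong_open[OF S, of "\<lambda>y. fd ?f y u" "\<lambda>y. fd f y u \<bullet> b"] fd1 by simp
    then show ?thesis by (simp add: fd_linear_compose[OF bounded_linear_inner_left D])
  qed
  have lim: "((\<lambda>t. (?f (x + t *\<^sub>R u + t *\<^sub>R v) - ?f (x + t *\<^sub>R u) - ?f (x + t *\<^sub>R v) + ?f x) / t\<^sup>2)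
           \<longlongrightarrow> fd (\<lambda>y. fd ?f y u) x v) (at_right 0)" for u v
    by (rule second_difference_quotient[OF S f' D1])
  have eq: "(\<lambda>t. (?f (x + t *\<^sub>R v + t *\<^sub>R u) - ?f (x + t *\<^sub>R v) - ?f (x + t *\<^sub>R u) + ?f x) / t\<^sup>2) =
    (\<lambda>t. (?f (x + t *\<^sub>R u + t *\<^sub>R v) - ?f (x + t *\<^sub>R u) - ?f (x + t *\<^sub>R v) + ?f x) / t\<^sup>2)"
    by (rule ext) (simp add: add_ac diff_diff_eq)
  show "fd (\<lambda>y. fd f y u) x v \<bullet> b = fd (\<lambda>y. fd f y v) x u \<bullet> b"
    unfolding fd2[symmetric]
    by (rule tendsto_unique[OF _ lim[of u v] lim[of v u, unfolded eq]]) simp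
qed

lemma Ck_on_cong:
  assumes "open S" "\<And>x. x \<in> S \<Longrightarrow> f x = g x"
  shows "Ck_on k S f \<longleftrightarrow> Ck_on k S g"
  using assms(2)
proof (induction k arbitrary: f g)
  case 0
  then show ?case by (auto cong: continuous_on_cong)
next
  case (Suc k)
  have "fd f x = fd g x" if "x \<in> S" for x
    using fd_cong_open[OF assms(1) that] Suc.prems by blast
  then have "Ck_on k S (\<lambda>x. fd f x v) \<longleftrightarrow> Ck_on k S (\<lambda>x. fd g x v)" for v
    by (intro Suc.IH) auto
  moreover have "f differentiable (at x) \<longleftrightarrow> g differentiable (at x)" if "x \<in> S" for x
    using differentiable_cong_open[OF assms(1) that] Suc.prems by blast
  ultimately show ?case by auto
qed

lemma Ck_on_Suc_imp: "Ck_on (Suc k) S f \<Longrightarrow> Ck_on k S f"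
proof (induction k arbitrary: f)
  case 0
  then show ?case
    by (auto intro!: continuous_at_imp_continuous_on differentiable_imp_continuous_within)
next
  case (Suc k)
  then show ?case using Suc.IH by fastforce
qed

lemma Ck_on_subset: "Ck_on k S f \<Longrightarrow> T \<subseteq> S \<Longrightarrow> Ck_on k T f"
  by (induction k arbitrary: f) (auto intro: continuous_on_subset)

lemma Ck_on_const: "Ck_on k S (\<lambda>x. c)"
  by (induction k arbitrary: c) auto

lemma Ck_on_linear_compose:
  assumes "open S" "bounded_linear L" "Ck_on k S f"
  shows "Ck_on k S (\<lambda>x. L (f x))"
  using assms(3)
proof (induction k arbitrary: f)
  case 0
  then show ?case using assms(2) by (auto intro: bounded_linear.continuous_on)
next
  case (Suc k)
  have "fd (\<lambda>x. L (f x)) x v = L (fd f x v)" if "x \<in> S" for x v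
    using fd_linear_compose[OF assms(2)] Suc.prems that by auto
  then have "Ck_on k S (\<lambda>x. fd (\<lambda>x. L (f x)) x v)" for v
    using Suc by (subst Ck_on_cong[OF assms(1), where g = "\<lambda>x. L (fd f x v)"]) auto
  moreover have "(\<lambda>x. L (f x)) differentiable (at x)" if "x \<in> S" for x
    using Suc.prems that assms(2)
    by (auto intro: differentiable_compose bounded_linear_imp_differentiable)
  ultimately show ?case by auto
qed

lemma Ck_on_add:
  assumes "open S" "Ck_on k S f" "Ck_on k S g"
  shows "Ck_on k S (\<lambda>x. f x + g x)"
  using assms(2,3)
proof (induction k arbitrary: f g)
  case 0
  then show ?case by (auto intro: continuous_intros)
next
  case (Suc k)
  have "fd (\<lambda>x. f x + g x) x v = fd f x v + fd g x v" if "x \<in> S" for x v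
    using fd_eq[OF has_derivative_add[OF fd_works fd_works], of f x g] Suc.prems that by auto
  then have "Ck_on k S (\<lambda>x. fd (\<lambda>x. f x + g x) x v)" for v
    using Suc by (subst Ck_on_cong[OF assms(1), where g = "\<lambda>x. fd f x v + fd g x v"]) auto
  then show ?case using Suc.prems by auto
qed

lemma Ck_on_scaleR:
  assumes "open S" "Ck_on k S f" "Ck_on k S g"
  shows "Ck_on k S (\<lambda>x. f x *\<^sub>R g x)"
  using assms(2,3)
proof (induction k arbitrary: f g)
  case 0
  then show ?case by (auto intro: continuous_intros)
next
  case (Suc k)
  have *: "fd (\<lambda>x. f x *\<^sub>R g x) x v = f x *\<^sub>R fd g x v + fd f x v *\<^sub>R g x" if "x \<in> S" for x v
    using fd_eq[OF has_derivative_scaleR[OF fd_works fd_works], of f x g] Suc.prems that by auto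
  have "Ck_on k S (\<lambda>x. f x *\<^sub>R fd g x v + fd f x v *\<^sub>R g x)" for v
    by (intro Ck_on_add[OF assms(1)] Suc.IH) (use Suc.prems Ck_on_Suc_imp in auto)
  then have "Ck_on k S (\<lambda>x. fd (\<lambda>x. f x *\<^sub>R g x) x v)" for v
    using * by (subst Ck_on_cong[OF assms(1)]) auto
  moreover have "(\<lambda>x. f x *\<^sub>R g x) differentiable (at x)" if "x \<in> S" for x
    using differentiable_scaleR[of f x UNIV g] Suc.prems that by simp
  ultimately show ?case by auto
qed

lemma Ck_on_sum:
  assumes "open S" "finite I" "\<And>i. i \<in> I \<Longrightarrow> Ck_on k S (f i)"
  shows "Ck_on k S (\<lambda>x. \<Sum>i\<in>I. f i x)"
  using assms(2,3)
  by (induction I rule: finite_induct) (auto intro: Ck_on_const Ck_on_add[OF assms(1)])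

text \<open>The chain rule is expanded in a basis, \<open>D(f \<circ> g)(x)v = \<Sum>\<^sub>b (Dg(x)v)\<^sub>b Df(g x)b\<close>, so that only
derivatives in constant directions occur and the induction on \<open>k\<close> applies to each of them.\<close>

lemma Ck_on_compose:
  fixes f :: "'b::euclidean_space \<Rightarrow> 'e::real_normed_vector" and g :: "'c::euclidean_space \<Rightarrow> 'b"
  assumes "open S" "open T" "Ck_on k S f" "Ck_on k T g" "g ` T \<subseteq> S"
  shows "Ck_on k T (\<lambda>x. f (g x))"
  using assms(3,4)
proof (induction k arbitrary: f)
  case 0
  then show ?case using assms(5) by (auto intro: continuous_on_compose2)
next
  case (Suc k)
  have d: "((\<lambda>x. f (g x)) has_derivative (\<lambda>v. fd f (g x) (fd g x v))) (at x)" if "x \<in> T" for x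
    using has_derivative_compose[OF fd_works fd_works, of g x f] Suc.prems that assms(5) by auto
  have *: "fd (\<lambda>x. f (g x)) x v = (\<Sum>b\<in>Basis. (fd g x v \<bullet> b) *\<^sub>R fd f (g x) b)" if "x \<in> T" for x v
  proof -
    have lin: "linear (fd f (g x))"
      using Suc.prems that assms(5) by (auto intro!: linear_frechet_derivative)
    have "fd (\<lambda>x. f (g x)) x v = fd f (g x) (fd g x v)" using fd_eq[OF d[OF that]] by simp
    also have "\<dots> = fd f (g x) (\<Sum>b\<in>Basis. (fd g x v \<bullet> b) *\<^sub>R b)"
      by (simp add: euclidean_representation)
    finally show ?thesis by (simp add: linear_sum[OF lin] linear_cmul[OF lin])
  qed
  have "Ck_on k T (\<lambda>x. \<Sum>b\<in>Basis. (fd g x v \<bullet> b) *\<^sub>R fd f (g x) b)" for v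
    by (intro Ck_on_sum Ck_on_scaleR Ck_on_linear_compose[OF _ bounded_linear_inner_left] Suc.IH)
      (use Suc.prems assms(2) Ck_on_Suc_imp in auto)
  then have "Ck_on k T (\<lambda>x. fd (\<lambda>x. f (g x)) x v)" for v
    using * by (subst Ck_on_cong[OF assms(2)]) auto
  moreover have "(\<lambda>x. f (g x)) differentiable (at x)" if "x \<in> T" for x
    using d[OF that] by (auto simp: differentiable_def)
  ultimately show ?case by auto
qed

lemma smooth_on_cong:
  "open S \<Longrightarrow> (\<And>x. x \<in> S \<Longrightarrow> f x = g x) \<Longrightarrow> smooth_on S f \<longleftrightarrow> smooth_on S g"
  unfolding smooth_on_def using Ck_on_cong by blast

lemma smooth_on_subset: "smooth_on S f \<Longrightarrow> T \<subseteq> S \<Longrightarrow> smooth_on T f"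
  unfolding smooth_on_def using Ck_on_subset by blast

lemma smooth_on_const: "smooth_on S (\<lambda>x. c)"
  unfolding smooth_on_def by (simp add: Ck_on_const)

lemma smooth_on_linear_compose:
  "open S \<Longrightarrow> bounded_linear L \<Longrightarrow> smooth_on S f \<Longrightarrow> smooth_on S (\<lambda>x. L (f x))"
  unfolding smooth_on_def by (simp add: Ck_on_linear_compose)

lemma smooth_on_add:
  "open S \<Longrightarrow> smooth_on S f \<Longrightarrow> smooth_on S g \<Longrightarrow> smooth_on S (\<lambda>x. f x + g x)"
  unfolding smooth_on_def by (simp add: Ck_on_add)

lemma smooth_on_scaleR:
  "open S \<Longrightarrow> smooth_on S f \<Longrightarrow> smooth_on S g \<Longrightarrow> smooth_on S (\<lambda>x. f x *\<^sub>R g x)"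
  unfolding smooth_on_def by (simp add: Ck_on_scaleR)

lemma smooth_on_sum:
  "open S \<Longrightarrow> finite I \<Longrightarrow> (\<And>i. i \<in> I \<Longrightarrow> smooth_on S (f i)) \<Longrightarrow> smooth_on S (\<lambda>x. \<Sum>i\<in>I. f i x)"
  unfolding smooth_on_def by (simp add: Ck_on_sum)

lemma smooth_on_compose:
  fixes f :: "'b::euclidean_space \<Rightarrow> 'e::real_normed_vector" and g :: "'c::euclidean_space \<Rightarrow> 'b"
  assumes "open S" "open T" "smooth_on S f" "smooth_on T g" "g ` T \<subseteq> S"
  shows "smooth_on T (\<lambda>x. f (g x))"
  using assms unfolding smooth_on_def by (blast intro: Ck_on_compose)

lemma smooth_on_fd: "smooth_on S f \<Longrightarrow> smooth_on S (\<lambda>x. fd f x v)"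
  unfolding smooth_on_def by (metis Ck_on.simps(2))

lemma smooth_on_differentiable: "smooth_on S f \<Longrightarrow> x \<in> S \<Longrightarrow> f differentiable (at x)"
  unfolding smooth_on_def by (metis Ck_on.simps(2))

lemma smooth_on_id: "smooth_on S id"
proof -
  have "Ck_on k S id" for k
    by (cases k) (auto simp: Ck_on_const id_def)
  then show ?thesis by (simp add: smooth_on_def)
qed

section \<open>Connections on an open subset of a Euclidean space\<close>

lemma bilinear_expansion:
  fixes B :: "'b::euclidean_space \<Rightarrow> 'd::euclidean_space \<Rightarrow> 'e::real_vector"
  assumes "bilinear B"
  shows "B u v = (\<Sum>i\<in>Basis. \<Sum>j\<in>Basis. ((u \<bullet> i) * (v \<bullet> j)) *\<^sub>R B i j)"
proof -
  have lin: "linear (\<lambda>u. B u v)" "linear (B u)" for u v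
    using assms unfolding bilinear_def by auto
  have "B u v = B (\<Sum>i\<in>Basis. (u \<bullet> i) *\<^sub>R i) v" by (simp add: euclidean_representation)
  also have "\<dots> = (\<Sum>i\<in>Basis. (u \<bullet> i) *\<^sub>R B i v)"
    by (simp add: linear_sum[OF lin(1)] linear_cmul[OF lin(1)])
  also have "\<dots> = (\<Sum>i\<in>Basis. (u \<bullet> i) *\<^sub>R B i (\<Sum>j\<in>Basis. (v \<bullet> j) *\<^sub>R j))"
    by (simp add: euclidean_representation)
  also have "\<dots> = (\<Sum>i\<in>Basis. \<Sum>j\<in>Basis. ((u \<bullet> i) * (v \<bullet> j)) *\<^sub>R B i j)"
    by (simp only: linear_sum[OF lin(2)] linear_cmul[OF lin(2)] scaleR_sum_right scaleR_scaleR)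
  finally show ?thesis .
qed

text \<open>Product rule for a bilinear operation that depends on the base point, such as a metric or the
connection coefficients.\<close>

lemma has_derivative_bilinear_field:
  fixes B :: "'s::real_normed_vector \<Rightarrow> 'b::euclidean_space \<Rightarrow> 'd::euclidean_space \<Rightarrow> 'e::real_normed_vector"
  assumes S: "open S" "x \<in> S" and bil: "\<And>y. y \<in> S \<Longrightarrow> bilinear (B y)"
    and dB: "\<And>a b. (\<lambda>y. B y a b) differentiable (at x)"
    and u: "(u has_derivative u') (at x)" and v: "(v has_derivative v') (at x)"
  shows "((\<lambda>y. B y (u y) (v y)) has_derivative
      (\<lambda>h. fd (\<lambda>y. B y (u x) (v x)) x h + B x (u' h) (v x) + B x (u x) (v' h))) (at x)"
proof -
  note exp = bilinear_expansion[OF bil]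
  have ui: "((\<lambda>y. u y \<bullet> i) has_derivative (\<lambda>h. u' h \<bullet> i)) (at x)" for i
    by (rule bounded_linear.has_derivative[OF bounded_linear_inner_left u])
  have vi: "((\<lambda>y. v y \<bullet> i) has_derivative (\<lambda>h. v' h \<bullet> i)) (at x)" for i
    by (rule bounded_linear.has_derivative[OF bounded_linear_inner_left v])
  note Bi = fd_works[OF dB]
  have fdB: "fd (\<lambda>y. B y a b) x h = (\<Sum>i\<in>Basis. \<Sum>j\<in>Basis. ((a \<bullet> i) * (b \<bullet> j)) *\<^sub>R fd (\<lambda>y. B y i j) x h)"
    for a b h
  proof -
    have "((\<lambda>y. \<Sum>i\<in>Basis. \<Sum>j\<in>Basis. ((a \<bullet> i) * (b \<bullet> j)) *\<^sub>R B y i j) has_derivative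
       (\<lambda>h. \<Sum>i\<in>Basis. \<Sum>j\<in>Basis. ((a \<bullet> i) * (b \<bullet> j)) *\<^sub>R fd (\<lambda>y. B y i j) x h)) (at x)"
      by (intro has_derivative_sum has_derivative_scaleR_right Bi)
    from has_derivative_transform_within_open[OF this S exp[symmetric]]
    show ?thesis using fd_eq by fastforce
  qed
  have *: "((\<lambda>y. \<Sum>i\<in>Basis. \<Sum>j\<in>Basis. ((u y \<bullet> i) * (v y \<bullet> j)) *\<^sub>R B y i j) has_derivative
       (\<lambda>h. \<Sum>i\<in>Basis. \<Sum>j\<in>Basis. ((u x \<bullet> i) * (v x \<bullet> j)) *\<^sub>R fd (\<lambda>y. B y i j) x h
          + ((u x \<bullet> i) * (v' h \<bullet> j) + (u' h \<bullet> i) * (v x \<bullet> j)) *\<^sub>R B x i j)) (at x)"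
    by (intro has_derivative_sum has_derivative_scaleR has_derivative_mult ui vi Bi)
  have eq: "(\<Sum>i\<in>Basis. \<Sum>j\<in>Basis. ((u x \<bullet> i) * (v x \<bullet> j)) *\<^sub>R fd (\<lambda>y. B y i j) x h
          + ((u x \<bullet> i) * (v' h \<bullet> j) + (u' h \<bullet> i) * (v x \<bullet> j)) *\<^sub>R B x i j)
      = fd (\<lambda>y. B y (u x) (v x)) x h + B x (u' h) (v x) + B x (u x) (v' h)" for h
    unfolding fdB[of "u x" "v x" h] exp[OF S(2), of "u' h" "v x"] exp[OF S(2), of "u x" "v' h"]
    by (simp add: sum.distrib[symmetric] algebra_simps)
  show ?thesis
    using has_derivative_transform_within_open[OF * S exp[symmetric]] unfolding eq .
qed

lemma has_derivative_linear_field: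
  fixes L :: "'s::real_normed_vector \<Rightarrow> 'd::euclidean_space \<Rightarrow> 'e::real_normed_vector"
  assumes S: "open S" "x \<in> S" and lin: "\<And>y. y \<in> S \<Longrightarrow> linear (L y)"
    and dL: "\<And>a. (\<lambda>y. L y a) differentiable (at x)"
    and v: "(v has_derivative v') (at x)"
  shows "((\<lambda>y. L y (v y)) has_derivative (\<lambda>h. fd (\<lambda>y. L y (v x)) x h + L x (v' h))) (at x)"
proof -
  have "((\<lambda>y. (1::real) *\<^sub>R L y (v y)) has_derivative
      (\<lambda>h. fd (\<lambda>y. 1 *\<^sub>R L y (v x)) x h + 0 *\<^sub>R L x (v x) + 1 *\<^sub>R L x (v' h))) (at x)"
    by (rule has_derivative_bilinear_field[OF S _ _ has_derivative_const v])
      (use lin dL in \<open>auto simp: bilinear_def linear_iff algebra_simps\<close>)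
  then show ?thesis by simp
qed

text \<open>Here \<open>\<Gamma> x u v\<close> stands for the covariant derivative, in the direction \<open>u\<close>, of the field with constant
components \<open>v\<close>; the bracket of two constant fields vanishes.\<close>

definition chart_curvature ::
  "('b::real_normed_vector \<Rightarrow> 'b \<Rightarrow> 'b \<Rightarrow> 'b) \<Rightarrow> 'b \<Rightarrow> 'b \<Rightarrow> 'b \<Rightarrow> 'b \<Rightarrow> 'b" where
  "chart_curvature \<Gamma> x u v w =
     fd (\<lambda>y. \<Gamma> y v w) x u - fd (\<lambda>y. \<Gamma> y u w) x v + \<Gamma> x u (\<Gamma> x v w) - \<Gamma> x v (\<Gamma> x u w)"

text \<open>The covariant derivative, in the direction \<open>a\<close>, of a vector field \<open>V\<close> along the map \<open>F\<close>. For \<open>F = id\<close> it is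
the ordinary covariant derivative.\<close>

definition pullback_deriv ::
  "('b::real_normed_vector \<Rightarrow> 'b \<Rightarrow> 'b \<Rightarrow> 'b) \<Rightarrow> ('c::real_normed_vector \<Rightarrow> 'b) \<Rightarrow> ('c \<Rightarrow> 'b) \<Rightarrow> 'c \<Rightarrow> 'c \<Rightarrow> 'b" where
  "pullback_deriv \<Gamma> F V x a = fd V x a + \<Gamma> (F x) (fd F x a) (V x)"

text \<open>The algebra behind the uniqueness of a torsion free metric connection: going around the six
permutations of the arguments changes the sign. It will be applied to the difference of two
candidate connections.\<close>

lemma symmetric_antisymmetric_zero:
  fixes T :: "'c \<Rightarrow> 'c \<Rightarrow> 'c \<Rightarrow> real"
  assumes sym: "\<And>a b c. T a b c = T b a c" and anti: "\<And>a b c. T a b c = - T a c b"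
  shows "T a b c = 0"
proof -
  have "T a b c = - T a b c"
    using sym anti by metis
  then show ?thesis by simp
qed

text \<open>Besides its use in the Bochner identity, this makes the trace of an endomorphism independent of the
chart that represents the tangent space.\<close>

lemma endo_trace_commute:
  fixes f :: "'b::euclidean_space \<Rightarrow> 'c::euclidean_space"
  assumes f: "linear f" and g: "linear g"
  shows "endo_trace (\<lambda>x. f (g x)) = endo_trace (\<lambda>x. g (f x))"
proof -
  have "endo_trace (\<lambda>x. f (g x)) = (\<Sum>b\<in>Basis. f (\<Sum>c\<in>Basis. (g b \<bullet> c) *\<^sub>R c) \<bullet> b)"
    unfolding endo_trace_def by (simp add: euclidean_representation)
  also have "\<dots> = (\<Sum>b\<in>Basis. \<Sum>c\<in>Basis. (g b \<bullet> c) * (f c \<bullet> b))"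
    by (simp add: linear_sum[OF f] linear_cmul[OF f] inner_sum_left)
  also have "\<dots> = (\<Sum>c\<in>Basis. \<Sum>b\<in>Basis. (g b \<bullet> c) * (f c \<bullet> b))"
    by (rule sum.swap)
  also have "\<dots> = (\<Sum>c\<in>Basis. g (\<Sum>b\<in>Basis. (f c \<bullet> b) *\<^sub>R b) \<bullet> c)"
    by (simp add: linear_sum[OF g] linear_cmul[OF g] inner_sum_left mult.commute)
  also have "\<dots> = endo_trace (\<lambda>x. g (f x))"
    unfolding endo_trace_def by (simp add: euclidean_representation)
  finally show ?thesis .
qed

locale local_connection =
  fixes S :: "'b::euclidean_space set" and \<Gamma> :: "'b \<Rightarrow> 'b \<Rightarrow> 'b \<Rightarrow> 'b"
  assumes open_S: "open S"
    and \<Gamma>_bil: "x \<in> S \<Longrightarrow> bilinear (\<Gamma> x)"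
    and \<Gamma>_sym: "x \<in> S \<Longrightarrow> \<Gamma> x u v = \<Gamma> x v u"
    and \<Gamma>_diff: "x \<in> S \<Longrightarrow> (\<lambda>x. \<Gamma> x u v) differentiable (at x)"
begin

lemmas \<Gamma>_simps =
  bilinear_ladd[OF \<Gamma>_bil] bilinear_radd[OF \<Gamma>_bil] bilinear_lmul[OF \<Gamma>_bil] bilinear_rmul[OF \<Gamma>_bil]
  bilinear_lneg[OF \<Gamma>_bil] bilinear_rneg[OF \<Gamma>_bil] bilinear_lsub[OF \<Gamma>_bil] bilinear_rsub[OF \<Gamma>_bil]
  bilinear_lzero[OF \<Gamma>_bil] bilinear_rzero[OF \<Gamma>_bil]

lemma linear_\<Gamma>: "x \<in> S \<Longrightarrow> linear (\<Gamma> x u)" "x \<in> S \<Longrightarrow> linear (\<lambda>u. \<Gamma> x u v)"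
  using \<Gamma>_bil by (auto simp: bilinear_def)

abbreviation "curv \<equiv> chart_curvature \<Gamma>"

lemma \<Gamma>_along:
  fixes F :: "'c::euclidean_space \<Rightarrow> 'b"
  assumes T: "open T" "x \<in> T" "F ` T \<subseteq> S" "F differentiable (at x)"
    and u: "(u has_derivative u') (at x)" and v: "(v has_derivative v') (at x)"
  shows "((\<lambda>y. \<Gamma> (F y) (u y) (v y)) has_derivative
     (\<lambda>h. fd (\<lambda>z. \<Gamma> z (u x) (v x)) (F x) (fd F x h) + \<Gamma> (F x) (u' h) (v x) + \<Gamma> (F x) (u x) (v' h))) (at x)"
proof -
  have FS: "F y \<in> S" if "y \<in> T" for y using that T by auto
  have d: "((\<lambda>y. \<Gamma> (F y) a b) has_derivative (\<lambda>h. fd (\<lambda>z. \<Gamma> z a b) (F x) (fd F x h))) (at x)" for a b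
    by (rule has_derivative_compose[OF fd_works[OF T(4)] fd_works[OF \<Gamma>_diff[OF FS[OF T(2)]]]])
  have "((\<lambda>y. \<Gamma> (F y) (u y) (v y)) has_derivative
     (\<lambda>h. fd (\<lambda>y. \<Gamma> (F y) (u x) (v x)) x h + \<Gamma> (F x) (u' h) (v x) + \<Gamma> (F x) (u x) (v' h))) (at x)"
    by (rule has_derivative_bilinear_field[OF T(1,2) _ _ u v])
      (use \<Gamma>_bil FS differentiableI[OF d] in auto)
  then show ?thesis unfolding fd_eq[OF d] .
qed

lemma pullback_deriv_differentiable:
  fixes F :: "'c::euclidean_space \<Rightarrow> 'b"
  assumes T: "open T" "x \<in> T" "F ` T \<subseteq> S" and F: "smooth_on T F" and V: "smooth_on T V"
  shows "((\<lambda>y. pullback_deriv \<Gamma> F V y b) has_derivative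
     (\<lambda>a. fd (\<lambda>y. fd V y b) x a + (fd (\<lambda>z. \<Gamma> z (fd F x b) (V x)) (F x) (fd F x a)
        + \<Gamma> (F x) (fd (\<lambda>y. fd F y b) x a) (V x) + \<Gamma> (F x) (fd F x b) (fd V x a)))) (at x)"
  unfolding pullback_deriv_def
  by (intro has_derivative_add \<Gamma>_along[OF T] fd_works smooth_on_differentiable[OF _ T(2)] smooth_on_fd F V)

text \<open>The curvature of the pulled back connection is the pullback of the curvature: the second derivatives
of \<open>F\<close> and of \<open>V\<close> cancel by symmetry.\<close>

lemma pullback_curvature:
  fixes F :: "'c::euclidean_space \<Rightarrow> 'b"
  assumes T: "open T" "x \<in> T" "F ` T \<subseteq> S" and F: "smooth_on T F" and V: "smooth_on T V"
  shows "pullback_deriv \<Gamma> F (\<lambda>y. pullback_deriv \<Gamma> F V y b) x a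
       - pullback_deriv \<Gamma> F (\<lambda>y. pullback_deriv \<Gamma> F V y a) x b
       = curv (F x) (fd F x a) (fd F x b) (V x)"
proof -
  have x: "F x \<in> S" using T by auto
  have "fd (\<lambda>y. fd F y a) x b = fd (\<lambda>y. fd F y b) x a"
    by (intro second_derivative_symmetric[OF T(1,2)])
      (use F smooth_on_differentiable smooth_on_fd T(2) in blast)+
  moreover have "fd (\<lambda>y. fd V y a) x b = fd (\<lambda>y. fd V y b) x a"
    by (intro second_derivative_symmetric[OF T(1,2)])
      (use V smooth_on_differentiable smooth_on_fd T(2) in blast)+
  ultimately show ?thesis
    unfolding pullback_deriv_def[of \<Gamma> F _ x] fd_eq[OF pullback_deriv_differentiable[OF T F V]] chart_curvature_def
    by (simp add: pullback_deriv_def \<Gamma>_simps[OF x])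
qed

lemma curvature_multilinear:
  assumes x: "x \<in> S"
  shows "linear (\<lambda>u. curv x u v w)" "linear (\<lambda>v. curv x u v w)" "linear (\<lambda>w. curv x u v w)"
    and "curv x v u w = - curv x u v w"
proof -
  have fl: "linear (fd (\<lambda>y. \<Gamma> y v w) x)" for v w
    by (rule linear_frechet_derivative[OF \<Gamma>_diff[OF x]])
  have fdl: "fd (\<lambda>y. \<Gamma> y (u + v) w) x h = fd (\<lambda>y. \<Gamma> y u w) x h + fd (\<lambda>y. \<Gamma> y v w) x h"
     "fd (\<lambda>y. \<Gamma> y w (u + v)) x h = fd (\<lambda>y. \<Gamma> y w u) x h + fd (\<lambda>y. \<Gamma> y w v) x h"
     "fd (\<lambda>y. \<Gamma> y (c *\<^sub>R u) w) x h = c *\<^sub>R fd (\<lambda>y. \<Gamma> y u w) x h"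
     "fd (\<lambda>y. \<Gamma> y w (c *\<^sub>R u)) x h = c *\<^sub>R fd (\<lambda>y. \<Gamma> y w u) x h" for u v w h c
  proof -
    note d = fd_works[OF \<Gamma>_diff[OF x]]
    have "fd (\<lambda>y. \<Gamma> y (u + v) w) x = fd (\<lambda>y. \<Gamma> y u w + \<Gamma> y v w) x"
      "fd (\<lambda>y. \<Gamma> y w (u + v)) x = fd (\<lambda>y. \<Gamma> y w u + \<Gamma> y w v) x"
      "fd (\<lambda>y. \<Gamma> y (c *\<^sub>R u) w) x = fd (\<lambda>y. c *\<^sub>R \<Gamma> y u w) x"
      "fd (\<lambda>y. \<Gamma> y w (c *\<^sub>R u)) x = fd (\<lambda>y. c *\<^sub>R \<Gamma> y w u) x"
      by (intro fd_cong_open[OF open_S x]; simp add: \<Gamma>_simps)+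
    then show "fd (\<lambda>y. \<Gamma> y (u + v) w) x h = fd (\<lambda>y. \<Gamma> y u w) x h + fd (\<lambda>y. \<Gamma> y v w) x h"
     "fd (\<lambda>y. \<Gamma> y w (u + v)) x h = fd (\<lambda>y. \<Gamma> y w u) x h + fd (\<lambda>y. \<Gamma> y w v) x h"
     "fd (\<lambda>y. \<Gamma> y (c *\<^sub>R u) w) x h = c *\<^sub>R fd (\<lambda>y. \<Gamma> y u w) x h"
     "fd (\<lambda>y. \<Gamma> y w (c *\<^sub>R u)) x h = c *\<^sub>R fd (\<lambda>y. \<Gamma> y w u) x h"
      using fd_eq[OF has_derivative_add[OF d d]] fd_eq[OF has_derivative_scaleR_right[OF d]] by simp_all
  qed
  show "linear (\<lambda>u. curv x u v w)" "linear (\<lambda>v. curv x u v w)" "linear (\<lambda>w. curv x u v w)"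
    unfolding linear_iff chart_curvature_def
    by (auto simp: fdl \<Gamma>_simps[OF x] linear_add[OF fl] linear_cmul[OF fl] algebra_simps)
  show "curv x v u w = - curv x u v w" by (simp add: chart_curvature_def)
qed

end

locale local_metric_connection = local_connection S \<Gamma>
  for S :: "'b::euclidean_space set" and \<Gamma> +
  fixes G :: "'b::euclidean_space \<Rightarrow> 'b \<Rightarrow> 'b \<Rightarrow> real"
  assumes G_bil: "x \<in> S \<Longrightarrow> bilinear (G x)"
    and G_sym: "x \<in> S \<Longrightarrow> G x u v = G x v u"
    and G_diff: "x \<in> S \<Longrightarrow> (\<lambda>x. G x u v) differentiable (at x)"
    and compat: "x \<in> S \<Longrightarrow> fd (\<lambda>x. G x v w) x u = G x (\<Gamma> x u v) w + G x v (\<Gamma> x u w)"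
begin

lemmas G_simps =
  bilinear_ladd[OF G_bil] bilinear_radd[OF G_bil] bilinear_lmul[OF G_bil] bilinear_rmul[OF G_bil]
  bilinear_lneg[OF G_bil] bilinear_rneg[OF G_bil] bilinear_lsub[OF G_bil] bilinear_rsub[OF G_bil]
  bilinear_lzero[OF G_bil] bilinear_rzero[OF G_bil]

lemma pullback_compat:
  fixes F :: "'c::euclidean_space \<Rightarrow> 'b"
  assumes T: "open T" "x \<in> T" "F ` T \<subseteq> S" "F differentiable (at x)"
    and V: "V differentiable (at x)" and W: "W differentiable (at x)"
  shows "((\<lambda>y. G (F y) (V y) (W y)) has_derivative
     (\<lambda>a. G (F x) (pullback_deriv \<Gamma> F V x a) (W x) + G (F x) (V x) (pullback_deriv \<Gamma> F W x a))) (at x)"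
proof -
  have FS: "F y \<in> S" if "y \<in> T" for y using that T by auto
  have d: "((\<lambda>y. G (F y) a b) has_derivative (\<lambda>h. fd (\<lambda>z. G z a b) (F x) (fd F x h))) (at x)" for a b
    by (rule has_derivative_compose[OF fd_works[OF T(4)] fd_works[OF G_diff[OF FS[OF T(2)]]]])
  have "((\<lambda>y. G (F y) (V y) (W y)) has_derivative
     (\<lambda>h. fd (\<lambda>y. G (F y) (V x) (W x)) x h + G (F x) (fd V x h) (W x) + G (F x) (V x) (fd W x h))) (at x)"
    by (rule has_derivative_bilinear_field[OF T(1,2) _ _ fd_works[OF V] fd_works[OF W]])
      (use G_bil FS differentiableI[OF d] in auto)
  then show ?thesis
    unfolding fd_eq[OF d] compat[OF FS[OF T(2)]] pullback_deriv_def
    by (rule has_derivative_eq_rhs) (simp add: fun_eq_iff G_simps[OF FS[OF T(2)]])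
qed

text \<open>Second derivatives of the function \<open>y \<mapsto> G y w z\<close> commute. Metric compatibility rewrites each of them
as four terms, two of which are symmetric in the directions and drop out.\<close>

lemma curvature_skew:
  assumes x: "x \<in> S"
  shows "G x (curv x u v w) z = - G x (curv x u v z) w"
proof -
  have id: "id ` S \<subseteq> S" "id differentiable (at x)" for x :: 'b
    by (auto simp: id_def)
  have sc: "smooth_on S (\<lambda>x. c)" "smooth_on S (id :: 'b \<Rightarrow> 'b)" for c :: 'b
    by (rule smooth_on_const smooth_on_id)+
  define N where "N w v y = pullback_deriv \<Gamma> id (\<lambda>y. w) y v" for w v y
  have dN: "N w v differentiable (at x)" for w v
    unfolding N_def[abs_def]
    by (rule differentiableI[OF pullback_deriv_differentiable[OF open_S x id(1) sc(2) sc(1)]])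
  let ?f = "\<lambda>y. G y w z"
  have d1: "(?f has_derivative (\<lambda>v. G y (N w v y) z + G y w (N z v y))) (at y)" if "y \<in> S" for y
    using pullback_compat[OF open_S that id(1) id(2), of "\<lambda>y. w" "\<lambda>y. z"] by (simp add: N_def)
  have d2: "((\<lambda>y. G y (N w v y) z + G y w (N z v y)) has_derivative
     (\<lambda>u. (G x (pullback_deriv \<Gamma> id (N w v) x u) z + G x (N w v x) (N z u x)) +
          (G x (N w u x) (N z v x) + G x w (pullback_deriv \<Gamma> id (N z v) x u)))) (at x)" for v
    using has_derivative_add[OF pullback_compat[OF open_S x id dN[of w v] differentiable_const[of z]]
       pullback_compat[OF open_S x id differentiable_const[of w] dN[of z v]]]
    by (simp add: N_def)
  have fd1: "fd ?f y v = G y (N w v y) z + G y w (N z v y)" if "y \<in> S" for y v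
    using fd_eq[OF d1[OF that]] by simp
  have D: "(\<lambda>y. fd ?f y v) differentiable (at x)" for v
    using d2[of v] differentiable_cong_open[OF open_S x, of "\<lambda>y. fd ?f y v"] fd1
    by (auto simp: differentiable_def)
  have fd2: "fd (\<lambda>y. fd ?f y v) x u = (G x (pullback_deriv \<Gamma> id (N w v) x u) z + G x (N w v x) (N z u x)) +
          (G x (N w u x) (N z v x) + G x w (pullback_deriv \<Gamma> id (N z v) x u))" for u v
    using fd_cong_open[OF open_S x, of "\<lambda>y. fd ?f y v"] fd1 fd_eq[OF d2[of v]] by simp
  have sym: "fd (\<lambda>y. fd ?f y v) x u = fd (\<lambda>y. fd ?f y u) x v"
    by (rule second_derivative_symmetric[OF open_S x _ D]) (use d1 in \<open>auto simp: differentiable_def\<close>)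
  have cv: "curv x u v w = pullback_deriv \<Gamma> id (N w v) x u - pullback_deriv \<Gamma> id (N w u) x v" for w
    using pullback_curvature[OF open_S x id(1) sc(2) sc(1), of w v u] by (simp add: N_def[abs_def])
  show ?thesis
    using sym unfolding fd2 cv by (simp add: G_simps[OF x] G_sym[OF x, of _ w])
qed

end

section \<open>A closed unitary field in a chart\<close>

text \<open>The assumption \<open>E_closed\<close> is \<open>d\<omega> = 0\<close> for the dual form \<open>\<omega> = G(E, \<cdot>)\<close>: for a torsion free metric
connection \<open>d\<omega>(u, v) = G(\<nabla>\<^sub>uE, v) - G(\<nabla>\<^sub>vE, u)\<close>.\<close>

locale closed_unit_field = local_metric_connection S \<Gamma> G
  for S :: "'b::euclidean_space set" and \<Gamma> and G +
  fixes E :: "'b \<Rightarrow> 'b"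
  assumes G_pos: "x \<in> S \<Longrightarrow> u \<noteq> 0 \<Longrightarrow> G x u u > 0"
    and E_smooth: "smooth_on S E"
    and E_unit: "x \<in> S \<Longrightarrow> G x (E x) (E x) = 1"
    and E_closed: "x \<in> S \<Longrightarrow>
      G x (fd E x u + \<Gamma> x u (E x)) v = G x u (fd E x v + \<Gamma> x v (E x))"
begin

definition A :: "'b \<Rightarrow> 'b \<Rightarrow> 'b" where
  "A x u = fd E x u + \<Gamma> x u (E x)"

abbreviation h :: "'b \<Rightarrow> 'b \<Rightarrow> 'b \<Rightarrow> real" where
  "h x u v \<equiv> G x (A x u) v"

lemma linear_A: "x \<in> S \<Longrightarrow> linear (A x)"
  unfolding A_def using E_smooth
  by (intro linear_compose_add linear_\<Gamma> linear_frechet_derivative smooth_on_differentiable)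

lemma A_sym: "x \<in> S \<Longrightarrow> h x u v = h x v u"
  using E_closed[of x u v] G_sym[of x] by (simp add: A_def)

lemma pullback_E:
  fixes F :: "'c::euclidean_space \<Rightarrow> 'b"
  assumes "F x \<in> S" "F differentiable (at x)"
  shows "pullback_deriv \<Gamma> F (\<lambda>y. E (F y)) x a = A (F x) (fd F x a)"
  using fd_eq[OF has_derivative_compose[OF fd_works fd_works], of F x E] assms
    smooth_on_differentiable[OF E_smooth]
  by (simp add: pullback_deriv_def A_def)

lemma id_facts: "id ` S \<subseteq> S" "(id :: 'b \<Rightarrow> 'b) differentiable (at x)"
  by (auto simp: id_def)

lemma h_E: 
  assumes x: "x \<in> S"
  shows "h x u (E x) = 0" "h x (E x) u = 0"
proof -
  have "((\<lambda>y. G y (E y) (E y)) has_derivative (\<lambda>u. G x (A x u) (E x) + G x (E x) (A x u))) (at x)"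
    using pullback_compat[OF open_S x id_facts, of E E] smooth_on_differentiable[OF E_smooth x]
      pullback_E[of id x] x by (simp add: id_def)
  moreover have "((\<lambda>y. G y (E y) (E y)) has_derivative (\<lambda>u. 0)) (at x)"
    by (rule has_derivative_transform_within_open[OF _ open_S x, of "\<lambda>y. 1"]) (use E_unit in auto)
  ultimately have "(\<lambda>u. G x (A x u) (E x) + G x (E x) (A x u)) = (\<lambda>u. 0)"
    by (rule has_derivative_unique)
  then have "G x (A x u) (E x) + G x (E x) (A x u) = 0" by (rule fun_cong)
  then show "h x u (E x) = 0" by (simp add: G_sym[OF x, of "E x"])
  then show "h x (E x) u = 0" using A_sym[OF x] by simp
qed

lemma A_E: "x \<in> S \<Longrightarrow> A x (E x) = 0"
  using h_E(2)[of x "A x (E x)"] G_pos[of x "A x (E x)"] by force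

lemma A_differentiable:
  assumes x: "x \<in> S"
  shows "(\<lambda>y. A y v) differentiable (at x)"
  using pullback_deriv_differentiable[OF open_S x id_facts(1) smooth_on_id E_smooth, of v]
  by (auto simp: differentiable_def pullback_deriv_def A_def)

text \<open>This is \<open>(\<nabla>\<^sub>uA)v - (\<nabla>\<^sub>vA)u = R\<^bsub>uv\<^esub>E\<close> for constant fields \<open>u\<close> and \<open>v\<close>, that is,
\<open>pullback_curvature\<close> for the field \<open>E\<close> and the identity map.\<close>

lemma codazzi:
  assumes x: "x \<in> S"
  shows "fd (\<lambda>y. A y v) x u + \<Gamma> x u (A x v) - (fd (\<lambda>y. A y u) x v + \<Gamma> x v (A x u)) = curv x u v (E x)"
proof -
  have "pullback_deriv \<Gamma> id E y a = A y a" for y a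
    by (simp add: pullback_deriv_def A_def)
  then show ?thesis
    using pullback_curvature[OF open_S x id_facts(1) smooth_on_id E_smooth, of v u]
    by (simp add: pullback_deriv_def)
qed

text \<open>Take \<open>v = E\<close> in the Codazzi equation. Since \<open>A(E)\<close> vanishes identically, the derivative of \<open>A\<close> applied to
the fixed vector \<open>E x\<close> is \<open>- A(DE)\<close>; the trace of the remaining terms is \<open>tr A\<^sup>2\<close> and the derivative of \<open>tr A\<close>,
because \<open>A = DE + \<Gamma>(\<cdot>, E)\<close> and the trace of a product does not depend on the order.\<close>

lemma bochner:
  assumes x: "x \<in> S"
  shows "endo_trace (\<lambda>b. curv x b (E x) (E x)) =
     - endo_trace (\<lambda>b. A x (A x b)) - fd (\<lambda>y. endo_trace (A y)) x (E x)"
proof -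
  note lA = linear_A[OF x]
  note E' = smooth_on_differentiable[OF E_smooth x]
  have lE: "linear (fd E x)" by (rule linear_frechet_derivative[OF E'])
  have 1: "fd (\<lambda>y. A y (E x)) x b + A x (fd E x b) = 0" for b
  proof -
    have "((\<lambda>y. A y (E y)) has_derivative (\<lambda>b. fd (\<lambda>y. A y (E x)) x b + A x (fd E x b))) (at x)"
      by (rule has_derivative_linear_field[OF open_S x linear_A A_differentiable[OF x] fd_works[OF E']])
    moreover have "((\<lambda>y. A y (E y)) has_derivative (\<lambda>u. 0)) (at x)"
      by (rule has_derivative_transform_within_open[OF _ open_S x, of "\<lambda>y. 0"]) (use A_E in auto)
    ultimately have "(\<lambda>b. fd (\<lambda>y. A y (E x)) x b + A x (fd E x b)) = (\<lambda>u. 0)"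
      by (rule has_derivative_unique)
    then show ?thesis by (rule fun_cong)
  qed
  have cv: "curv x b (E x) (E x) = - A x (fd E x b) - fd (\<lambda>y. A y b) x (E x) - \<Gamma> x (E x) (A x b)" for b
    using codazzi[OF x, of "E x" b, symmetric] 1[of b] by (simp add: A_E[OF x] \<Gamma>_simps[OF x] eq_neg_iff_add_eq_0[symmetric])
  have tr: "fd (\<lambda>y. endo_trace (A y)) x (E x) = (\<Sum>b\<in>Basis. fd (\<lambda>y. A y b) x (E x) \<bullet> b)"
  proof -
    have "((\<lambda>y. endo_trace (A y)) has_derivative (\<lambda>e. \<Sum>b\<in>Basis. fd (\<lambda>y. A y b) x e \<bullet> b)) (at x)"
      unfolding endo_trace_def
      by (intro has_derivative_sum bounded_linear.has_derivative[OF bounded_linear_inner_left]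
          fd_works A_differentiable[OF x])
    from fd_eq[OF this] show ?thesis by simp
  qed
  have "endo_trace (\<lambda>b. \<Gamma> x (E x) (A x b)) = endo_trace (\<lambda>b. A x (\<Gamma> x (E x) b))"
    by (rule endo_trace_commute[OF linear_\<Gamma>(1)[OF x] lA])
  moreover have "endo_trace (\<lambda>b. A x (A x b)) =
      endo_trace (\<lambda>b. A x (fd E x b)) + endo_trace (\<lambda>b. A x (\<Gamma> x (E x) b))"
  proof -
    have "A x (A x b) = A x (fd E x b) + A x (\<Gamma> x (E x) b)" for b
      unfolding linear_add[OF lA, symmetric] A_def[of x b] by (simp add: \<Gamma>_sym[OF x, of b])
    then show ?thesis unfolding endo_trace_def by (simp add: inner_add_left sum.distrib)
  qed
  ultimately show ?thesis
    unfolding tr cv unfolding endo_trace_def by (simp add: inner_diff_left inner_minus_left sum_subtractf sum_negf)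
qed

text \<open>Let \<open>\<nabla>\<close> be the derivative along \<open>F\<close> and \<open>K = DF(\<Gamma>'(b, c))\<close>. By hypothesis
\<open>\<nabla>\<^sub>b(DF c) = K - \<kappa> h(b, c) E\<close>. Differentiating once more in the direction \<open>a\<close> and antisymmetrising
turns the left side into \<open>R\<close> (\<open>pullback_curvature\<close>) and the derivative of \<open>K\<close> into \<open>DF(R')\<close>; the
derivative of \<open>E\<close> gives the terms with \<open>A\<close>. The coefficient of \<open>E\<close> contains the derivative of
\<open>h(b, c) = G(\<nabla>\<^sub>bE, DF c)\<close>, whose antisymmetric part is \<open>G(R\<^bsub>ab\<^esub>E, DF c)\<close> after the terms
\<open>h(a, \<Gamma>'(b, c))\<close> and \<open>h(b, \<Gamma>'(a, c))\<close> cancel. No term quadratic in \<open>\<kappa>\<close> survives because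
\<open>h(\<cdot>, E) = 0\<close>.\<close>

lemma related_curvature:
  fixes F :: "'c::euclidean_space \<Rightarrow> 'b" and \<Gamma>' :: "'c \<Rightarrow> 'c \<Rightarrow> 'c \<Rightarrow> 'c"
  assumes T: "F ` T \<subseteq> S" "smooth_on T F" and conn': "local_connection T \<Gamma>'"
    and rel: "\<And>y a b. y \<in> T \<Longrightarrow> fd F y (\<Gamma>' y a b) =
       pullback_deriv \<Gamma> F (\<lambda>y. fd F y b) y a + (\<kappa> * h (F y) (fd F y a) (fd F y b)) *\<^sub>R E (F y)"
    and x: "x \<in> T"
  shows "fd F x (chart_curvature \<Gamma>' x a b c) =
     curv (F x) (fd F x a) (fd F x b) (fd F x c)
     + (\<kappa> * G (F x) (curv (F x) (fd F x a) (fd F x b) (E (F x))) (fd F x c)) *\<^sub>R E (F x)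
     + \<kappa> *\<^sub>R (h (F x) (fd F x b) (fd F x c) *\<^sub>R A (F x) (fd F x a)
          - h (F x) (fd F x a) (fd F x c) *\<^sub>R A (F x) (fd F x b))"
proof -
  interpret L: local_connection T \<Gamma>' by (rule conn')
  note oT = L.open_S
  have FS: "F y \<in> S" if "y \<in> T" for y using that T(1) by auto
  note sx = FS[OF x]
  have dF: "F differentiable (at y)" if "y \<in> T" for y
    using smooth_on_differentiable[OF T(2) that] .
  have ddF: "(\<lambda>y. fd F y c) differentiable (at y)" if "y \<in> T" for y c
    using smooth_on_differentiable[OF smooth_on_fd[OF T(2)] that] .
  have linF: "linear (fd F y)" if "y \<in> T" for y
    by (rule linear_frechet_derivative[OF dF[OF that]])
  define EF where "EF y = E (F y)" for y
  have sEF: "smooth_on T EF" unfolding EF_def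
    by (rule smooth_on_compose[OF open_S oT E_smooth T(2,1)])
  have dEF: "EF differentiable (at x)" using smooth_on_differentiable[OF sEF x] .
  define P where "P V y a = pullback_deriv \<Gamma> F V y a" for V y a
  have PE: "P EF y a = A (F y) (fd F y a)" if "y \<in> T" for y a
    unfolding P_def EF_def by (rule pullback_E[OF FS[OF that] dF[OF that]])
  have dP: "(\<lambda>y. P V y a) differentiable (at x)" if "smooth_on T V" for V a
    unfolding P_def by (rule differentiableI[OF pullback_deriv_differentiable[OF oT x T that]])
  define H where "H b y = G (F y) (P EF y b) (fd F y c)" for b y
  have H: "H b y = h (F y) (fd F y b) (fd F y c)" if "y \<in> T" for b y
    by (simp add: H_def PE[OF that])
  define K where "K b y = fd F y (\<Gamma>' y b c)" for b y
  have W: "P (\<lambda>y. fd F y c) y b = K b y - (\<kappa> * H b y) *\<^sub>R EF y" if "y \<in> T" for b y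
    using rel[OF that, of b c] by (simp add: P_def K_def H[OF that] EF_def)
  have dK: "(K b has_derivative (\<lambda>a. fd (\<lambda>y. fd F y (\<Gamma>' x b c)) x a + fd F x (fd (\<lambda>y. \<Gamma>' y b c) x a))) (at x)" for b
    unfolding K_def
    by (rule has_derivative_linear_field[OF oT x linF ddF[OF x] fd_works[OF L.\<Gamma>_diff[OF x]]])
  have PK: "P (K b) x a = fd F x (fd (\<lambda>y. \<Gamma>' y b c) x a + \<Gamma>' x a (\<Gamma>' x b c))
      - (\<kappa> * h (F x) (fd F x a) (fd F x (\<Gamma>' x b c))) *\<^sub>R EF x" for a b
    using rel[OF x, of a "\<Gamma>' x b c"]
    by (simp add: P_def pullback_deriv_def fd_eq[OF dK] K_def EF_def linear_add[OF linF[OF x]])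
  have Gg: "G (F x) (P EF x b) (P (\<lambda>y. fd F y c) x a) = h (F x) (fd F x b) (fd F x (\<Gamma>' x a c))" for a b
    by (simp add: W[OF x] PE[OF x] K_def EF_def G_simps[OF sx] h_E[OF sx])
  have dH: "(H b has_derivative (\<lambda>a. G (F x) (P (\<lambda>y. P EF y b) x a) (fd F x c)
        + h (F x) (fd F x b) (fd F x (\<Gamma>' x a c)))) (at x)" for b
    using pullback_compat[OF oT x T(1) dF[OF x] dP[OF sEF] ddF[OF x], of b c] Gg
    unfolding H_def[abs_def] P_def by simp
  have PP: "P (\<lambda>y. P (\<lambda>y. fd F y c) y b) x a = P (K b) x a
      - (\<kappa> * fd (H b) x a) *\<^sub>R EF x - (\<kappa> * H b x) *\<^sub>R P EF x a" for a b
  proof -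
    have d: "((\<lambda>y. K b y - (\<kappa> * H b y) *\<^sub>R EF y) has_derivative
       (\<lambda>a. fd (K b) x a - ((\<kappa> * H b x) *\<^sub>R fd EF x a + (\<kappa> * fd (H b) x a) *\<^sub>R EF x))) (at x)"
      using dK dH dEF
      by (intro has_derivative_diff has_derivative_scaleR has_derivative_mult_right fd_works)
        (auto intro: differentiableI)
    have "fd (\<lambda>y. P (\<lambda>y. fd F y c) y b) x a
       = fd (K b) x a - ((\<kappa> * H b x) *\<^sub>R fd EF x a + (\<kappa> * fd (H b) x a) *\<^sub>R EF x)"
      using fd_cong_open[OF oT x W] fd_eq[OF d] by simp
    then have "P (\<lambda>y. P (\<lambda>y. fd F y c) y b) x a
      = fd (K b) x a - ((\<kappa> * H b x) *\<^sub>R fd EF x a + (\<kappa> * fd (H b) x a) *\<^sub>R EF x)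
        + \<Gamma> (F x) (fd F x a) (K b x - (\<kappa> * H b x) *\<^sub>R EF x)"
      unfolding P_def[of "\<lambda>y. P (\<lambda>y. fd F y c) y b"] pullback_deriv_def W[OF x] by simp
    then show ?thesis
      by (simp add: P_def pullback_deriv_def \<Gamma>_simps[OF sx] scaleR_add_right)
  qed
  have c1: "P (\<lambda>y. P (\<lambda>y. fd F y c) y b) x a - P (\<lambda>y. P (\<lambda>y. fd F y c) y a) x b
      = curv (F x) (fd F x a) (fd F x b) (fd F x c)"
    unfolding P_def by (rule pullback_curvature[OF oT x T smooth_on_fd[OF T(2)]])
  have c2: "P (\<lambda>y. P EF y b) x a = curv (F x) (fd F x a) (fd F x b) (EF x) + P (\<lambda>y. P EF y a) x b"
    using pullback_curvature[OF oT x T sEF, of b a] unfolding P_def by (simp add: diff_eq_eq)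
  have fdH: "fd (H b) x a = G (F x) (P (\<lambda>y. P EF y b) x a) (fd F x c)
        + h (F x) (fd F x b) (fd F x (\<Gamma>' x a c))" for a b
    using fd_eq[OF dH[of b]] by simp
  have cv: "fd F x (chart_curvature \<Gamma>' x a b c) =
      fd F x (fd (\<lambda>y. \<Gamma>' y b c) x a + \<Gamma>' x a (\<Gamma>' x b c)) - fd F x (fd (\<lambda>y. \<Gamma>' y a c) x b + \<Gamma>' x b (\<Gamma>' x a c))"
    by (simp add: chart_curvature_def linear_diff[OF linF[OF x]] linear_add[OF linF[OF x]])
  have H2: "fd (H b) x a + h (F x) (fd F x a) (fd F x (\<Gamma>' x b c))
      - (fd (H a) x b + h (F x) (fd F x b) (fd F x (\<Gamma>' x a c)))
      = G (F x) (curv (F x) (fd F x a) (fd F x b) (EF x)) (fd F x c)"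
    unfolding fdH c2 by (simp add: G_simps[OF sx])
  have "fd F x (chart_curvature \<Gamma>' x a b c) = 
     (P (\<lambda>y. P (\<lambda>y. fd F y c) y b) x a - P (\<lambda>y. P (\<lambda>y. fd F y c) y a) x b)
     + (\<kappa> * (fd (H b) x a + h (F x) (fd F x a) (fd F x (\<Gamma>' x b c))
      - (fd (H a) x b + h (F x) (fd F x b) (fd F x (\<Gamma>' x a c))))) *\<^sub>R EF x
     + \<kappa> *\<^sub>R (H b x *\<^sub>R P EF x a - H a x *\<^sub>R P EF x b)"
    unfolding cv PP PK by (simp add: algebra_simps)
  then show ?thesis
    unfolding c1 H2 H[OF x] PE[OF x] by (simp add: EF_def)
qed

definition GL :: "'b \<Rightarrow> 'b \<Rightarrow> 'b \<Rightarrow> real" where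
  "GL x u v = G x u v - 2 * (G x (E x) u * G x (E x) v)"

lemma GL_has_derivative:
  assumes x: "x \<in> S"
  shows "((\<lambda>x. GL x v w) has_derivative (\<lambda>u. G x (\<Gamma> x u v) w + G x v (\<Gamma> x u w)
      - 2 * (G x (E x) v * (h x u w + G x (E x) (\<Gamma> x u w))
           + (h x u v + G x (E x) (\<Gamma> x u v)) * G x (E x) w))) (at x)"
proof -
  have d: "((\<lambda>y. G y (E y) v) has_derivative (\<lambda>u. h x u v + G x (E x) (\<Gamma> x u v))) (at x)" for v
    using pullback_compat[OF open_S x id_facts, of E "\<lambda>y. v"] smooth_on_differentiable[OF E_smooth x]
    by (simp add: pullback_deriv_def A_def)
  have g: "((\<lambda>y. G y v w) has_derivative (\<lambda>u. G x (\<Gamma> x u v) w + G x v (\<Gamma> x u w))) (at x)"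
    using fd_works[OF G_diff[OF x], of v w] by (rule has_derivative_eq_rhs) (simp add: fun_eq_iff compat[OF x])
  show ?thesis
    unfolding GL_def by (intro has_derivative_diff has_derivative_mult_right has_derivative_mult d g)
qed

lemma fd_GL:
  "x \<in> S \<Longrightarrow> fd (\<lambda>x. GL x v w) x u = G x (\<Gamma> x u v) w + G x v (\<Gamma> x u w)
      - 2 * (G x (E x) v * (h x u w + G x (E x) (\<Gamma> x u w))
           + (h x u v + G x (E x) (\<Gamma> x u v)) * G x (E x) w)"
  using fd_eq[OF GL_has_derivative] by simp

text \<open>The right-hand side is torsion free because \<open>h\<close> is symmetric. It is compatible with the varied metric
because that metric pairs \<open>2 h(u, v) E\<close> with \<open>w\<close> to \<open>- 2 h(u, v) \<omega>(w)\<close>, which is exactly what the derivative of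
\<open>- 2 \<omega> \<otimes> \<omega>\<close> contributes. So the difference \<open>t\<close> of the two connections vanishes when paired with anything.\<close>

lemma variation_connection:
  assumes conn': "local_connection S \<Gamma>'"
    and compat': "\<And>x u v w. x \<in> S \<Longrightarrow>
      fd (\<lambda>x. GL x v w) x u = GL x (\<Gamma>' x u v) w + GL x v (\<Gamma>' x u w)"
    and x: "x \<in> S"
  shows "\<Gamma>' x u v = \<Gamma> x u v + (2 * h x u v) *\<^sub>R E x"
proof -
  interpret L: local_connection S \<Gamma>' by (rule conn')
  define t where "t u v = \<Gamma>' x u v - \<Gamma> x u v - (2 * h x u v) *\<^sub>R E x" for u v
  note dGL = fd_GL[OF x]
  have E1: "G x (E x) (E x) = 1" by (rule E_unit[OF x])
  have "GL x (t u v) w = 0" for u v w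
  proof (rule symmetric_antisymmetric_zero[of "\<lambda>u v w. GL x (t u v) w"])
    show "GL x (t a b) c = GL x (t b a) c" for a b c
      by (simp add: t_def \<Gamma>_sym[OF x, of a] L.\<Gamma>_sym[OF x, of a] A_sym[OF x, of a])
    show "GL x (t a b) c = - GL x (t a c) b" for a b c
      using dGL[of b c a] unfolding compat'[OF x]
      by (simp add: t_def GL_def G_simps[OF x] E1 G_sym[OF x, of b "\<Gamma>' x a c"]
          G_sym[OF x, of b "\<Gamma> x a c"] G_sym[OF x, of b "E x"] algebra_simps)
  qed
  \<comment> \<open>Pairing in the varied metric with the reflection of \<open>t u v\<close> in \<open>E\<close> gives its length for \<open>G\<close>.\<close>
  from this[of u v "t u v - (2 * G x (E x) (t u v)) *\<^sub>R E x"]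
  have "G x (t u v) (t u v) = 0"
    by (simp add: GL_def G_simps[OF x] E1 G_sym[OF x, of "t u v" "E x"] algebra_simps)
  then have "t u v = 0" using G_pos[OF x] by force
  then show ?thesis by (simp add: t_def algebra_simps)
qed

text \<open>The Gauss formula. Differentiating \<open>G(E, DF b) = 0\<close> shows that the right-hand side is orthogonal to \<open>E\<close>,
hence tangent to the image; paired with tangent vectors, the difference \<open>t\<close> of the two sides is
symmetric in the first two slots and skew in the last two.\<close>

lemma leaf_connection:
  fixes F :: "'c::euclidean_space \<Rightarrow> 'b" and \<Gamma>' :: "'c \<Rightarrow> 'c \<Rightarrow> 'c \<Rightarrow> 'c"
  assumes T: "F ` T \<subseteq> S" "smooth_on T F" and conn': "local_connection T \<Gamma>'"
    and range: "\<And>y. y \<in> T \<Longrightarrow> range (fd F y) = {w. G (F y) (E (F y)) w = 0}"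
    and compat': "\<And>y a b c. y \<in> T \<Longrightarrow>
      fd (\<lambda>y. G (F y) (fd F y b) (fd F y c)) y a
      = G (F y) (fd F y (\<Gamma>' y a b)) (fd F y c) + G (F y) (fd F y b) (fd F y (\<Gamma>' y a c))"
    and x: "x \<in> T"
  shows "fd F x (\<Gamma>' x a b) =
     pullback_deriv \<Gamma> F (\<lambda>y. fd F y b) x a + h (F x) (fd F x a) (fd F x b) *\<^sub>R E (F x)"
proof -
  interpret L: local_connection T \<Gamma>' by (rule conn')
  note oT = L.open_S
  have FS: "F y \<in> S" if "y \<in> T" for y using that T(1) by auto
  note sx = FS[OF x]
  have dF: "F differentiable (at x)" using smooth_on_differentiable[OF T(2) x] .
  have ddF: "(\<lambda>y. fd F y c) differentiable (at x)" for c
    using smooth_on_differentiable[OF smooth_on_fd[OF T(2)] x] .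
  have linF: "linear (fd F x)" by (rule linear_frechet_derivative[OF dF])
  have orth: "G (F y) (E (F y)) (fd F y c) = 0" if "y \<in> T" for y c
    using range[OF that] by blast
  define P where "P b a = pullback_deriv \<Gamma> F (\<lambda>y. fd F y b) x a" for b a
  have Psym: "P b a = P a b" for a b
  proof -
    have "fd (\<lambda>y. fd F y a) x b = fd (\<lambda>y. fd F y b) x a"
      by (intro second_derivative_symmetric[OF oT x])
       (use T smooth_on_differentiable ddF in blast)+
    then show ?thesis
      by (simp add: P_def pullback_deriv_def \<Gamma>_sym[OF sx, of "fd F x a"])
  qed
  have PE: "G (F x) (E (F x)) (P b a) = - h (F x) (fd F x a) (fd F x b)" for a b
  proof -
    have "((\<lambda>y. G (F y) (E (F y)) (fd F y b)) has_derivative (\<lambda>a. h (F x) (fd F x a) (fd F x b)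
        + G (F x) (E (F x)) (P b a))) (at x)"
      using pullback_compat[OF oT x T(1) dF _ ddF, of "\<lambda>y. E (F y)" b]
        pullback_E[OF sx dF] smooth_on_differentiable[OF smooth_on_compose[OF open_S oT E_smooth T(2,1)] x]
      by (simp add: P_def)
    moreover have "((\<lambda>y. G (F y) (E (F y)) (fd F y b)) has_derivative (\<lambda>u. 0)) (at x)"
      by (rule has_derivative_transform_within_open[OF _ oT x, of "\<lambda>y. 0"]) (use orth in auto)
    ultimately have "(\<lambda>a. h (F x) (fd F x a) (fd F x b) + G (F x) (E (F x)) (P b a)) = (\<lambda>u. 0)"
      by (rule has_derivative_unique)
    from fun_cong[OF this, of a] show ?thesis by simp
  qed
  define t where "t a b = fd F x (\<Gamma>' x a b) - P b a - h (F x) (fd F x a) (fd F x b) *\<^sub>R E (F x)" for a b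
  have zero: "G (F x) (t a b) (fd F x c) = 0" for a b c
  proof (rule symmetric_antisymmetric_zero[of "\<lambda>a b c. G (F x) (t a b) (fd F x c)"])
    show "G (F x) (t a b) (fd F x c) = G (F x) (t b a) (fd F x c)" for a b c
      by (simp add: t_def Psym[of b] L.\<Gamma>_sym[OF x, of a] A_sym[OF sx, of "fd F x a"])
    show "G (F x) (t a b) (fd F x c) = - G (F x) (t a c) (fd F x b)" for a b c
      using fd_eq[OF pullback_compat[OF oT x T(1) dF ddF ddF, of b c]] compat'[OF x, of b c a]
      by (simp add: t_def G_simps[OF sx] orth[OF x] P_def[symmetric] G_sym[OF sx, of "fd F x b"])
  qed
  have "G (F x) (E (F x)) (t a b) = 0"
    by (simp add: t_def G_simps[OF sx] orth[OF x] PE E_unit[OF sx])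
  then obtain d where "t a b = fd F x d" using range[OF x] by blast
  then have "t a b = 0" using zero[of a b d] G_pos[OF sx, of "t a b"] by force
  then show ?thesis by (simp add: t_def P_def algebra_simps)
qed

end

section \<open>Charts, fields and connections on a manifold\<close>

text \<open>The map \<open>J c q\<close> converts tangent vectors at \<open>q\<close>, which are represented in the preferred chart at \<open>q\<close>, to
components in the chart \<open>c\<close>; its inverse is \<open>\<lambda>u. coord_field M c u q\<close>.\<close>

locale smooth_mfd =
  fixes M :: "('a, 'b::euclidean_space) manifold"
  assumes manifold: "smooth_manifold M"
begin

abbreviation J :: "('a, 'b) chart \<Rightarrow> 'a \<Rightarrow> 'b \<Rightarrow> 'b" where
  "J c q \<equiv> mdiff M (snd c) q"

definition transition :: "('a, 'b) chart \<Rightarrow> ('a, 'b) chart \<Rightarrow> 'b \<Rightarrow> 'b" where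
  "transition c c' = snd c' \<circ> chart_inv c"

lemma chart_at: "p \<in> points M \<Longrightarrow> chart_at M p \<in> atlas M" "p \<in> points M \<Longrightarrow> p \<in> fst (chart_at M p)"
proof -
  assume "p \<in> points M"
  then have "\<exists>c. c \<in> atlas M \<and> p \<in> fst c"
    using manifold unfolding smooth_manifold_def by blast
  from someI_ex[OF this] show "chart_at M p \<in> atlas M" "p \<in> fst (chart_at M p)"
    unfolding chart_at_def by auto
qed

lemma chart_open: "c \<in> atlas M \<Longrightarrow> openin (mtop M) (fst c)"
  using manifold unfolding smooth_manifold_def by blast

lemma chart_points: "c \<in> atlas M \<Longrightarrow> q \<in> fst c \<Longrightarrow> q \<in> points M"
  using chart_open openin_subset by blast

lemma chart_homeo:
  "c \<in> atlas M \<Longrightarrow> homeomorphic_map (subtopology (mtop M) (fst c)) (top_of_set (snd c ` fst c)) (snd c)"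
  using manifold unfolding smooth_manifold_def by blast

lemma chart_image_open:
  assumes "c \<in> atlas M" "openin (mtop M) W"
  shows "open (snd c ` (fst c \<inter> W))"
proof -
  have "openin (subtopology (mtop M) (fst c)) (fst c \<inter> W)"
    using assms(2) by (auto simp: openin_subtopology)
  then have "openin (top_of_set (snd c ` fst c)) (snd c ` (fst c \<inter> W))"
    using homeomorphic_imp_open_map[OF chart_homeo[OF assms(1)]] by (auto simp: open_map_def)
  moreover have "open (snd c ` fst c)"
    using manifold assms(1) unfolding smooth_manifold_def by blast
  ultimately show ?thesis by (simp add: openin_open_eq)
qed

lemma chart_image_open': "c \<in> atlas M \<Longrightarrow> open (snd c ` fst c)"
  using chart_image_open[of c "fst c"] chart_open by simp

lemma chart_image_open_sub:
  "c \<in> atlas M \<Longrightarrow> openin (mtop M) W \<Longrightarrow> W \<subseteq> fst c \<Longrightarrow> open (snd c ` W)"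
  using chart_image_open[of c W] by (simp add: inf.absorb2)

lemma chart_inj: "c \<in> atlas M \<Longrightarrow> inj_on (snd c) (fst c)"
  using homeomorphic_imp_injective_map[OF chart_homeo] chart_open[THEN openin_subset]
  by (metis inf.absorb2 topspace_subtopology)

lemma chart_inv [simp]: "c \<in> atlas M \<Longrightarrow> q \<in> fst c \<Longrightarrow> chart_inv c (snd c q) = q"
  unfolding chart_inv_def using chart_inj by (simp add: inv_into_f_f)

lemma transition_smooth:
  "c \<in> atlas M \<Longrightarrow> c' \<in> atlas M \<Longrightarrow> smooth_on (snd c ` (fst c \<inter> fst c')) (transition c c')"
  using manifold unfolding smooth_manifold_def transition_def by blast

lemma transition_open:
  "c \<in> atlas M \<Longrightarrow> c' \<in> atlas M \<Longrightarrow> open (snd c ` (fst c \<inter> fst c'))"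
  using chart_image_open chart_open by blast

lemma transition_chart: "c \<in> atlas M \<Longrightarrow> q \<in> fst c \<Longrightarrow> transition c c' (snd c q) = snd c' q"
  by (simp add: transition_def)

lemma transition_differentiable:
  "c \<in> atlas M \<Longrightarrow> c' \<in> atlas M \<Longrightarrow> q \<in> fst c \<Longrightarrow> q \<in> fst c' \<Longrightarrow>
    transition c c' differentiable (at (snd c q))"
  using smooth_on_differentiable[OF transition_smooth] by blast

lemma transition_has_derivative:
  assumes "c \<in> atlas M" "q \<in> fst c" "c' \<in> atlas M" "q \<in> fst c'"
  shows "(snd c' \<circ> chart_inv c has_derivative fd (transition c c') (snd c q)) (at (snd c q))"
  unfolding transition_def[symmetric] by (intro fd_works transition_differentiable assms)

lemma has_derivative_change_chart:
  assumes c: "c \<in> atlas M" "q \<in> fst c" and c': "c' \<in> atlas M" "q \<in> fst c'"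
    and f: "(f \<circ> chart_inv c has_derivative f') (at (snd c q))"
  shows "(f \<circ> chart_inv c' has_derivative (\<lambda>v. f' (fd (transition c' c) (snd c' q) v))) (at (snd c' q))"
proof -
  have "((\<lambda>x. (f \<circ> chart_inv c) (transition c' c x)) has_derivative
      (\<lambda>v. f' (fd (transition c' c) (snd c' q) v))) (at (snd c' q))"
    by (rule has_derivative_compose[OF fd_works[OF transition_differentiable[OF c'(1) c(1) c'(2) c(2)]]])
      (use f in \<open>simp only: transition_chart[OF c']\<close>)
  then show ?thesis
    by (rule has_derivative_transform_within_open[OF _ transition_open[OF c'(1) c(1)]])
      (use c c' in \<open>auto simp: transition_def\<close>)
qed

lemma transition_inverse:
  assumes c: "c \<in> atlas M" "q \<in> fst c" and c': "c' \<in> atlas M" "q \<in> fst c'"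
  shows "fd (transition c c') (snd c q) (fd (transition c' c) (snd c' q) u) = u"
proof -
  from has_derivative_change_chart[OF c c' transition_has_derivative[OF c c']]
  have "(snd c' \<circ> chart_inv c' has_derivative
     (\<lambda>u. fd (transition c c') (snd c q) (fd (transition c' c) (snd c' q) u))) (at (snd c' q))" .
  moreover have "(snd c' \<circ> chart_inv c' has_derivative (\<lambda>u. u)) (at (snd c' q))"
    by (rule has_derivative_transform_within_open[OF has_derivative_ident chart_image_open'[OF c'(1)]])
      (use c' in auto)
  ultimately have "(\<lambda>u. fd (transition c c') (snd c q) (fd (transition c' c) (snd c' q) u)) = (\<lambda>u. u)"
    by (rule has_derivative_unique)
  then show ?thesis by (rule fun_cong)
qed

lemma J_eq: "J c q = fd (transition (chart_at M q) c) (snd (chart_at M q) q)"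
  by (auto simp: mdiff_def transition_def)

lemma coord_field_eq: "coord_field M c u q = fd (transition c (chart_at M q)) (snd c q) u"
  by (auto simp: coord_field_def transition_def)

lemma J_coord [simp]: "c \<in> atlas M \<Longrightarrow> q \<in> fst c \<Longrightarrow> J c q (coord_field M c u q) = u"
  unfolding J_eq coord_field_eq using transition_inverse chart_at chart_points by blast

lemma coord_J [simp]: "c \<in> atlas M \<Longrightarrow> q \<in> fst c \<Longrightarrow> coord_field M c (J c q v) q = v"
  unfolding J_eq coord_field_eq using transition_inverse chart_at chart_points by blast

lemma linear_J: "c \<in> atlas M \<Longrightarrow> q \<in> fst c \<Longrightarrow> linear (J c q)"
  unfolding J_eq by (intro linear_frechet_derivative transition_differentiable chart_at) (auto intro: chart_points)

lemma linear_coord: "c \<in> atlas M \<Longrightarrow> q \<in> fst c \<Longrightarrow> linear (\<lambda>u. coord_field M c u q)"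
  unfolding coord_field_eq by (intro linear_frechet_derivative transition_differentiable chart_at) (auto intro: chart_points)

lemma coord_chart_at [simp]:
  assumes p: "p \<in> points M" shows "coord_field M (chart_at M p) u p = u"
proof -
  let ?c = "chart_at M p"
  note c = chart_at[OF p]
  have "fd (transition ?c ?c) (snd ?c p) = fd (\<lambda>x. x) (snd ?c p)"
    by (rule fd_cong_open[OF chart_image_open'[OF c(1)]]) (use c in \<open>auto simp: transition_def\<close>)
  then show ?thesis by (simp add: coord_field_eq)
qed

lemma J_chart_at [simp]: "p \<in> points M \<Longrightarrow> J (chart_at M p) p v = v"
  using J_coord[of "chart_at M p" p v] chart_at by simp

text \<open>The differential, although defined in the preferred chart of each point, can be computed in any one
chart. This is what allows differentiating along a whole coordinate neighbourhood.\<close>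

lemma mdiff_chart:
  assumes c: "c \<in> atlas M" "q \<in> fst c"
    and f: "(f \<circ> chart_inv c has_derivative f') (at (snd c q))"
  shows "mdiff M f q v = f' (J c q v)"
proof -
  have q: "q \<in> points M" using chart_points[OF c] .
  show ?thesis
    using fd_eq[OF has_derivative_change_chart[OF c chart_at[OF q] f]]
    by (simp add: mdiff_def[of M f] J_eq)
qed

lemma J_change:
  assumes c: "c \<in> atlas M" "q \<in> fst c" and c': "c' \<in> atlas M" "q \<in> fst c'"
  shows "J c' q v = fd (transition c c') (snd c q) (J c q v)"
  by (rule mdiff_chart[OF c transition_has_derivative[OF c c']])

text \<open>Smoothness near a point in one chart carries over to all others by composing with transition maps.\<close>

lemma local_fun_chart:
  assumes c: "c \<in> atlas M" "p \<in> fst c"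
  shows "local_fun M p f \<longleftrightarrow>
    (\<exists>W. openin (mtop M) W \<and> p \<in> W \<and> W \<subseteq> fst c \<and> smooth_on (snd c ` W) (f \<circ> chart_inv c))"
    (is "?L \<longleftrightarrow> ?R")
proof
  assume ?L
  then obtain W where W: "p \<in> W" "openin (mtop M) W" "smooth_on (snd c ` (fst c \<inter> W)) (f \<circ> chart_inv c)"
    unfolding local_fun_def smooth_fun_on_def using c(1) by blast
  then show ?R using c chart_open[OF c(1)] by (intro exI[of _ "fst c \<inter> W"]) auto
next
  assume ?R
  then obtain W where W: "openin (mtop M) W" "p \<in> W" "W \<subseteq> fst c"
    and f: "smooth_on (snd c ` W) (f \<circ> chart_inv c)" by blast
  have "smooth_on (snd c' ` (fst c' \<inter> W)) (f \<circ> chart_inv c')" if c': "c' \<in> atlas M" for c'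
  proof -
    have o: "open (snd c' ` (fst c' \<inter> W))" by (rule chart_image_open[OF c' W(1)])
    have "smooth_on (snd c' ` (fst c' \<inter> W)) (\<lambda>x. (f \<circ> chart_inv c) (transition c' c x))"
      by (rule smooth_on_compose[OF chart_image_open_sub[OF c(1) W(1,3)] o f])
        (use c' c W in \<open>auto simp: transition_chart intro!: smooth_on_subset[OF transition_smooth]\<close>)
    then show ?thesis
      by (rule iffD1[OF smooth_on_cong[OF o], rotated]) (use c c' W in \<open>auto simp: transition_def subset_iff\<close>)
  qed
  then show ?L unfolding local_fun_def smooth_fun_on_def using W by blast
qed

text \<open>As for functions, but the components also change by the derivative of the transition map; its entries
are smooth, and the sum over a basis reduces the claim to products.\<close>

lemma local_field_chart:
  assumes c: "c \<in> atlas M" "p \<in> fst c"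
  shows "local_field M p X \<longleftrightarrow>
    (\<exists>W. openin (mtop M) W \<and> p \<in> W \<and> W \<subseteq> fst c \<and> smooth_on (snd c ` W) (field_rep M c X \<circ> chart_inv c))"
    (is "?L \<longleftrightarrow> ?R")
proof
  assume ?L
  then obtain W where W: "p \<in> W" "openin (mtop M) W"
      "smooth_on (snd c ` (fst c \<inter> W)) (field_rep M c X \<circ> chart_inv c)"
    unfolding local_field_def smooth_field_on_def using c(1) by blast
  then show ?R using c chart_open[OF c(1)] by (intro exI[of _ "fst c \<inter> W"]) auto
next
  assume ?R
  then obtain W where W: "openin (mtop M) W" "p \<in> W" "W \<subseteq> fst c"
    and f: "smooth_on (snd c ` W) (field_rep M c X \<circ> chart_inv c)" by blast
  have "smooth_on (snd c' ` (fst c' \<inter> W)) (field_rep M c' X \<circ> chart_inv c')" if c': "c' \<in> atlas M" for c'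
  proof -
    have o: "open (snd c' ` (fst c' \<inter> W))" by (rule chart_image_open[OF c' W(1)])
    have W': "openin (mtop M) (fst c' \<inter> W)" using chart_open[OF c'] W by auto
    have oc: "open (snd c ` (fst c' \<inter> W))"
      by (rule chart_image_open_sub[OF c(1) W']) (use W in auto)
    let ?r = "\<lambda>x. \<Sum>b\<in>Basis. ((field_rep M c X \<circ> chart_inv c) x \<bullet> b) *\<^sub>R fd (transition c c') x b"
    have "smooth_on (snd c ` (fst c' \<inter> W)) (field_rep M c X \<circ> chart_inv c)"
      using f by (rule smooth_on_subset) auto
    moreover have "smooth_on (snd c ` (fst c' \<inter> W)) (transition c c')"
      using W by (intro smooth_on_subset[OF transition_smooth[OF c(1) c']]) auto
    ultimately have "smooth_on (snd c ` (fst c' \<inter> W)) ?r"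
      by (intro smooth_on_sum[OF oc] smooth_on_scaleR[OF oc] smooth_on_fd finite_Basis
          smooth_on_linear_compose[OF oc bounded_linear_inner_left])
    then have "smooth_on (snd c' ` (fst c' \<inter> W)) (\<lambda>x. ?r (transition c' c x))"
      by (rule smooth_on_compose[OF oc o])
        (use c' c W in \<open>auto simp: transition_chart intro!: smooth_on_subset[OF transition_smooth]\<close>)
    moreover have "?r (transition c' c (snd c' q)) = (field_rep M c' X \<circ> chart_inv c') (snd c' q)"
      if q: "q \<in> fst c' \<inter> W" for q
    proof -
      have qc: "q \<in> fst c" "q \<in> fst c'" using q W by auto
      have lin: "linear (fd (transition c c') (snd c q))"
        by (intro linear_frechet_derivative transition_differentiable c c' qc)
      have "?r (transition c' c (snd c' q)) =
          fd (transition c c') (snd c q) (\<Sum>b\<in>Basis. (J c q (X q) \<bullet> b) *\<^sub>R b)"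
        using qc c c' by (simp add: transition_chart field_rep_def linear_sum[OF lin] linear_cmul[OF lin])
      also have "\<dots> = J c' q (X q)"
        by (simp add: euclidean_representation J_change[OF c(1) qc(1) c' qc(2)])
      finally show ?thesis using qc c' by (simp add: field_rep_def)
    qed
    ultimately show ?thesis
      by (rule_tac iffD1[OF smooth_on_cong[OF o]]) auto
  qed
  then show ?L unfolding local_field_def smooth_field_on_def using W by blast
qed

lemma local_field_cong:
  assumes p: "p \<in> points M" and X: "local_field M p X"
    and W: "openin (mtop M) W" "p \<in> W" "\<And>q. q \<in> W \<Longrightarrow> X q = Y q"
  shows "local_field M p Y"
proof -
  note c = chart_at[OF p]
  let ?c = "chart_at M p"
  obtain V where V: "openin (mtop M) V" "p \<in> V" "V \<subseteq> fst ?c"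
    "smooth_on (snd ?c ` V) (field_rep M ?c X \<circ> chart_inv ?c)"
    using X local_field_chart[OF c] by blast
  have VW: "openin (mtop M) (V \<inter> W)" using V W by auto
  have "smooth_on (snd ?c ` (V \<inter> W)) (field_rep M ?c X \<circ> chart_inv ?c)"
    using V(4) by (rule smooth_on_subset) auto
  then have "smooth_on (snd ?c ` (V \<inter> W)) (field_rep M ?c Y \<circ> chart_inv ?c)"
    by (rule iffD1[OF smooth_on_cong, rotated 2])
      (use VW V W c in \<open>auto simp: field_rep_def intro!: chart_image_open_sub\<close>)
  then show ?thesis using local_field_chart[OF c] VW V W by blast
qed

lemma local_field_scale_add:
  assumes p: "p \<in> points M" and f: "local_fun M p f" and X: "local_field M p X" and Y: "local_field M p Y"
  shows "local_field M p (\<lambda>q. f q *\<^sub>R X q + Y q)"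
proof -
  note c = chart_at[OF p]
  let ?c = "chart_at M p"
  obtain U where U: "openin (mtop M) U" "p \<in> U" "U \<subseteq> fst ?c"
    "smooth_on (snd ?c ` U) (f \<circ> chart_inv ?c)"
    using f local_fun_chart[OF c] by blast
  obtain V where V: "openin (mtop M) V" "p \<in> V" "V \<subseteq> fst ?c"
    "smooth_on (snd ?c ` V) (field_rep M ?c X \<circ> chart_inv ?c)"
    using X local_field_chart[OF c] by blast
  obtain W where W: "openin (mtop M) W" "p \<in> W" "W \<subseteq> fst ?c"
    "smooth_on (snd ?c ` W) (field_rep M ?c Y \<circ> chart_inv ?c)"
    using Y local_field_chart[OF c] by blast
  let ?S = "U \<inter> V \<inter> W"
  have S: "openin (mtop M) ?S" "?S \<subseteq> fst ?c" using U V W by auto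
  have o: "open (snd ?c ` ?S)" by (rule chart_image_open_sub[OF c(1) S])
  have "smooth_on (snd ?c ` ?S) (\<lambda>x. (f \<circ> chart_inv ?c) x *\<^sub>R (field_rep M ?c X \<circ> chart_inv ?c) x
      + (field_rep M ?c Y \<circ> chart_inv ?c) x)"
    by (intro smooth_on_add[OF o] smooth_on_scaleR[OF o] smooth_on_subset[OF U(4)]
        smooth_on_subset[OF V(4)] smooth_on_subset[OF W(4)]) auto
  moreover have "field_rep M ?c (\<lambda>q. f q *\<^sub>R X q + Y q) q = f q *\<^sub>R field_rep M ?c X q + field_rep M ?c Y q"
    if "q \<in> ?S" for q
    using linear_J[OF c(1)] that S unfolding field_rep_def by (auto simp: linear_add linear_cmul)
  ultimately have "smooth_on (snd ?c ` ?S) (field_rep M ?c (\<lambda>q. f q *\<^sub>R X q + Y q) \<circ> chart_inv ?c)"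
    by (rule_tac iffD1[OF smooth_on_cong[OF o]]) (use S c in auto)
  then show ?thesis using local_field_chart[OF c] S U V W by blast
qed

lemma local_field_zero: "p \<in> points M \<Longrightarrow> local_field M p (\<lambda>q. 0)"
proof -
  assume p: "p \<in> points M"
  note c = chart_at[OF p]
  let ?c = "chart_at M p"
  have "smooth_on (snd ?c ` fst ?c) (field_rep M ?c (\<lambda>q. 0) \<circ> chart_inv ?c)"
    by (rule iffD1[OF smooth_on_cong[OF chart_image_open'[OF c(1)]] smooth_on_const[of _ 0]])
      (use c linear_J[OF c(1)] in \<open>auto simp: field_rep_def linear_0\<close>)
  then show ?thesis using local_field_chart[OF c] chart_open[OF c(1)] c by blast
qed

lemma coord_local_field:
  assumes c: "c \<in> atlas M" "q \<in> fst c"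
  shows "local_field M q (coord_field M c u)"
proof -
  have "smooth_on (snd c ` fst c) (field_rep M c (coord_field M c u) \<circ> chart_inv c)"
    by (rule iffD1[OF smooth_on_cong[OF chart_image_open'[OF c(1)]] smooth_on_const[of _ u]])
      (use c in \<open>auto simp: field_rep_def\<close>)
  then show ?thesis using local_field_chart[OF c] chart_open[OF c(1)] c by blast
qed

text \<open>The bracket is computed in the preferred chart at \<open>q\<close>, where the components of a coordinate field of \<open>c\<close>
are first derivatives of the transition map; symmetry of the second derivatives gives zero.\<close>

lemma coord_bracket:
  assumes c: "c \<in> atlas M" and q: "q \<in> fst c"
  shows "lie_bracket M (coord_field M c u) (coord_field M c v) q = 0"
proof -
  let ?c = "chart_at M q"
  note c0 = chart_at[OF chart_points[OF c q]]
  let ?t = "transition c ?c"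
  let ?T = "snd c ` (fst c \<inter> fst ?c)"
  note oT = transition_open[OF c c0(1)]
  have xT: "snd c q \<in> ?T" using q c0 by auto
  have t: "smooth_on ?T ?t" by (rule transition_smooth[OF c c0(1)])
  have "mdiff M (field_rep M ?c (coord_field M c v)) q w = fd (\<lambda>x. fd ?t x v) (snd c q) (J c q w)" for v w
  proof (rule mdiff_chart[OF c q])
    have "((\<lambda>x. fd ?t x v) has_derivative fd (\<lambda>x. fd ?t x v) (snd c q)) (at (snd c q))"
      by (intro fd_works smooth_on_differentiable[OF smooth_on_fd[OF t] xT])
    then show "(field_rep M ?c (coord_field M c v) \<circ> chart_inv c has_derivative
        fd (\<lambda>x. fd ?t x v) (snd c q)) (at (snd c q))"
      by (rule has_derivative_transform_within_open[OF _ oT xT])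
        (use c c0 J_change[OF c _ c0(1)] in \<open>auto simp: field_rep_def\<close>)
  qed
  moreover have "fd (\<lambda>x. fd ?t x v) (snd c q) u = fd (\<lambda>x. fd ?t x u) (snd c q) v"
    by (rule second_derivative_symmetric[OF oT xT])
      (use t smooth_on_fd smooth_on_differentiable xT in blast)+
  ultimately show ?thesis
    using c q by (simp add: lie_bracket_def)
qed

text \<open>Expanding the second argument in a basis makes the expression linear in it by construction. A
coordinate field with direction \<open>v\<close> depends linearly on \<open>v\<close> only inside the chart.\<close>

definition christoffel ::
  "('a \<Rightarrow> 'b \<Rightarrow> ('a \<Rightarrow> 'b) \<Rightarrow> 'b) \<Rightarrow> ('a, 'b) chart \<Rightarrow> 'b \<Rightarrow> 'b \<Rightarrow> 'b \<Rightarrow> 'b" where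
  "christoffel D c x u v = (\<Sum>b\<in>Basis. (v \<bullet> b) *\<^sub>R
     field_rep M c (\<lambda>q. D q (coord_field M c u q) (coord_field M c b)) (chart_inv c x))"

context
  fixes D :: "'a \<Rightarrow> 'b \<Rightarrow> ('a \<Rightarrow> 'b) \<Rightarrow> 'b"
  assumes D: "affine_connection M D"
begin

lemma D_linear: "p \<in> points M \<Longrightarrow> local_field M p X \<Longrightarrow> linear (\<lambda>v. D p v X)"
  using D unfolding affine_connection_def by blast

lemma D_add: "p \<in> points M \<Longrightarrow> local_field M p X \<Longrightarrow> local_field M p Y \<Longrightarrow>
    D p v (\<lambda>q. X q + Y q) = D p v X + D p v Y"
  using D unfolding affine_connection_def by blast

lemma D_scale: "p \<in> points M \<Longrightarrow> local_fun M p f \<Longrightarrow> local_field M p X \<Longrightarrow>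
    D p v (\<lambda>q. f q *\<^sub>R X q) = mdiff M f p v *\<^sub>R X p + f p *\<^sub>R D p v X"
  using D unfolding affine_connection_def by blast

lemma D_local_field: "p \<in> points M \<Longrightarrow> local_field M p U \<Longrightarrow> local_field M p X \<Longrightarrow>
    local_field M p (\<lambda>q. D q (U q) X)"
  using D unfolding affine_connection_def by blast

text \<open>The indicator function of a neighbourhood is smooth near the point and has derivative zero there.
Multiplying by it does not change the covariant derivative and erases what happens far away.\<close>

lemma D_germ:
  assumes p: "p \<in> points M" and X: "local_field M p X"
    and W: "openin (mtop M) W" "p \<in> W" "\<And>q. q \<in> W \<Longrightarrow> X q = Y q"
  shows "D p v X = D p v Y"
proof -
  note c = chart_at[OF p]
  let ?c = "chart_at M p"
  define f :: "'a \<Rightarrow> real" where "f q = (if q \<in> W then 1 else 0)" for q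
  let ?W = "fst ?c \<inter> W"
  have W': "openin (mtop M) ?W" "?W \<subseteq> fst ?c" using W chart_open[OF c(1)] by auto
  note o = chart_image_open_sub[OF c(1) W']
  have one: "(f \<circ> chart_inv ?c) x = 1" if "x \<in> snd ?c ` ?W" for x
    using that c by (auto simp: f_def)
  have "smooth_on (snd ?c ` ?W) (f \<circ> chart_inv ?c)"
    by (rule iffD1[OF smooth_on_cong[OF o] smooth_on_const[of _ 1]]) (use one in simp)
  then have lf: "local_fun M p f" using local_fun_chart[OF c] W' W c by blast
  have "((\<lambda>x. 1) has_derivative (\<lambda>v. 0)) (at (snd ?c p))" by simp
  then have "(f \<circ> chart_inv ?c has_derivative (\<lambda>v. 0)) (at (snd ?c p))"
    by (rule has_derivative_transform_within_open[OF _ o]) (use c W one in auto)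
  from mdiff_chart[OF c this] have "mdiff M f p v = 0" .
  moreover have "f p = 1" using W by (simp add: f_def)
  moreover have "(\<lambda>q. f q *\<^sub>R X q) = (\<lambda>q. f q *\<^sub>R Y q)" using W by (auto simp: f_def)
  ultimately show ?thesis
    using D_scale[OF p lf X, of v] D_scale[OF p lf local_field_cong[OF p X W], of v] by simp
qed

lemma D_zero:
  assumes p: "p \<in> points M" shows "D p v (\<lambda>q. 0) = 0"
  using D_add[OF p local_field_zero[OF p] local_field_zero[OF p], of v] by simp

lemma D_sum:
  assumes p: "p \<in> points M" and fin: "finite I"
    and f: "\<And>i. i \<in> I \<Longrightarrow> local_fun M p (f i)" and X: "\<And>i. i \<in> I \<Longrightarrow> local_field M p (X i)"
  shows "local_field M p (\<lambda>q. \<Sum>i\<in>I. f i q *\<^sub>R X i q) \<and>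
    D p v (\<lambda>q. \<Sum>i\<in>I. f i q *\<^sub>R X i q) = (\<Sum>i\<in>I. mdiff M (f i) p v *\<^sub>R X i p + f i p *\<^sub>R D p v (X i))"
  using fin f X
proof (induction I rule: finite_induct)
  case empty
  then show ?case using local_field_zero[OF p] D_zero[OF p] by simp
next
  case (insert i I)
  have fX: "local_field M p (\<lambda>q. f i q *\<^sub>R X i q)"
    using local_field_scale_add[OF p, of "f i" "X i" "\<lambda>q. 0"] insert.prems local_field_zero[OF p] by simp
  show ?case
    using insert local_field_scale_add[OF p, of "f i" "X i"] D_add[OF p fX]
      D_scale[OF p, of "f i" "X i" v] by simp
qed

text \<open>The classical formula \<open>\<nabla>\<^sub>vX = DX(v) + \<Gamma>(v, X)\<close>: near \<open>q\<close> the field is a combination of coordinate fields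
with smooth coefficients, to which the Leibniz rule applies.\<close>

lemma D_chart:
  assumes c: "c \<in> atlas M" "q \<in> fst c" and X: "local_field M q X"
  shows "J c q (D q v X) =
    fd (field_rep M c X \<circ> chart_inv c) (snd c q) (J c q v) + christoffel D c (snd c q) (J c q v) (field_rep M c X q)"
proof -
  have q: "q \<in> points M" using chart_points[OF c] .
  note lJ = linear_J[OF c] and lc = linear_coord[OF c]
  define R where "R = field_rep M c X \<circ> chart_inv c"
  obtain W where W: "openin (mtop M) W" "q \<in> W" "W \<subseteq> fst c" "smooth_on (snd c ` W) R"
    using X local_field_chart[OF c] unfolding R_def by blast
  have dR: "R differentiable (at (snd c q))" using smooth_on_differentiable[OF W(4)] W by blast
  define f where "f b q = field_rep M c X q \<bullet> b" for b q
  have fR: "f b \<circ> chart_inv c = (\<lambda>x. R x \<bullet> b)" for b by (auto simp: f_def R_def)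
  have lf: "local_fun M q (f b)" for b
    unfolding local_fun_chart[OF c] fR
    using W smooth_on_linear_compose[OF chart_image_open_sub[OF c(1) W(1,3)] bounded_linear_inner_left W(4)] by blast
  have df: "mdiff M (f b) q v = fd R (snd c q) (J c q v) \<bullet> b" for b
    by (rule mdiff_chart[OF c]) (simp add: fR bounded_linear.has_derivative[OF bounded_linear_inner_left fd_works[OF dR]])
  have exp: "X q' = (\<Sum>b\<in>Basis. f b q' *\<^sub>R coord_field M c b q')" if "q' \<in> fst c" for q'
  proof -
    have "X q' = coord_field M c (\<Sum>b\<in>Basis. (J c q' (X q') \<bullet> b) *\<^sub>R b) q'"
      using that c by (simp add: euclidean_representation)
    then show ?thesis
      by (simp add: linear_sum[OF linear_coord[OF c(1) that]] linear_cmul[OF linear_coord[OF c(1) that]]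
          f_def field_rep_def)
  qed
  have vJ: "v = coord_field M c (J c q v) q" using c by simp
  have "D q v X = D q v (\<lambda>q. \<Sum>b\<in>Basis. f b q *\<^sub>R coord_field M c b q)"
    by (rule D_germ[OF q X chart_open[OF c(1)] c(2) exp])
  also have "\<dots> = (\<Sum>b\<in>Basis. mdiff M (f b) q v *\<^sub>R coord_field M c b q + f b q *\<^sub>R D q v (coord_field M c b))"
    using D_sum[OF q finite_Basis, of f "coord_field M c" v] lf coord_local_field[OF c] by blast
  finally have "J c q (D q v X) = (\<Sum>b\<in>Basis. mdiff M (f b) q v *\<^sub>R b) + 
      (\<Sum>b\<in>Basis. f b q *\<^sub>R J c q (D q v (coord_field M c b)))"
    using c by (simp add: linear_sum[OF lJ] linear_cmul[OF lJ] linear_add[OF lJ] sum.distrib)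
  moreover have "(\<Sum>b\<in>Basis. mdiff M (f b) q v *\<^sub>R b) = fd R (snd c q) (J c q v)"
    unfolding df by (rule euclidean_representation)
  moreover have "(\<Sum>b\<in>Basis. f b q *\<^sub>R J c q (D q v (coord_field M c b))) =
      christoffel D c (snd c q) (J c q v) (field_rep M c X q)"
    using c by (simp add: christoffel_def f_def field_rep_def)
  ultimately show ?thesis by (simp add: R_def)
qed

lemma christoffel_bilinear:
  assumes c: "c \<in> atlas M" and x: "x \<in> snd c ` fst c"
  shows "bilinear (christoffel D c x)"
proof -
  obtain q where q: "q \<in> fst c" "x = snd c q" using x by blast
  have "linear (\<lambda>u. J c q (D q (coord_field M c u q) (coord_field M c b)))" for b
    using linear_compose[OF linear_compose[OF linear_coord[OF c q(1)]
        D_linear[OF chart_points[OF c q(1)] coord_local_field[OF c q(1)]]] linear_J[OF c q(1)], of b]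
    by (simp add: o_def)
  then show ?thesis
    unfolding bilinear_def christoffel_def field_rep_def linear_iff using q c
    by (auto simp: algebra_simps sum.distrib scaleR_sum_right inner_add_left)
qed

lemma D_coord:
  assumes c: "c \<in> atlas M" and q: "q \<in> fst c"
  shows "J c q (D q v (coord_field M c w)) = christoffel D c (snd c q) (J c q v) w"
proof -
  have "fd (field_rep M c (coord_field M c w) \<circ> chart_inv c) (snd c q) = fd (\<lambda>x. w) (snd c q)"
    by (rule fd_cong_open[OF chart_image_open'[OF c]]) (use c q in \<open>auto simp: field_rep_def\<close>)
  then show ?thesis
    using D_chart[OF c q coord_local_field[OF c q, of w], of v] c q by (simp add: field_rep_def)
qed

lemma local_field_rep_differentiable:
  assumes c: "c \<in> atlas M" "q \<in> fst c" and X: "local_field M q X"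
  shows "(field_rep M c X \<circ> chart_inv c) differentiable (at (snd c q))"
  using X local_field_chart[OF c] smooth_on_differentiable by blast

lemma christoffel_differentiable:
  assumes c: "c \<in> atlas M" and x: "x \<in> snd c ` fst c"
  shows "(\<lambda>x. christoffel D c x u v) differentiable (at x)"
proof -
  obtain q where q: "q \<in> fst c" "x = snd c q" using x by blast
  have "(field_rep M c (\<lambda>q. D q (coord_field M c u q) (coord_field M c b)) \<circ> chart_inv c)
     differentiable (at x)" for b
    unfolding q(2) using c q chart_points
    by (intro local_field_rep_differentiable D_local_field coord_local_field)
  then have "(\<lambda>x. \<Sum>b\<in>Basis. (v \<bullet> b) *\<^sub>R (field_rep M c (\<lambda>q. D q (coord_field M c u q)
      (coord_field M c b)) \<circ> chart_inv c) x) differentiable (at x)"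
    by (intro differentiable_sum differentiable_scaleR differentiable_const ballI finite_Basis)
  then show ?thesis by (simp add: christoffel_def)
qed

lemma curvature_chart:
  assumes p: "p \<in> points M"
  shows "curvature_tensor M D p u v w = chart_curvature (christoffel D (chart_at M p)) (snd (chart_at M p) p) u v w"
proof -
  let ?c = "chart_at M p"
  let ?C = "coord_field M ?c"
  note c = chart_at[OF p]
  have *: "D p (?C u p) (\<lambda>q. D q (?C v q) (?C w)) = fd (\<lambda>x. christoffel D ?c x v w) (snd ?c p) u
      + christoffel D ?c (snd ?c p) u (christoffel D ?c (snd ?c p) v w)" for u v
  proof -
    let ?X = "\<lambda>q. D q (?C v q) (?C w)"
    have lX: "local_field M p ?X" by (intro D_local_field p coord_local_field c)
    have rep: "field_rep M ?c ?X q = christoffel D ?c (snd ?c q) v w" if "q \<in> fst ?c" for q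
      using D_coord[OF c(1) that] that c by (simp add: field_rep_def)
    have "fd (field_rep M ?c ?X \<circ> chart_inv ?c) (snd ?c p) = fd (\<lambda>x. christoffel D ?c x v w) (snd ?c p)"
      by (rule fd_cong_open[OF chart_image_open'[OF c(1)]]) (use c rep in auto)
    then show ?thesis
      using D_chart[OF c lX, of u] p by (simp add: rep c)
  qed
  have "D p 0 (?C w) = 0"
    using D_linear[OF p coord_local_field[OF c]] linear_0 by blast
  then show ?thesis
    unfolding curvature_tensor_def Let_def * coord_bracket[OF c] chart_curvature_def by simp
qed

end

definition chart_metric :: "('a \<Rightarrow> 'b \<Rightarrow> 'b \<Rightarrow> real) \<Rightarrow> ('a, 'b) chart \<Rightarrow> 'b \<Rightarrow> 'b \<Rightarrow> 'b \<Rightarrow> real" where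
  "chart_metric g c x u v =
     g (chart_inv c x) (coord_field M c u (chart_inv c x)) (coord_field M c v (chart_inv c x))"

context
  fixes D :: "'a \<Rightarrow> 'b \<Rightarrow> ('a \<Rightarrow> 'b) \<Rightarrow> 'b" and g
  assumes lc: "levi_civita_connection M g D"
begin

lemma lc_affine: "affine_connection M D"
  using lc unfolding levi_civita_connection_def by blast

lemma lc_torsion: "p \<in> points M \<Longrightarrow> local_field M p U \<Longrightarrow> local_field M p V \<Longrightarrow>
    D p (U p) V - D p (V p) U = lie_bracket M U V p"
  using lc unfolding levi_civita_connection_def by blast

lemma lc_metric: "p \<in> points M \<Longrightarrow> local_field M p X \<Longrightarrow> local_field M p Y \<Longrightarrow>
    mdiff M (\<lambda>q. g q (X q) (Y q)) p v = g p (D p v X) (Y p) + g p (X p) (D p v Y)"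
  using lc unfolding levi_civita_connection_def by blast

lemma christoffel_connection:
  assumes c: "c \<in> atlas M"
  shows "local_connection (snd c ` fst c) (christoffel D c)"
proof
  show "open (snd c ` fst c)" by (rule chart_image_open'[OF c])
  fix x u v assume x: "x \<in> snd c ` fst c"
  show "bilinear (christoffel D c x)" by (rule christoffel_bilinear[OF lc_affine c x])
  show "(\<lambda>x. christoffel D c x u v) differentiable (at x)"
    by (rule christoffel_differentiable[OF lc_affine c x])
  obtain q where q: "q \<in> fst c" "x = snd c q" using x by blast
  have "D q (coord_field M c u q) (coord_field M c v) = D q (coord_field M c v q) (coord_field M c u)"
    using lc_torsion[OF chart_points[OF c q(1)] coord_local_field[OF c q(1)] coord_local_field[OF c q(1)], of u v]
      coord_bracket[OF c q(1), of u v] by simp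
  from arg_cong[OF this, of "J c q"]
  show "christoffel D c x u v = christoffel D c x v u"
    using c q by (simp add: D_coord[OF lc_affine])
qed

text \<open>Differentiability of the metric coefficients is a hypothesis, rather than smoothness of the metric, so
that the lemma also covers the varied and the induced metric, for which it is obtained separately.\<close>

lemma christoffel_compat:
  assumes c: "c \<in> atlas M" and x: "x \<in> snd c ` fst c"
    and diff: "(\<lambda>x. chart_metric g c x v w) differentiable (at x)"
  shows "fd (\<lambda>x. chart_metric g c x v w) x u =
    chart_metric g c x (christoffel D c x u v) w + chart_metric g c x v (christoffel D c x u w)"
proof -
  obtain q where q: "q \<in> fst c" "x = snd c q" using x by blast
  note cf = coord_local_field[OF c q(1)]
  have "mdiff M (\<lambda>q. g q (coord_field M c v q) (coord_field M c w q)) q (coord_field M c u q)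
      = fd (\<lambda>x. chart_metric g c x v w) x (J c q (coord_field M c u q))"
    by (rule mdiff_chart[OF c q(1)])
      (use fd_works[OF diff] q in \<open>simp add: chart_metric_def o_def\<close>)
  then have "fd (\<lambda>x. chart_metric g c x v w) x u =
     g q (D q (coord_field M c u q) (coord_field M c v)) (coord_field M c w q)
     + g q (coord_field M c v q) (D q (coord_field M c u q) (coord_field M c w))"
    using lc_metric[OF chart_points[OF c q(1)] cf cf] c q by simp
  moreover have "D q (coord_field M c u q) (coord_field M c v) = coord_field M c (christoffel D c x u v) q" for v
    using D_coord[OF lc_affine c q(1), of "coord_field M c u q" v] c q
    by (metis J_coord coord_J)
  ultimately show ?thesis using c q by (simp add: chart_metric_def)
qed

lemma curvature_tensor_multilinear:
  assumes p: "p \<in> points M"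
  shows "linear (\<lambda>u. curvature_tensor M D p u v w)" "linear (\<lambda>v. curvature_tensor M D p u v w)"
    "linear (\<lambda>w. curvature_tensor M D p u v w)"
    "curvature_tensor M D p v u w = - curvature_tensor M D p u v w"
proof -
  note c = chart_at[OF p]
  have x: "snd (chart_at M p) p \<in> snd (chart_at M p) ` fst (chart_at M p)" using c by blast
  note * = local_connection.curvature_multilinear[OF christoffel_connection[OF c(1)] x]
  show "linear (\<lambda>u. curvature_tensor M D p u v w)" "linear (\<lambda>v. curvature_tensor M D p u v w)"
    "linear (\<lambda>w. curvature_tensor M D p u v w)"
    "curvature_tensor M D p v u w = - curvature_tensor M D p u v w"
    unfolding curvature_chart[OF lc_affine p] by (rule *)+
qed

end

end

section \<open>Closed unitary fields on a manifold\<close>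

lemma local_connection_subset:
  assumes "local_connection S \<Gamma>" "open T" "T \<subseteq> S"
  shows "local_connection T \<Gamma>"
  using assms unfolding local_connection_def by blast

text \<open>Chain rule for the passage from the chart \<open>c\<close> to the preferred chart at \<open>F y\<close>.\<close>

lemma tangent_map_chart:
  assumes N: "smooth_manifold N" and M: "smooth_manifold M" and F: "smooth_map N M F"
    and d: "d \<in> atlas N" "y \<in> fst d" and c: "c \<in> atlas M" "F y \<in> fst c"
  shows "tangent_map N M F y w =
    coord_field M c (fd (snd c \<circ> F \<circ> chart_inv d) (snd d y) (mdiff N (snd d) y w)) (F y)"
proof -
  interpret N: smooth_mfd N by unfold_locales (rule N)
  interpret M: smooth_mfd M by unfold_locales (rule M)
  let ?F = "snd c \<circ> F \<circ> chart_inv d"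
  let ?c = "chart_at M (F y)"
  have Fy: "F y \<in> points M" by (rule M.chart_points[OF c])
  note c1 = M.chart_at[OF Fy]
  have contF: "continuous_map (mtop N) (mtop M) F" using F by (simp add: smooth_map_def)
  let ?W = "{q \<in> points N. F q \<in> fst c}"
  have W: "openin (mtop N) ?W"
    by (rule openin_continuous_map_preimage[OF contF M.chart_open[OF c(1)]])
  have oW: "open (snd d ` (fst d \<inter> ?W))" by (rule N.chart_image_open[OF d(1) W])
  have yW: "snd d y \<in> snd d ` (fst d \<inter> ?W)" using d c N.chart_points[OF d] by blast
  have "smooth_on (snd d ` (fst d \<inter> F -` fst c)) ?F"
    using F d c unfolding smooth_map_def by blast
  then have dF: "?F differentiable (at (snd d y))"
    by (rule smooth_on_differentiable) (use d c in blast)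
  have Fd: "?F (snd d y) = snd c (F y)" using d by simp
  have "((\<lambda>x. (snd ?c \<circ> chart_inv c) (?F x)) has_derivative
      (\<lambda>h. fd (M.transition c ?c) (snd c (F y)) (fd ?F (snd d y) h))) (at (snd d y))"
    by (rule has_derivative_compose[OF fd_works[OF dF]])
      (use M.transition_has_derivative[OF c c1] in \<open>simp only: Fd\<close>)
  then have "((snd ?c \<circ> F) \<circ> chart_inv d has_derivative
      (\<lambda>h. fd (M.transition c ?c) (snd c (F y)) (fd ?F (snd d y) h))) (at (snd d y))"
    by (rule has_derivative_transform_within_open[OF _ oW yW]) (use c d in auto)
  from N.mdiff_chart[OF d this, of w] show ?thesis
    unfolding tangent_map_def M.coord_field_eq .
qed

locale closed_unitary_geometry = smooth_mfd M
  for M :: "('a, 'b::euclidean_space) manifold" +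
  fixes g :: "'a \<Rightarrow> 'b \<Rightarrow> 'b \<Rightarrow> real" and E :: "'a \<Rightarrow> 'b"
    and D :: "'a \<Rightarrow> 'b \<Rightarrow> ('a \<Rightarrow> 'b) \<Rightarrow> 'b"
  assumes riem: "riemannian_metric M g"
    and closed_unitary: "closed_unitary_field M g E"
    and lc: "levi_civita_connection M g D"
begin

lemma g_bilinear: "p \<in> points M \<Longrightarrow> bilinear (g p)"
  and g_sym: "p \<in> points M \<Longrightarrow> g p u v = g p v u"
  and g_pos: "p \<in> points M \<Longrightarrow> u \<noteq> 0 \<Longrightarrow> g p u u > 0"
  using riem unfolding riemannian_metric_def semi_riemannian_metric_def by blast+

lemma E_unitary: "p \<in> points M \<Longrightarrow> g p (E p) (E p) = 1"
  using closed_unitary unfolding closed_unitary_field_def by blast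

lemma E_field: "p \<in> points M \<Longrightarrow> local_field M p E"
  using closed_unitary unfolding closed_unitary_field_def local_field_def by blast

abbreviation shape :: "'a \<Rightarrow> 'b \<Rightarrow> 'b" where "shape p v \<equiv> D p v E"

lemma linear_shape: "p \<in> points M \<Longrightarrow> linear (shape p)"
  by (rule D_linear[OF lc_affine[OF lc] _ E_field])

text \<open>For fields \<open>U\<close>, \<open>V\<close> a torsion free metric connection satisfies
\<open>d\<omega>(U, V) = g(\<nabla>\<^sub>UE, V) - g(\<nabla>\<^sub>VE, U)\<close>, so this is the closedness of \<open>E\<close>.\<close>

lemma shape_sym:
  assumes p: "p \<in> points M"
  shows "g p (shape p u) v = g p (shape p v) u"
proof -
  let ?U = "coord_field M (chart_at M p) u" and ?V = "coord_field M (chart_at M p) v"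
  note cf = coord_local_field[OF chart_at[OF p]]
  have "ext_deriv M (metric_dual g E) p u v = 0"
    using closed_unitary p unfolding closed_unitary_field_def by blast
  moreover have "ext_deriv M (metric_dual g E) p u v =
     (g p (D p u E) v + g p (E p) (D p u ?V)) - (g p (D p v E) u + g p (E p) (D p v ?U))
     - g p (E p) (D p u ?V - D p v ?U)"
    using lc_metric[OF lc p E_field[OF p] cf] lc_torsion[OF lc p cf cf, of u v] p
    by (simp add: ext_deriv_def metric_dual_def Let_def)
  ultimately show ?thesis by (simp add: bilinear_rsub[OF g_bilinear[OF p]])
qed

text \<open>In a chart the data satisfy the hypotheses of the local theory. The second part identifies the operator
\<open>A\<close> of the local theory, computed from components, with \<open>v \<mapsto> \<nabla>\<^sub>vE\<close> by \<open>D_chart\<close>.\<close>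

lemma chart_closed_unit_field:
  assumes c: "c \<in> atlas M"
  shows "closed_unit_field (snd c ` fst c) (christoffel D c) (chart_metric g c) (field_rep M c E \<circ> chart_inv c)"
    and "q \<in> fst c \<Longrightarrow> closed_unit_field.A (christoffel D c) (field_rep M c E \<circ> chart_inv c) (snd c q) u
      = J c q (shape q (coord_field M c u q))"
proof -
  let ?S = "snd c ` fst c"
  note oS = chart_image_open'[OF c]
  have Aq: "fd (field_rep M c E \<circ> chart_inv c) (snd c q) u + christoffel D c (snd c q) u ((field_rep M c E \<circ> chart_inv c) (snd c q))
      = J c q (shape q (coord_field M c u q))" if "q \<in> fst c" for q u
    using D_chart[OF lc_affine[OF lc] c that E_field[OF chart_points[OF c that]], of "coord_field M c u q"]
      c that by simp
  have sm: "smooth_on ?S (\<lambda>x. chart_metric g c x u v)" for u v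
    using riem c unfolding riemannian_metric_def semi_riemannian_metric_def chart_metric_def o_def by blast
  have conn: "local_connection ?S (christoffel D c)" by (rule christoffel_connection[OF lc c])
  have Esm: "smooth_on ?S (field_rep M c E \<circ> chart_inv c)"
  proof -
    have "fst c \<inter> points M = fst c" using chart_points[OF c] by blast
    then show ?thesis
      using closed_unitary c unfolding closed_unitary_field_def smooth_field_on_def by metis
  qed
  show cl: "closed_unit_field ?S (christoffel D c) (chart_metric g c) (field_rep M c E \<circ> chart_inv c)"
    unfolding closed_unit_field_def closed_unit_field_axioms_def local_metric_connection_def
      local_metric_connection_axioms_def
  proof (intro conjI conn allI impI Esm)
    fix x assume x: "x \<in> ?S"
    then obtain q where q: "q \<in> fst c" "x = snd c q" by blast
    note p = chart_points[OF c q(1)]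
    note lcq = linear_coord[OF c q(1)]
    show "bilinear (chart_metric g c x)"
      using g_bilinear[OF p] lcq c q unfolding bilinear_def linear_iff chart_metric_def by auto
    fix u v
    show "chart_metric g c x u v = chart_metric g c x v u"
      using g_sym[OF p] c q by (simp add: chart_metric_def)
    show df: "(\<lambda>x. chart_metric g c x u v) differentiable (at x)" for u v
      by (rule smooth_on_differentiable[OF sm x])
    show "fd (\<lambda>x. chart_metric g c x v w) x u = chart_metric g c x (christoffel D c x u v) w
        + chart_metric g c x v (christoffel D c x u w)" for u v w
      by (rule christoffel_compat[OF lc c x df])
    show "0 < chart_metric g c x u u" if "u \<noteq> 0"
    proof -
      have "coord_field M c u q \<noteq> 0"
        using that J_coord[OF c q(1), of u] linear_0[OF linear_J[OF c q(1)]] by metis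
      then show ?thesis using g_pos[OF p] c q by (simp add: chart_metric_def)
    qed
    show "chart_metric g c x ((field_rep M c E \<circ> chart_inv c) x) ((field_rep M c E \<circ> chart_inv c) x) = 1"
      using E_unitary[OF p] c q by (simp add: chart_metric_def field_rep_def)
    show "chart_metric g c x (fd (field_rep M c E \<circ> chart_inv c) x u +
          christoffel D c x u ((field_rep M c E \<circ> chart_inv c) x)) v =
         chart_metric g c x u (fd (field_rep M c E \<circ> chart_inv c) x v +
          christoffel D c x v ((field_rep M c E \<circ> chart_inv c) x))"
      unfolding q(2) Aq[OF q(1)]
      using shape_sym[OF p, of "coord_field M c u q"] g_sym[OF p, of "coord_field M c u q"] c q
      by (simp add: chart_metric_def)
  qed
  show "closed_unit_field.A (christoffel D c) (field_rep M c E \<circ> chart_inv c) (snd c q) u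
      = J c q (shape q (coord_field M c u q))" if "q \<in> fst c"
    unfolding closed_unit_field.A_def[OF cl] by (rule Aq[OF that])
qed

text \<open>What happens at \<open>p\<close> is read off in the preferred chart at \<open>p\<close>, in which the tangent space at \<open>p\<close> is
represented by itself.\<close>

context
  fixes p c x
  assumes p: "p \<in> points M"
  defines "c \<equiv> chart_at M p" and "x \<equiv> snd c p"
begin

lemma preferred_chart: "c \<in> atlas M" "p \<in> fst c"
  using chart_at[OF p] by (auto simp: c_def)

interpretation C: closed_unit_field "snd c ` fst c" "christoffel D c" "chart_metric g c"
    "field_rep M c E \<circ> chart_inv c"
  by (rule chart_closed_unit_field[OF preferred_chart(1)])

lemma preferred_coord: "x \<in> snd c ` fst c" using preferred_chart by (auto simp: x_def)

lemma chart_values_at: "chart_metric g c x = g p" "(field_rep M c E \<circ> chart_inv c) x = E p"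
  "C.A x = shape p" "chart_curvature (christoffel D c) x = curvature_tensor M D p"
proof -
  show "chart_metric g c x = g p" "(field_rep M c E \<circ> chart_inv c) x = E p"
    using preferred_chart p by (auto simp: x_def c_def chart_metric_def field_rep_def fun_eq_iff)
  show "C.A x = shape p"
    using chart_closed_unit_field(2)[OF preferred_chart] p by (auto simp: x_def c_def)
  show "chart_curvature (christoffel D c) x = curvature_tensor M D p"
    using curvature_chart[OF lc_affine[OF lc] p] unfolding x_def c_def by (intro ext) simp
qed

lemma curvature_skew_at:
  "g p (curvature_tensor M D p u v w) z = - g p (curvature_tensor M D p u v z) w"
  using C.curvature_skew[OF preferred_coord] unfolding chart_values_at .

lemma shape_E_at: "g p (shape p u) (E p) = 0" "shape p (E p) = 0"
  using C.h_E(1)[OF preferred_coord, of u] C.A_E[OF preferred_coord] unfolding chart_values_at by auto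

text \<open>The trace of \<open>A\<close> does not depend on the chart, so the divergence is the trace of the operator \<open>A\<close> of the
chart on the whole coordinate neighbourhood and can be differentiated there.\<close>

lemma bochner_at:
  "endo_trace (\<lambda>u. curvature_tensor M D p u (E p) (E p)) =
     - endo_trace (\<lambda>u. shape p (shape p u)) - mdiff M (divergence D E) p (E p)"
proof -
  have div: "divergence D E q = endo_trace (C.A (snd c q))" if q: "q \<in> fst c" for q
  proof -
    have l: "linear (\<lambda>v. shape q (coord_field M c v q))"
      using linear_compose[OF linear_coord[OF preferred_chart(1) q] linear_shape[OF chart_points[OF preferred_chart(1) q]]]
      by (simp add: o_def)
    have "endo_trace (C.A (snd c q)) = endo_trace (\<lambda>u. J c q (shape q (coord_field M c u q)))"
      using chart_closed_unit_field(2)[OF preferred_chart(1) q] by (metis (full_types))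
    also have "\<dots> = endo_trace (\<lambda>v. shape q (coord_field M c (J c q v) q))"
      by (rule endo_trace_commute[OF linear_J[OF preferred_chart(1) q] l])
    finally show ?thesis using preferred_chart q by (simp add: divergence_def)
  qed
  have "(\<lambda>y. endo_trace (C.A y)) differentiable (at x)"
    unfolding endo_trace_def
    by (intro differentiable_sum finite_Basis ballI differentiable_compose[OF _ C.A_differentiable[OF preferred_coord]]
       bounded_linear_imp_differentiable bounded_linear_inner_left)
  from fd_works[OF this]
  have "(divergence D E \<circ> chart_inv c has_derivative fd (\<lambda>y. endo_trace (C.A y)) x) (at x)"
    by (rule has_derivative_transform_within_open[OF _ C.open_S preferred_coord]) (use div preferred_chart in auto)
  then have "mdiff M (divergence D E) p (E p) = fd (\<lambda>y. endo_trace (C.A y)) x (J c p (E p))"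
    unfolding x_def by (rule mdiff_chart[OF preferred_chart])
  then have "mdiff M (divergence D E) p (E p) = fd (\<lambda>y. endo_trace (C.A y)) x (E p)"
    using p by (simp add: c_def)
  then show ?thesis using C.bochner[OF preferred_coord] unfolding chart_values_at by simp
qed

text \<open>The case \<open>F = id\<close>, \<open>\<kappa> = 2\<close> of \<open>related_curvature\<close>. In the chart the connection of the varied metric is
identified by \<open>variation_connection\<close>.\<close>

lemma variation_curvature_at:
  assumes lcL: "levi_civita_connection M (canonical_variation g E) D'"
  shows "curvature_tensor M D' p u v w = curvature_tensor M D p u v w
     + (2 * g p (curvature_tensor M D p u v (E p)) w) *\<^sub>R E p
     + 2 *\<^sub>R (g p (shape p v) w *\<^sub>R shape p u - g p (shape p u) w *\<^sub>R shape p v)"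
proof -
  let ?g = "canonical_variation g E"
  have conn: "local_connection (snd c ` fst c) (christoffel D' c)"
    by (rule christoffel_connection[OF lcL preferred_chart(1)])
  have GL: "chart_metric ?g c y = C.GL y" if "y \<in> snd c ` fst c" for y
    using that preferred_chart(1) by (auto simp: fun_eq_iff chart_metric_def C.GL_def canonical_variation_def
        metric_dual_def field_rep_def)
  have compat: "fd (\<lambda>x. C.GL x v w) y u = C.GL y (christoffel D' c y u v) w + C.GL y v (christoffel D' c y u w)"
    if y: "y \<in> snd c ` fst c" for y u v w
  proof -
    have "(\<lambda>x. C.GL x v w) differentiable (at y)" using C.GL_has_derivative[OF y] by (rule differentiableI)
    then have "(\<lambda>x. chart_metric ?g c x v w) differentiable (at y)"
      using differentiable_cong_open[OF C.open_S y, of "\<lambda>x. chart_metric ?g c x v w" "\<lambda>x. C.GL x v w"] GL by simp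
    from christoffel_compat[OF lcL preferred_chart(1) y this]
    show ?thesis
      using fd_cong_open[OF C.open_S y, of "\<lambda>x. chart_metric ?g c x v w" "\<lambda>x. C.GL x v w"] GL y by simp
  qed
  have rel: "fd id y (christoffel D' c y a b) = pullback_deriv (christoffel D c) id (\<lambda>y. fd id y b) y a
     + (2 * chart_metric g c (id y) (C.A (id y) (fd id y a)) (fd id y b)) *\<^sub>R (field_rep M c E \<circ> chart_inv c) (id y)"
    if "y \<in> snd c ` fst c" for y a b
    using C.variation_connection[OF conn compat that, of a b] by (simp add: pullback_deriv_def)
  have "curvature_tensor M D' p u v w = chart_curvature (christoffel D' c) x u v w"
    unfolding c_def x_def by (rule curvature_chart[OF lc_affine[OF lcL] p])
  then show ?thesis
    using C.related_curvature[OF C.id_facts(1) smooth_on_id conn rel preferred_coord, of u v w]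
    unfolding frechet_derivative_id id_apply chart_values_at by simp
qed

text \<open>The Gauss equation, as the case \<open>\<kappa> = 1\<close> of \<open>related_curvature\<close> for the immersion in charts. The normal
component \<open>\<alpha>\<close> is left open, since only the tangential part determines the curvature of the leaf.\<close>

lemma gauss_at:
  fixes N :: "('l, 'd::euclidean_space) manifold"
  assumes leaf: "orthogonal_integral_manifold M g E N F"
    and lcN: "levi_civita_connection N (induced_metric N M F g) D'"
    and y: "y \<in> points N" "F y = p"
  shows "\<exists>\<alpha>. tangent_map N M F y (curvature_tensor N D' y u v w) =
      curvature_tensor M D p (tangent_map N M F y u) (tangent_map N M F y v) (tangent_map N M F y w)
      + \<alpha> *\<^sub>R E p
      + (g p (shape p (tangent_map N M F y v)) (tangent_map N M F y w) *\<^sub>R shape p (tangent_map N M F y u)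
       - g p (shape p (tangent_map N M F y u)) (tangent_map N M F y w) *\<^sub>R shape p (tangent_map N M F y v))"
    and "linear (tangent_map N M F y)"
proof -
  have N: "smooth_manifold N" and F: "smooth_map N M F"
    and bij: "\<And>y. y \<in> points N \<Longrightarrow> bij_betw (tangent_map N M F y) UNIV {w. g (F y) (E (F y)) w = 0}"
    using leaf unfolding orthogonal_integral_manifold_def by auto
  interpret N: smooth_mfd N by unfold_locales (rule N)
  define d where "d = chart_at N y"
  have d: "d \<in> atlas N" "y \<in> fst d" using N.chart_at[OF y(1)] by (auto simp: d_def)
  let ?E = "field_rep M c E \<circ> chart_inv c"
  define \<phi> where "\<phi> = snd c \<circ> F \<circ> chart_inv d"
  define W where "W = {q \<in> points N. F q \<in> fst c}"
  define T where "T = snd d ` (fst d \<inter> W)"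
  have "openin (mtop N) W"
    unfolding W_def
    by (rule openin_continuous_map_preimage[OF _ chart_open[OF preferred_chart(1)]])
      (use F in \<open>simp add: smooth_map_def\<close>)
  then have oT: "open T" unfolding T_def by (rule N.chart_image_open[OF d(1)])
  have "smooth_on (snd d ` (fst d \<inter> F -` fst c)) \<phi>"
    using F d preferred_chart unfolding smooth_map_def \<phi>_def by blast
  then have sm: "smooth_on T \<phi>" by (rule smooth_on_subset) (auto simp: T_def W_def)
  have TS: "\<phi> ` T \<subseteq> snd c ` fst c" using d(1) by (auto simp: T_def W_def \<phi>_def)
  have Td: "T \<subseteq> snd d ` fst d" by (auto simp: T_def)
  have conn: "local_connection T (N.christoffel D' d)"
    by (rule local_connection_subset[OF N.christoffel_connection[OF lcN d(1)] oT Td])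
  have tm: "tangent_map N M F q v = coord_field M c (fd \<phi> (snd d q) (N.J d q v)) (F q)"
    if "q \<in> fst d" "F q \<in> fst c" for q v
    unfolding \<phi>_def by (rule tangent_map_chart[OF N manifold F d(1) that(1) preferred_chart(1) that(2)])
  have \<phi>q: "\<phi> (snd d q) = snd c (F q)" if "q \<in> fst d" for q using that d by (simp add: \<phi>_def)
  have range: "range (fd \<phi> z) = {w. chart_metric g c (\<phi> z) (?E (\<phi> z)) w = 0}" if "z \<in> T" for z
  proof -
    obtain q where q: "q \<in> fst d" "F q \<in> fst c" "z = snd d q" "q \<in> points N"
      using \<open>z \<in> T\<close> by (auto simp: T_def W_def)
    have img: "range (tangent_map N M F q) = {w. g (F q) (E (F q)) w = 0}"
      using bij[OF q(4)] by (simp add: bij_betw_def)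
    have metric: "chart_metric g c (\<phi> z) (?E (\<phi> z)) w = g (F q) (E (F q)) (coord_field M c w (F q))" for w
      using q preferred_chart by (simp add: \<phi>q chart_metric_def field_rep_def)
    have fd: "fd \<phi> z v = J c (F q) (tangent_map N M F q (coord_field N d v q))" for v
      using tm[OF q(1,2)] q preferred_chart d by simp
    show ?thesis
    proof (intro subset_antisym subsetI)
      fix w assume "w \<in> range (fd \<phi> z)"
      then obtain v where "w = fd \<phi> z v" by blast
      then show "w \<in> {w. chart_metric g c (\<phi> z) (?E (\<phi> z)) w = 0}"
        unfolding mem_Collect_eq metric fd using img q preferred_chart by auto
    next
      fix w assume "w \<in> {w. chart_metric g c (\<phi> z) (?E (\<phi> z)) w = 0}"
      then have "coord_field M c w (F q) \<in> range (tangent_map N M F q)"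
        unfolding img mem_Collect_eq metric .
      then obtain v where "coord_field M c w (F q) = tangent_map N M F q v" by blast
      then have "w = fd \<phi> z (N.J d q v)"
        using tm[OF q(1,2)] q preferred_chart d by (metis J_coord)
      then show "w \<in> range (fd \<phi> z)" by blast
    qed
  qed
  have metricN: "N.chart_metric (induced_metric N M F g) d z a b =
      chart_metric g c (\<phi> z) (fd \<phi> z a) (fd \<phi> z b)" if "z \<in> T" for z a b
  proof -
    obtain q where q: "q \<in> fst d" "F q \<in> fst c" "z = snd d q"
      using \<open>z \<in> T\<close> by (auto simp: T_def W_def)
    show ?thesis using q preferred_chart d
      by (simp add: N.chart_metric_def induced_metric_def tm \<phi>q chart_metric_def)
  qed
  have compat: "fd (\<lambda>z. chart_metric g c (\<phi> z) (fd \<phi> z a) (fd \<phi> z b)) z u =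
     chart_metric g c (\<phi> z) (fd \<phi> z (N.christoffel D' d z u a)) (fd \<phi> z b)
     + chart_metric g c (\<phi> z) (fd \<phi> z a) (fd \<phi> z (N.christoffel D' d z u b))" if z: "z \<in> T" for z u a b
  proof -
    have "(\<lambda>z. chart_metric g c (\<phi> z) (fd \<phi> z a) (fd \<phi> z b)) differentiable (at z)"
      by (rule differentiableI[OF C.pullback_compat[OF oT z TS]])
        (use z sm smooth_on_differentiable smooth_on_fd in blast)+
    then have "(\<lambda>z. N.chart_metric (induced_metric N M F g) d z a b) differentiable (at z)"
      using differentiable_cong_open[OF oT z, of "\<lambda>z. N.chart_metric (induced_metric N M F g) d z a b"] metricN
      by simp
    from N.christoffel_compat[OF lcN d(1) _ this, of u] z Td
    show ?thesis
      using fd_cong_open[OF oT z, of "\<lambda>z. N.chart_metric (induced_metric N M F g) d z a b"] metricN z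
      by (auto simp: subset_iff)
  qed
  have zT: "snd d y \<in> T" using d y preferred_chart by (auto simp: T_def W_def)
  have xy: "\<phi> (snd d y) = x" using \<phi>q[OF d(2)] y by (simp add: x_def)
  have tmy: "tangent_map N M F y = fd \<phi> (snd d y)"
    using tm[OF d(2)] preferred_chart y p by (auto simp: fun_eq_iff d_def c_def)
  show "linear (tangent_map N M F y)"
    unfolding tmy by (intro linear_frechet_derivative smooth_on_differentiable[OF sm zT])
  have rel: "fd \<phi> z (N.christoffel D' d z a b) = pullback_deriv (christoffel D c) \<phi> (\<lambda>y. fd \<phi> y b) z a
     + (1 * chart_metric g c (\<phi> z) (C.A (\<phi> z) (fd \<phi> z a)) (fd \<phi> z b)) *\<^sub>R ?E (\<phi> z)"
    if "z \<in> T" for z a b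
    using C.leaf_connection[OF TS sm conn range compat that, of a b] by simp
  have curvN: "curvature_tensor N D' y u v w = chart_curvature (N.christoffel D' d) (snd d y) u v w"
    unfolding d_def by (rule N.curvature_chart[OF N.lc_affine[OF lcN] y(1)])
  show "\<exists>\<alpha>. tangent_map N M F y (curvature_tensor N D' y u v w) =
      curvature_tensor M D p (tangent_map N M F y u) (tangent_map N M F y v) (tangent_map N M F y w)
      + \<alpha> *\<^sub>R E p
      + (g p (shape p (tangent_map N M F y v)) (tangent_map N M F y w) *\<^sub>R shape p (tangent_map N M F y u)
       - g p (shape p (tangent_map N M F y u)) (tangent_map N M F y w) *\<^sub>R shape p (tangent_map N M F y v))"
    using C.related_curvature[OF TS sm conn rel zT, of u v w]
    unfolding curvN tmy xy chart_values_at scaleR_one by blast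
qed

end

end

section \<open>Algebra of curvature, traces and planes at a point\<close>

lemma span_pair_iff: "z \<in> span {u, v} \<longleftrightarrow> (\<exists>a b. z = a *\<^sub>R u + b *\<^sub>R (v::'b::real_vector))"
  by (simp add: span_breakdown_eq span_empty algebra_simps)

locale curvature_like =
  fixes g :: "'b::euclidean_space \<Rightarrow> 'b \<Rightarrow> real" and R :: "'b \<Rightarrow> 'b \<Rightarrow> 'b \<Rightarrow> 'b"
  assumes g_bil: "bilinear g" and g_sym: "g u v = g v u"
    and R_lin1: "linear (\<lambda>u. R u v w)" and R_lin2: "linear (\<lambda>v. R u v w)" and R_lin3: "linear (R u v)"
    and R_alt: "R v u w = - R u v w" and R_skew: "g (R u v w) z = - g (R u v z) w"
begin

lemmas g_simps = bilinear_ladd[OF g_bil] bilinear_radd[OF g_bil] bilinear_lmul[OF g_bil] bilinear_rmul[OF g_bil]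
  bilinear_lneg[OF g_bil] bilinear_rneg[OF g_bil] bilinear_lsub[OF g_bil] bilinear_rsub[OF g_bil]
  bilinear_lzero[OF g_bil] bilinear_rzero[OF g_bil]

lemmas R_simps = linear_add[OF R_lin1] linear_add[OF R_lin2] linear_add[OF R_lin3]
  linear_cmul[OF R_lin1] linear_cmul[OF R_lin2] linear_cmul[OF R_lin3]

lemma R_same: "R u u w = 0"
  using R_alt[of u u w] by (metis add.inverse_unique equation_minus_iff neg_eq_iff_add_eq_0 scaleR_half_double scaleR_zero_right)

lemma g_R_same: "g (R u v w) w = 0"
  using R_skew[of u v w w] by simp

lemma change_basis:
  assumes u: "u' = a *\<^sub>R u + b *\<^sub>R v" and v: "v' = c *\<^sub>R u + d *\<^sub>R v"
  shows "g (R u' v' v') u' = (a * d - b * c)\<^sup>2 * g (R u v v) u"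
    and "g u' u' * g v' v' - (g u' v')\<^sup>2 = (a * d - b * c)\<^sup>2 * (g u u * g v v - (g u v)\<^sup>2)"
proof -
  have R: "R u' v' w = (a * d - b * c) *\<^sub>R R u v w" for w
    unfolding u v by (simp add: R_simps R_same R_alt[of v u] algebra_simps)
  show "g (R u' v' v') u' = (a * d - b * c)\<^sup>2 * g (R u v v) u"
    unfolding R unfolding u v
    by (simp add: g_simps R_simps g_R_same R_skew[of u v u v] power2_eq_square algebra_simps)
  show "g u' u' * g v' v' - (g u' v')\<^sup>2 = (a * d - b * c)\<^sup>2 * (g u u * g v v - (g u v)\<^sup>2)"
    unfolding u v by (simp add: g_simps g_sym[of v u] power2_eq_square algebra_simps)
qed

text \<open>Numerator and denominator both change by the square of the determinant. If it is \<open>0\<close>, both vanish for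
the new basis, and expressing the old basis by the new one shows that they vanish for the old
basis as well. So the quotients agree even if the vectors do not span a plane or the denominator is
\<open>0\<close>, which covers the degenerate projected plane in the case \<open>E \<in> \<Pi>\<close>.\<close>

lemma quotient_basis_independent:
  assumes "span {u, v} = span {u', v'}"
  shows "g (R u v v) u / (g u u * g v v - (g u v)\<^sup>2) = g (R u' v' v') u' / (g u' u' * g v' v' - (g u' v')\<^sup>2)"
proof -
  have "u' \<in> span {u, v}" "v' \<in> span {u, v}" "u \<in> span {u', v'}" "v \<in> span {u', v'}"
    unfolding assms using assms by (auto intro: span_base)
  then obtain a b c d a' b' c' d' where
    1: "u' = a *\<^sub>R u + b *\<^sub>R v" "v' = c *\<^sub>R u + d *\<^sub>R v" and
    2: "u = a' *\<^sub>R u' + b' *\<^sub>R v'" "v = c' *\<^sub>R u' + d' *\<^sub>R v'"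
    unfolding span_pair_iff by blast
  show ?thesis
  proof (cases "(a * d - b * c)\<^sup>2 = 0")
    case True
    then show ?thesis using change_basis[OF 1] change_basis[OF 2] by simp
  next
    case False
    then show ?thesis unfolding change_basis[OF 1] by simp
  qed
qed

end

lemma sectional_curvature_basis:
  assumes "curvature_like (g p) (curvature_tensor M D p)" "span {u, v} = P"
  shows "sectional_curvature M g D p P =
    g p (curvature_tensor M D p u v v) u / (g p u u * g p v v - (g p u v)\<^sup>2)"
  unfolding sectional_curvature_def
proof (rule the_equality)
  show "\<forall>u' v'. span {u', v'} = P \<longrightarrow>
      g p (curvature_tensor M D p u v v) u / (g p u u * g p v v - (g p u v)\<^sup>2) =
      g p (curvature_tensor M D p u' v' v') u' / (g p u' u' * g p v' v' - (g p u' v')\<^sup>2)"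
    using curvature_like.quotient_basis_independent[OF assms(1), of u v] assms(2) by metis
qed (use assms(2) in blast)

text \<open>In the degenerate plane \<open>y\<close> spans the radical. A lightlike vector of the plane is therefore a multiple
\<open>b y\<close>, the normalisation forces \<open>b\<^sup>2 = 2\<close>, and a vector outside its span has a nonzero component
along \<open>x\<close>, whose square cancels.\<close>

lemma lightlike_curvature_basis:
  fixes M :: "('a, 'b::euclidean_space) manifold"
  assumes cl: "curvature_like (g p) (curvature_tensor M D p)" and P: "span {x, y} = P"
    and x: "g p x x = 1" and y: "g p y y = 0" "g p x y = 0" "y \<noteq> 0" and E: "(g p y (E p))\<^sup>2 = 1 / 2"
  shows "lightlike_curvature M g D E p P = 2 * g p (curvature_tensor M D p x y y) x"
  unfolding lightlike_curvature_def
proof (rule the_equality)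
  interpret curvature_like "g p" "curvature_tensor M D p" by (rule cl)
  let ?R = "curvature_tensor M D p"
  have gyx: "g p y x = 0" using y g_sym by metis
  show "\<forall>u x'. u \<in> P \<longrightarrow> u \<noteq> 0 \<longrightarrow> g p u u = 0 \<longrightarrow> \<bar>g p u (E p)\<bar> = 1 \<longrightarrow>
     x' \<in> P \<longrightarrow> x' \<notin> span {u} \<longrightarrow> 2 * g p (?R x y y) x = g p (?R x' u u) x' / g p x' x'"
  proof (intro allI impI)
    fix u x' assume u: "u \<in> P" "u \<noteq> 0" "g p u u = 0" "\<bar>g p u (E p)\<bar> = 1" and x': "x' \<in> P" "x' \<notin> span {u}"
    obtain a b where ab: "u = a *\<^sub>R x + b *\<^sub>R y" using u(1) P span_pair_iff by metis
    obtain c d where cd: "x' = c *\<^sub>R x + d *\<^sub>R y" using x'(1) P span_pair_iff by metis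
    have "a = 0" using u(3) by (simp add: ab g_simps x y gyx)
    then have ub: "u = b *\<^sub>R y" by (simp add: ab)
    have "(g p u (E p))\<^sup>2 = 1" using u(4) by (metis power2_abs one_power2)
    then have b: "b\<^sup>2 = 2" using E by (simp add: ub g_simps power_mult_distrib)
    have "c \<noteq> 0"
    proof
      assume "c = 0"
      moreover have "b \<noteq> 0" using b by auto
      ultimately have "x' = (d / b) *\<^sub>R u" by (simp add: cd ub)
      then have "x' \<in> span {u}" by (metis insertI1 span_base span_scale)
      then show False using x'(2) by simp
    qed
    moreover have "g p x' x' = c\<^sup>2" by (simp add: cd g_simps x y gyx power2_eq_square)
    moreover have "g p (?R x' u u) x' = c\<^sup>2 * b\<^sup>2 * g p (?R x y y) x"
      using change_basis(1)[of x' c x d y u 0 b] cd ub by (simp add: power_mult_distrib)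
    ultimately show "2 * g p (?R x y y) x = g p (?R x' u u) x' / g p x' x'" using b by simp
  qed
  fix k assume k: "\<forall>u x'. u \<in> P \<longrightarrow> u \<noteq> 0 \<longrightarrow> g p u u = 0 \<longrightarrow> \<bar>g p u (E p)\<bar> = 1 \<longrightarrow>
     x' \<in> P \<longrightarrow> x' \<notin> span {u} \<longrightarrow> k = g p (?R x' u u) x' / g p x' x'"
  let ?u = "sqrt 2 *\<^sub>R y"
  have "?u \<in> P" "x \<in> P" using P by (auto intro: span_base span_scale)
  moreover have "g p ?u ?u = 0" by (simp add: g_simps y)
  moreover have "\<bar>g p ?u (E p)\<bar> = 1"
  proof -
    have "(g p ?u (E p))\<^sup>2 = 1" using E by (simp add: g_simps power_mult_distrib)
    then show ?thesis by (metis abs_1 power2_eq_1_iff abs_minus_cancel)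
  qed
  moreover have "x \<notin> span {?u}"
    using x y gyx by (auto simp: span_singleton g_simps)
  ultimately have "k = g p (?R x ?u ?u) x / g p x x" using k y by simp
  then show "k = 2 * g p (?R x y y) x" by (simp add: x R_simps g_simps)
qed

lemma orthogonal_independent:
  fixes h :: "'b::euclidean_space \<Rightarrow> 'b \<Rightarrow> real"
  assumes h: "bilinear h" and B: "finite B" "\<And>e. e \<in> B \<Longrightarrow> h e e \<noteq> 0"
    "\<And>e e'. e \<in> B \<Longrightarrow> e' \<in> B \<Longrightarrow> e \<noteq> e' \<Longrightarrow> h e e' = 0"
  shows "independent B"
proof
  assume "dependent B"
  then obtain u v where u: "v \<in> B" "u v \<noteq> 0" "(\<Sum>v\<in>B. u v *\<^sub>R v) = 0"
    using B(1) by (auto simp: dependent_finite)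
  have l: "linear (\<lambda>x. h x v)" using h by (simp add: bilinear_def)
  have "h (\<Sum>v\<in>B. u v *\<^sub>R v) v = (\<Sum>w\<in>B. if w = v then u v * h v v else 0)"
    unfolding linear_sum[OF l] linear_cmul[OF l] using B u by (intro sum.cong) auto
  then show False using u B h by (simp add: bilinear_lzero)
qed

lemma orthonormal_frame_expansion:
  fixes h :: "'b::euclidean_space \<Rightarrow> 'b \<Rightarrow> real"
  assumes h: "bilinear h" and B: "orthonormal_frame h B"
  shows "x = (\<Sum>e\<in>B. (h e e * h x e) *\<^sub>R e)"
proof -
  have B': "finite B" "card B = DIM('b)" "\<And>e. e \<in> B \<Longrightarrow> \<bar>h e e\<bar> = 1"
    "\<And>e e'. e \<in> B \<Longrightarrow> e' \<in> B \<Longrightarrow> e \<noteq> e' \<Longrightarrow> h e e' = 0"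
    using B by (auto simp: orthonormal_frame_def)
  have ne: "h e e \<noteq> 0" if "e \<in> B" for e using B'(3)[OF that] by auto
  have sq: "h e e * h e e = 1" if "e \<in> B" for e
    using B'(3)[OF that] by (metis abs_mult_self_eq mult_1)
  have "independent B" by (rule orthogonal_independent[OF h B'(1) ne B'(4)])
  then have "UNIV \<subseteq> span B"
    by (intro card_ge_dim_independent) (auto simp: B')
  then obtain u where u: "x = (\<Sum>e\<in>B. u e *\<^sub>R e)" using span_finite[OF B'(1)] by blast
  have "h x f = u f * h f f" if "f \<in> B" for f
  proof -
    have l: "linear (\<lambda>x. h x f)" using h by (simp add: bilinear_def)
    have "h x f = (\<Sum>e\<in>B. if e = f then u f * h f f else 0)"
      unfolding u linear_sum[OF l] linear_cmul[OF l] using B' that by (intro sum.cong) auto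
    then show ?thesis using that B' by simp
  qed
  then have "(h e e * h x e) *\<^sub>R e = u e *\<^sub>R e" if "e \<in> B" for e
    using sq[OF that] that by (simp add: mult.commute mult.left_commute)
  then show ?thesis using u by (metis (no_types, lifting) sum.cong)
qed

text \<open>Expand each standard basis vector in the frame and exchange the order of summation.\<close>

lemma endo_trace_frame:
  fixes h :: "'b::euclidean_space \<Rightarrow> 'b \<Rightarrow> real"
  assumes h: "bilinear h" and B: "orthonormal_frame h B" and L: "linear L"
  shows "endo_trace L = (\<Sum>e\<in>B. h e e * h (L e) e)"
proof -
  have "endo_trace L = (\<Sum>b\<in>Basis. L (\<Sum>e\<in>B. (h e e * h b e) *\<^sub>R e) \<bullet> b)"
    unfolding endo_trace_def using orthonormal_frame_expansion[OF h B] by metis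
  also have "\<dots> = (\<Sum>b\<in>Basis. \<Sum>e\<in>B. h e e * (h b e * (L e \<bullet> b)))"
    by (simp add: linear_sum[OF L] linear_cmul[OF L] inner_sum_left mult.assoc)
  also have "\<dots> = (\<Sum>e\<in>B. \<Sum>b\<in>Basis. h e e * (h b e * (L e \<bullet> b)))"
    by (rule sum.swap)
  also have "\<dots> = (\<Sum>e\<in>B. h e e * h (\<Sum>b\<in>Basis. (L e \<bullet> b) *\<^sub>R b) e)"
  proof (rule sum.cong[OF refl])
    fix e
    have l: "linear (\<lambda>x. h x e)" using h by (simp add: bilinear_def)
    show "(\<Sum>b\<in>Basis. h e e * (h b e * (L e \<bullet> b))) = h e e * h (\<Sum>b\<in>Basis. (L e \<bullet> b) *\<^sub>R b) e"
      by (simp add: linear_sum[OF l] linear_cmul[OF l] sum_distrib_left mult.commute)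
  qed
  finally show ?thesis by (simp add: euclidean_representation)
qed

text \<open>The frame \<open>B\<close> represents the bilinear form \<open>b\<close> as \<open>h(L x, y)\<close>; the sum over any other frame is then the
trace of the same endomorphism \<open>L\<close>.\<close>

lemma metric_trace_frame:
  fixes h b :: "'b::euclidean_space \<Rightarrow> 'b \<Rightarrow> real"
  assumes h: "bilinear h" "\<And>u v. h u v = h v u" and b: "bilinear b" and B: "orthonormal_frame h B"
  shows "metric_trace h b = (\<Sum>e\<in>B. h e e * b e e)"
proof -
  define L where "L x = (\<Sum>e\<in>B. (h e e * b x e) *\<^sub>R e)" for x
  have L: "linear L"
    unfolding L_def linear_iff
    by (auto simp: bilinear_ladd[OF b] bilinear_lmul[OF b] algebra_simps sum.distrib scaleR_sum_right)
  have hL: "h (L x) y = b x y" for x y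
  proof -
    have l: "linear (\<lambda>x. h x y)" "linear (b x)" using h(1) b by (auto simp: bilinear_def)
    have "h (L x) y = (\<Sum>e\<in>B. (h e e * b x e) * h e y)"
      by (simp add: L_def linear_sum[OF l(1)] linear_cmul[OF l(1)])
    also have "\<dots> = b x (\<Sum>e\<in>B. (h e e * h y e) *\<^sub>R e)"
      unfolding linear_sum[OF l(2)] linear_cmul[OF l(2)] by (intro sum.cong) (simp_all add: h(2)[of y])
    finally show ?thesis using orthonormal_frame_expansion[OF h(1) B] by metis
  qed
  have tr: "(\<Sum>e\<in>C. h e e * b e e) = endo_trace L" if "orthonormal_frame h C" for C
    unfolding endo_trace_frame[OF h(1) that L] hL ..
  show ?thesis
    unfolding metric_trace_def
    by (rule the_equality) (use tr B in auto)
qed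

text \<open>Gram-Schmidt, started with \<open>e\<close> and continued until the number of vectors is the dimension.\<close>

lemma exists_orthonormal_frame:
  fixes g :: "'b::euclidean_space \<Rightarrow> 'b \<Rightarrow> real"
  assumes g: "bilinear g" "\<And>u v. g u v = g v u" "\<And>u. u \<noteq> 0 \<Longrightarrow> g u u > 0" and e: "g e e = 1"
  obtains B where "orthonormal_frame g B" "e \<in> B" "\<And>b. b \<in> B \<Longrightarrow> g b b = 1"
proof -
  note gs = bilinear_lmul[OF g(1)] bilinear_rmul[OF g(1)]
  have "\<exists>B. finite B \<and> card B = n \<and> e \<in> B \<and> (\<forall>b\<in>B. g b b = 1) \<and> (\<forall>b\<in>B. \<forall>b'\<in>B. b \<noteq> b' \<longrightarrow> g b b' = 0)"
    if "1 \<le> n" "n \<le> DIM('b)" for n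
    using that
  proof (induction n rule: dec_induct)
    case base
    then show ?case using e by (intro exI[of _ "{e}"]) auto
  next
    case (step n)
    then obtain B where B: "finite B" "card B = n" "e \<in> B" "\<And>b. b \<in> B \<Longrightarrow> g b b = 1"
      "\<And>b b'. b \<in> B \<Longrightarrow> b' \<in> B \<Longrightarrow> b \<noteq> b' \<Longrightarrow> g b b' = 0" by auto
    have "span B \<noteq> UNIV"
    proof
      assume "span B = UNIV"
      then have "DIM('b) \<le> card B" using dim_le_card[of UNIV B] B(1) by simp
      then show False using step B by simp
    qed
    then obtain v where v: "v \<notin> span B" by blast
    define w where "w = v - (\<Sum>b\<in>B. g v b *\<^sub>R b)"
    have "w \<noteq> 0"
    proof
      assume "w = 0"
      then have "v = (\<Sum>b\<in>B. g v b *\<^sub>R b)" by (simp add: w_def)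
      also have "\<dots> \<in> span B" by (intro span_sum span_scale span_base)
      finally show False using v by simp
    qed
    then have gw: "g w w > 0" by (rule g(3))
    have wb: "g w c = 0" if "c \<in> B" for c
    proof -
      have l: "linear (\<lambda>x. g x c)" using g(1) by (simp add: bilinear_def)
      have "g (\<Sum>b\<in>B. g v b *\<^sub>R b) c = (\<Sum>b\<in>B. if b = c then g v c else 0)"
        unfolding linear_sum[OF l] linear_cmul[OF l] using B that by (intro sum.cong) auto
      then show ?thesis unfolding w_def bilinear_lsub[OF g(1)] using that B(1) by simp
    qed
    define z where "z = (1 / sqrt (g w w)) *\<^sub>R w"
    have z: "g z z = 1" using gw by (simp add: z_def gs divide_simps)
    have zb: "g z c = 0" "g c z = 0" if "c \<in> B" for c
      using wb[OF that] g(2)[of c z] by (simp_all add: z_def gs)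
    have "z \<notin> B" using zb z by fastforce
    then show ?case
      by (intro exI[of _ "insert z B"]) (use B z zb in auto)
  qed
  from this[of "DIM('b)"] obtain B where "finite B" "card B = DIM('b)" "e \<in> B" "\<forall>b\<in>B. g b b = 1"
    "\<forall>b\<in>B. \<forall>b'\<in>B. b \<noteq> b' \<longrightarrow> g b b' = 0"
    using DIM_positive[where 'a='b] by (metis Suc_leI One_nat_def order_refl)
  then show thesis by (intro that[of B]) (auto simp: orthonormal_frame_def)
qed

lemma endo_trace_rank_one:
  fixes f :: "'b::euclidean_space \<Rightarrow> real"
  assumes "linear f"
  shows "endo_trace (\<lambda>x. f x *\<^sub>R w) = f w"
proof -
  have "f w = f (\<Sum>b\<in>Basis. (w \<bullet> b) *\<^sub>R b)" by (simp add: euclidean_representation)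
  then show ?thesis
    by (simp add: endo_trace_def linear_sum[OF assms] linear_cmul[OF assms] mult.commute)
qed

text \<open>The functional \<open>g(e, \<cdot>)\<close> vanishes on some nonzero vector of the plane, which gives \<open>x\<close>. Then \<open>g(e, y)\<close> is the
length of the projection of \<open>e\<close> to the plane, once the sign of \<open>y\<close> is chosen.\<close>

lemma plane_adapted_basis:
  fixes g :: "'b::euclidean_space \<Rightarrow> 'b \<Rightarrow> real"
  assumes g: "bilinear g" "\<And>u v. g u v = g v u" "\<And>u. u \<noteq> 0 \<Longrightarrow> g u u > 0" and P: "is_plane P"
  obtains x y where "span {x, y} = P" "g x x = 1" "g y y = 1" "g x y = 0" "g e x = 0" "g e y \<ge> 0"
proof -
  note gs = bilinear_lmul[OF g(1)] bilinear_rmul[OF g(1)] bilinear_lsub[OF g(1)] bilinear_rsub[OF g(1)]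
     bilinear_lneg[OF g(1)] bilinear_rneg[OF g(1)]
  have sub: "subspace P" "dim P = 2" using P by (auto simp: is_plane_def)
  obtain B where B: "B \<subseteq> P" "independent B" "P \<subseteq> span B" "card B = 2"
    using basis_exists[of P] sub by metis
  obtain u v where uv: "B = {u, v}" "u \<noteq> v" using B(4) card_2_iff by metis
  have unit: "\<exists>z\<in>P. g z z = 1 \<and> (\<exists>k. k \<noteq> 0 \<and> z = k *\<^sub>R w)" if "w \<in> P" "w \<noteq> 0" for w
    using that g(3)[of w] subspace_scale[OF sub(1)]
    by (intro bexI[of _ "(1 / sqrt (g w w)) *\<^sub>R w"] conjI exI[of _ "1 / sqrt (g w w)"])
       (auto simp: gs divide_simps)
  have "\<exists>x0\<in>P. x0 \<noteq> 0 \<and> g e x0 = 0"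
  proof (cases "g e u = 0")
    case True
    moreover have "u \<noteq> 0" using B(2) uv dependent_zero[of B] by auto
    ultimately show ?thesis using B uv by (intro bexI[of _ u]) auto
  next
    case False
    let ?x = "g e v *\<^sub>R u - g e u *\<^sub>R v"
    have "?x \<noteq> 0"
    proof
      assume "?x = 0"
      then have "v = (g e v / g e u) *\<^sub>R u"
        using False by (simp add: divide_simps) (metis divide_inverse_commute eq_vector_fraction_iff scaleR_scaleR)
      then have "v \<in> span {u}" by (metis insertI1 span_base span_scale)
      then have "dependent B" unfolding uv dependent_def
        using uv(2) by (intro bexI[of _ v]) (auto simp: insert_Diff_if)
      then show False using B(2) by simp
    qed
    moreover have "?x \<in> P" using B uv sub by (auto intro!: subspace_diff subspace_scale)
    ultimately show ?thesis by (intro bexI[of _ ?x]) (auto simp: gs)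
  qed
  then obtain x0 where x0: "x0 \<in> P" "x0 \<noteq> 0" "g e x0 = 0" by blast
  obtain x where x: "x \<in> P" "g x x = 1" "g e x = 0"
    using unit[OF x0(1,2)] x0(3) by (auto simp: gs)
  have "\<exists>w\<in>P. w \<notin> span {x}"
  proof (rule ccontr)
    assume "\<not> ?thesis"
    then have "P \<subseteq> span {x}" by blast
    then have "dim P \<le> 1" using dim_le_card[of P "{x}"] by simp
    then show False using sub by simp
  qed
  then obtain w where w: "w \<in> P" "w \<notin> span {x}" by blast
  let ?w = "w - g x w *\<^sub>R x"
  have "?w \<noteq> 0" using w(2) by (metis eq_iff_diff_eq_0 insertI1 span_base span_scale)
  moreover have "?w \<in> P" using w x sub by (auto intro!: subspace_diff subspace_scale)
  moreover have "g x ?w = 0" by (simp add: gs x)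
  ultimately obtain y0 where y0: "y0 \<in> P" "g y0 y0 = 1" "g x y0 = 0"
    using unit[of ?w] by (auto simp: gs)
  define y where "y = (if g e y0 \<ge> 0 then y0 else - y0)"
  have y: "y \<in> P" "g y y = 1" "g x y = 0" "g e y \<ge> 0"
    using y0 subspace_neg[OF sub(1)] by (auto simp: y_def gs)
  have "x \<noteq> y" using x y by auto
  have "independent {x, y}"
    by (rule orthogonal_independent[OF g(1)]) (use x y g(2) in auto)
  then have "dim (span {x, y}) = 2"
    using \<open>x \<noteq> y\<close> by (simp add: dim_eq_card_independent)
  then have "span {x, y} = P"
    using x y sub by (intro subspace_dim_equal span_minimal) (auto simp: span_minimal)
  then show thesis using that x y by blast
qed

text \<open>For \<open>z = a x + b y\<close> the cosine of the angle between \<open>e\<close> and \<open>z\<close> is \<open>b g(e, y) / \<surd>(a\<^sup>2 + b\<^sup>2)\<close>, which is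
largest for \<open>z = y\<close>.\<close>

lemma angle_plane_adapted:
  fixes g :: "'b::euclidean_space \<Rightarrow> 'b \<Rightarrow> real"
  assumes g: "bilinear g" "\<And>u v. g u v = g v u" "\<And>u. u \<noteq> 0 \<Longrightarrow> g u u > 0" and e: "g e e = 1"
    and xy: "span {x, y} = P" "g x x = 1" "g y y = 1" "g x y = 0" "g e x = 0" "g e y \<ge> 0"
  shows "angle_plane g e P = arccos (g e y)" "g e y \<le> 1"
proof -
  note gs = bilinear_lmul[OF g(1)] bilinear_rmul[OF g(1)] bilinear_lsub[OF g(1)] bilinear_rsub[OF g(1)]
     bilinear_ladd[OF g(1)] bilinear_radd[OF g(1)] bilinear_lzero[OF g(1)]
  let ?c = "g e y"
  have "g (y - ?c *\<^sub>R e) (y - ?c *\<^sub>R e) = 1 - ?c * ?c"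
    by (simp add: gs xy e g(2)[of y e] algebra_simps)
  moreover have "g (y - ?c *\<^sub>R e) (y - ?c *\<^sub>R e) \<ge> 0"
    using g(3)[of "y - ?c *\<^sub>R e"] by (cases "y - ?c *\<^sub>R e = 0") (auto simp: gs)
  ultimately have "?c\<^sup>2 \<le> 1" by (simp add: power2_eq_square)
  then show c1: "?c \<le> 1" using xy(6) by (simp add: power2_le_iff_abs_le abs_square_le_1)
  have y0: "y \<noteq> 0" using xy(3) by (auto simp: gs)
  show "angle_plane g e P = arccos (g e y)"
    unfolding angle_plane_def
  proof (rule cInf_eq_minimum)
    show "arccos ?c \<in> (\<lambda>x. arccos (g e x / (sqrt (g e e) * sqrt (g x x)))) ` (P - {0})"
      using y0 e xy by (intro image_eqI[of _ _ y]) (auto intro: span_base)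
    fix t assume "t \<in> (\<lambda>x. arccos (g e x / (sqrt (g e e) * sqrt (g x x)))) ` (P - {0})"
    then obtain z where z: "z \<in> P" "z \<noteq> 0" "t = arccos (g e z / sqrt (g z z))" using e by auto
    obtain a b where ab: "z = a *\<^sub>R x + b *\<^sub>R y" using z(1) xy(1) span_pair_iff by metis
    have ez: "g e z = b * ?c" by (simp add: ab gs xy)
    have zz: "g z z = a\<^sup>2 + b\<^sup>2" by (simp add: ab gs xy g(2)[of y x] power2_eq_square)
    have pos: "sqrt (g z z) > 0" using g(3)[OF z(2)] by simp
    have "\<bar>b\<bar> \<le> sqrt (g z z)" unfolding zz by (simp add: real_le_rsqrt)
    then have "\<bar>b * ?c\<bar> \<le> sqrt (g z z) * ?c"
      using xy(6) by (simp add: abs_mult mult_right_mono)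
    then have "\<bar>b * ?c / sqrt (g z z)\<bar> \<le> ?c"
      using pos by (simp add: abs_divide pos_divide_le_eq mult.commute)
    then have "b * ?c / sqrt (g z z) \<le> ?c" "- (b * ?c / sqrt (g z z)) \<le> ?c"
      by (simp_all only: abs_le_iff)
    then show "arccos ?c \<le> t" unfolding z(3) ez
      by (intro arccos_le_arccos) (use c1 in linarith)+
  qed
qed

section \<open>Curvature of the canonical variation\<close>

context closed_unitary_geometry
begin

context
  fixes p
  assumes p: "p \<in> points M"
begin

lemmas gp_simps = bilinear_ladd[OF g_bilinear[OF p]] bilinear_radd[OF g_bilinear[OF p]]
  bilinear_lmul[OF g_bilinear[OF p]] bilinear_rmul[OF g_bilinear[OF p]]
  bilinear_lsub[OF g_bilinear[OF p]] bilinear_rsub[OF g_bilinear[OF p]]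
  bilinear_lneg[OF g_bilinear[OF p]] bilinear_rneg[OF g_bilinear[OF p]]
  bilinear_lzero[OF g_bilinear[OF p]] bilinear_rzero[OF g_bilinear[OF p]]

abbreviation h :: "'b \<Rightarrow> 'b \<Rightarrow> real" where "h u v \<equiv> g p (shape p u) v"

abbreviation R :: "'b \<Rightarrow> 'b \<Rightarrow> 'b \<Rightarrow> 'b" where "R \<equiv> curvature_tensor M D p"

lemma curvature_like_R: "curvature_like (g p) R"
proof (rule curvature_like.intro)
  show "bilinear (g p)" by (rule g_bilinear[OF p])
  show "g p u v = g p v u" for u v by (rule g_sym[OF p])
  show "g p (R u v w) z = - g p (R u v z) w" for u v w z by (rule curvature_skew_at[OF p])
qed (rule curvature_tensor_multilinear[OF lc p])+

interpretation R: curvature_like "g p" R by (rule curvature_like_R)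

lemma h_sym: "h u v = h v u"
  by (rule shape_sym[OF p])

lemma canonical_variation_at:
  "canonical_variation g E p u v = g p u v - 2 * (g p (E p) u * g p (E p) v)"
  by (simp add: canonical_variation_def metric_dual_def)

lemma bilinear_variation: "bilinear (canonical_variation g E p)"
  unfolding bilinear_def linear_iff canonical_variation_at by (auto simp: gp_simps algebra_simps)

text \<open>The varied metric pairs \<open>E\<close> with \<open>z\<close> to \<open>- \<omega>(z)\<close>, and \<open>g(R\<^bsub>uv\<^esub>E, w) = - \<omega>(R\<^bsub>uv\<^esub>w)\<close>; so the \<open>E\<close>-component of the
curvature cancels the term \<open>- 2 \<omega> \<otimes> \<omega>\<close> of the metric.\<close>

lemma variation_curvature_form:
  assumes lcL: "levi_civita_connection M (canonical_variation g E) D'"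
  shows "canonical_variation g E p (curvature_tensor M D' p u v w) z
    = g p (R u v w) z + 2 * (h v w * h u z - h u w * h v z)"
  using shape_E_at(1)[OF p] R.R_skew[of u v "E p" w] E_unitary[OF p]
  by (simp add: variation_curvature_at[OF p lcL] canonical_variation_at gp_simps
      g_sym[OF p, of "E p" "R u v w"] g_sym[OF p, of "E p" "shape p u"] g_sym[OF p, of "E p" "shape p v"]
      algebra_simps)

lemma curvature_like_variation:
  assumes lcL: "levi_civita_connection M (canonical_variation g E) D'"
  shows "curvature_like (canonical_variation g E p) (curvature_tensor M D' p)"
proof (rule curvature_like.intro)
  show "bilinear (canonical_variation g E p)" by (rule bilinear_variation)
  show "canonical_variation g E p u v = canonical_variation g E p v u" for u v
    using g_sym[OF p, of u v] by (simp add: canonical_variation_at)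
  show "canonical_variation g E p (curvature_tensor M D' p u v w) z =
    - canonical_variation g E p (curvature_tensor M D' p u v z) w" for u v w z
    using R.R_skew[of u v w z] by (simp add: variation_curvature_form[OF lcL])
qed (rule curvature_tensor_multilinear[OF lcL p])+

text \<open>Pairing the Gauss equation with a tangent vector removes the normal component.\<close>

lemma leaf_curvature_form:
  assumes leaf: "orthogonal_integral_manifold M g E N F"
    and lcN: "levi_civita_connection N (induced_metric N M F g) D'"
    and y: "y \<in> points N" "F y = p"
  defines "T \<equiv> tangent_map N M F y"
  shows "induced_metric N M F g y (curvature_tensor N D' y u v w) z
    = g p (R (T u) (T v) (T w)) (T z) + (h (T v) (T w) * h (T u) (T z) - h (T u) (T w) * h (T v) (T z))"
    and "curvature_like (induced_metric N M F g y) (curvature_tensor N D' y)"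
proof -
  have N: "smooth_manifold N" and bij: "bij_betw T UNIV {w. g p (E p) w = 0}"
    using leaf y unfolding orthogonal_integral_manifold_def T_def by auto
  interpret N: smooth_mfd N by unfold_locales (rule N)
  note gauss = gauss_at[OF p leaf lcN y, folded T_def]
  have ET: "g p (E p) (T z) = 0" for z using bij by (auto simp: bij_betw_def)
  have metric: "induced_metric N M F g y a b = g p (T a) (T b)" for a b
    using y by (simp add: induced_metric_def T_def)
  show form: "induced_metric N M F g y (curvature_tensor N D' y u v w) z
    = g p (R (T u) (T v) (T w)) (T z) + (h (T v) (T w) * h (T u) (T z) - h (T u) (T w) * h (T v) (T z))"
    for u v w z
  proof -
    obtain \<alpha> where "T (curvature_tensor N D' y u v w) = R (T u) (T v) (T w) + \<alpha> *\<^sub>R E p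
        + (h (T v) (T w) *\<^sub>R shape p (T u) - h (T u) (T w) *\<^sub>R shape p (T v))"
      using gauss(1)[of u v w] by blast
    then show ?thesis by (simp add: metric gp_simps ET)
  qed
  show "curvature_like (induced_metric N M F g y) (curvature_tensor N D' y)"
  proof (rule curvature_like.intro)
    show "bilinear (induced_metric N M F g y)"
      unfolding bilinear_def linear_iff metric
      by (auto simp: linear_add[OF gauss(2)] linear_cmul[OF gauss(2)] gp_simps)
    show "induced_metric N M F g y u v = induced_metric N M F g y v u" for u v
      unfolding metric by (rule g_sym[OF p])
    show "induced_metric N M F g y (curvature_tensor N D' y u v w) z =
      - induced_metric N M F g y (curvature_tensor N D' y u v z) w" for u v w z
      unfolding form using R.R_skew[of "T u" "T v" "T w" "T z"] by simp
  qed (rule N.curvature_tensor_multilinear[OF lcN y(1)])+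
qed

text \<open>The tangent map is injective, so the preimage of the plane is spanned by the preimages of \<open>u\<close> and \<open>v\<close>.\<close>

lemma induced_curvature_basis:
  assumes leaf: "orthogonal_integral_manifold M g E N F"
    and lcN: "levi_civita_connection N (induced_metric N M F g) D'"
    and y: "y \<in> points N" "F y = p"
    and u: "g p (E p) u = 0" and v: "g p (E p) v = 0"
  shows "induced_curvature N M F g D' y (span {u, v}) =
    (g p (R u v v) u + (h v v * h u u - h u v * h v u)) / (g p u u * g p v v - (g p u v)\<^sup>2)"
proof -
  let ?T = "tangent_map N M F y"
  have bij: "bij_betw ?T UNIV {w. g p (E p) w = 0}"
    using leaf y unfolding orthogonal_integral_manifold_def by auto
  then obtain a b where ab: "?T a = u" "?T b = v"
    using u v by (metis (mono_tags, lifting) bij_betw_imp_surj_on imageE mem_Collect_eq)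
  have "span {u, v} = ?T ` span {a, b}"
    using linear_span_image[OF gauss_at(2)[OF p leaf lcN y], of "{a, b}"] ab by simp
  then have "?T -` span {u, v} = span {a, b}"
    using bij by (simp add: bij_betw_def inj_vimage_image_eq)
  then have "induced_curvature N M F g D' y (span {u, v})
      = sectional_curvature N (induced_metric N M F g) D' y (span {a, b})"
    by (simp add: induced_curvature_def)
  also have "\<dots> = (g p (R u v v) u + (h v v * h u u - h u v * h v u)) / (g p u u * g p v v - (g p u v)\<^sup>2)"
    unfolding sectional_curvature_basis[where p = y and g = "induced_metric N M F g",
        OF leaf_curvature_form(2)[OF leaf lcN y] refl]
    unfolding leaf_curvature_form(1)[OF leaf lcN y]
    unfolding induced_metric_def
    using ab y by simp
  finally show ?thesis .
qed

text \<open>The projected plane is spanned by \<open>x\<close> and \<open>w = y - cos \<theta> E\<close>, where \<open>g(w, w) = sin\<^sup>2 \<theta>\<close> and \<open>h(w, \<cdot>) = h(y, \<cdot>)\<close>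
because \<open>A(E) = 0\<close>. In the form multiplied by \<open>sin\<^sup>2 \<theta>\<close> the identity also holds for \<open>w = 0\<close>.\<close>

lemma projected_plane:
  assumes leaf: "orthogonal_integral_manifold M g E N F"
    and lcN: "levi_civita_connection N (induced_metric N M F g) D'"
    and z: "z \<in> points N" "F z = p"
    and xy: "span {x, y} = P" "g p x x = 1" "g p y y = 1" "g p x y = 0" "g p (E p) x = 0"
  defines "P' \<equiv> orth_proj (g p) (E p) ` P"
  shows "(1 - (g p (E p) y)\<^sup>2) * (induced_curvature N M F g D' z P' - sectional_curvature M g D p P')
    = h y y * h x x - h x y * h y x"
proof -
  let ?c = "g p (E p) y"
  define w where "w = y - ?c *\<^sub>R E p"
  have lin: "linear (orth_proj (g p) (E p))"
    unfolding orth_proj_def linear_iff by (auto simp: gp_simps algebra_simps)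
  have P': "P' = span {x, w}"
    unfolding P'_def xy(1)[symmetric] linear_span_image[OF lin, symmetric] 
    by (simp add: orth_proj_def xy(5) w_def)
  have Ew: "g p (E p) w = 0" by (simp add: w_def gp_simps E_unitary[OF p])
  have xw: "g p x w = 0" using xy(4,5) g_sym[OF p, of x "E p"] by (simp add: w_def gp_simps)
  have ww: "g p w w = 1 - ?c\<^sup>2"
    using xy(3) g_sym[OF p, of y "E p"] E_unitary[OF p]
    by (simp add: w_def gp_simps power2_eq_square algebra_simps)
  have hE: "h u w = h u y" "h w u = h y u" for u
    using shape_E_at[OF p] linear_diff[OF linear_shape[OF p]] linear_cmul[OF linear_shape[OF p]]
    by (simp_all add: w_def gp_simps)
  have "induced_curvature N M F g D' z P' - sectional_curvature M g D p P'
    = (h w w * h x x - h x w * h w x) / (1 - ?c\<^sup>2)"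
    unfolding P' induced_curvature_basis[OF leaf lcN z xy(5) Ew]
      sectional_curvature_basis[where p = p and g = g, OF curvature_like_R refl]
    by (simp add: xy(2) xw ww diff_divide_distrib[symmetric])
  moreover have "h w w * h x x - h x w * h w x = 0" if "1 - ?c\<^sup>2 = 0"
  proof -
    have "w = 0" using ww that g_pos[OF p, of w] by force
    then show ?thesis using linear_0[OF linear_shape[OF p]] by (simp add: gp_simps)
  qed
  ultimately show ?thesis by (simp add: hE)
qed

text \<open>In the adapted basis the denominator of the varied sectional curvature is \<open>g\<^sub>L(y, y) = - cos 2\<theta>\<close>, which is
nonzero since otherwise \<open>y\<close> would be in the radical of the plane.\<close>

lemma nondegenerate_plane_curvature:
  assumes lcL: "levi_civita_connection M (canonical_variation g E) D'"
    and P: "is_plane P" "\<not> degenerate_on (canonical_variation g E p) P"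
    and leaf: "orthogonal_integral_manifold M g E N F"
    and lcN: "levi_civita_connection N (induced_metric N M F g) DN"
    and z: "z \<in> points N" "F z = p"
  defines "\<theta> \<equiv> angle_plane (g p) (E p) P" and "P' \<equiv> orth_proj (g p) (E p) ` P"
  shows "- cos (2 * \<theta>) * sectional_curvature M (canonical_variation g E) D' p P =
    sectional_curvature M g D p P + 2 * (sin \<theta>)\<^sup>2 *
      (induced_curvature N M F g DN z P' - sectional_curvature M g D p P')"
proof -
  obtain x y where xy: "span {x, y} = P" "g p x x = 1" "g p y y = 1" "g p x y = 0"
      "g p (E p) x = 0" "g p (E p) y \<ge> 0"
    using plane_adapted_basis[OF g_bilinear[OF p] g_sym[OF p] g_pos[OF p] P(1)] by blast
  let ?c = "g p (E p) y"
  note angle = angle_plane_adapted[OF g_bilinear[OF p] g_sym[OF p] g_pos[OF p] E_unitary[OF p] xy]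
  have "\<theta> = arccos ?c" unfolding \<theta>_def by (rule angle(1))
  then have \<theta>: "cos \<theta> = ?c" using angle(2) xy(6) by simp
  have cos2: "cos (2 * \<theta>) = 2 * ?c\<^sup>2 - 1" by (simp add: cos_double_cos \<theta>)
  have sin2: "(sin \<theta>)\<^sup>2 = 1 - ?c\<^sup>2" by (simp add: sin_squared_eq \<theta>)
  have gL: "canonical_variation g E p x x = 1" "canonical_variation g E p x y = 0"
    "canonical_variation g E p y x = 0" "canonical_variation g E p y y = 1 - 2 * ?c\<^sup>2"
    using g_sym[OF p, of y x] by (simp_all add: canonical_variation_at xy power2_eq_square)
  have "1 - 2 * ?c\<^sup>2 \<noteq> 0"
  proof
    assume 0: "1 - 2 * ?c\<^sup>2 = 0"
    have "y \<in> P" "y \<noteq> 0" using xy by (auto simp: gp_simps intro: span_base)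
    moreover have "canonical_variation g E p y v = 0" if v: "v \<in> P" for v
    proof -
      obtain a b where "v = a *\<^sub>R x + b *\<^sub>R y" using v xy(1) span_pair_iff by metis
      then show ?thesis
        using gL 0
        by (simp add: bilinear_radd[OF bilinear_variation] bilinear_rmul[OF bilinear_variation])
    qed
    ultimately show False using P(2) unfolding degenerate_on_def by blast
  qed
  then have KL: "(1 - 2 * ?c\<^sup>2) * sectional_curvature M (canonical_variation g E) D' p P
      = g p (R x y y) x + 2 * (h y y * h x x - h x y * h y x)"
    using sectional_curvature_basis[where p = p and g = "canonical_variation g E",
        OF curvature_like_variation[OF lcL] xy(1)] by (simp add: variation_curvature_form[OF lcL] gL)
  have K: "sectional_curvature M g D p P = g p (R x y y) x"
    using sectional_curvature_basis[where p = p and g = g, OF curvature_like_R xy(1)] by (simp add: xy)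
  have "- cos (2 * \<theta>) * sectional_curvature M (canonical_variation g E) D' p P
      = (1 - 2 * ?c\<^sup>2) * sectional_curvature M (canonical_variation g E) D' p P"
    by (simp add: cos2)
  also have "\<dots> = sectional_curvature M g D p P + 2 * ((1 - ?c\<^sup>2) *
      (induced_curvature N M F g DN z P' - sectional_curvature M g D p P'))"
    unfolding KL K projected_plane[OF leaf lcN z xy(1-5), folded P'_def] ..
  finally show ?thesis by (simp only: sin2 mult.assoc)
qed

text \<open>The vector \<open>y\<close> of the adapted basis is \<open>E\<close> itself, and \<open>A(E) = 0\<close> removes the correction.\<close>

lemma plane_containing_E_curvature:
  assumes lcL: "levi_civita_connection M (canonical_variation g E) D'"
    and P: "is_plane P" "E p \<in> P"
  shows "sectional_curvature M (canonical_variation g E) D' p P = - sectional_curvature M g D p P"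
proof -
  obtain x y where xy: "span {x, y} = P" "g p x x = 1" "g p y y = 1" "g p x y = 0"
      "g p (E p) x = 0" "g p (E p) y \<ge> 0"
    using plane_adapted_basis[OF g_bilinear[OF p] g_sym[OF p] g_pos[OF p] P(1)] by blast
  obtain a b where ab: "E p = a *\<^sub>R x + b *\<^sub>R y" using P(2) xy(1) span_pair_iff by metis
  have "g p (a *\<^sub>R x + b *\<^sub>R y) x = 0" using xy(5) ab by simp
  then have "a = 0" using xy g_sym[OF p, of y x] by (simp add: gp_simps)
  then have Eb: "E p = b *\<^sub>R y" using ab by simp
  have "b\<^sup>2 = 1" using E_unitary[OF p] by (simp add: Eb gp_simps xy power2_eq_square)
  moreover have "b \<ge> 0" using xy(6) by (simp add: Eb gp_simps xy(3))
  ultimately have "b = 1" by (simp add: power2_eq_1_iff)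
  then have yE: "E p = y" using Eb by simp
  have gL: "canonical_variation g E p x x = 1" "canonical_variation g E p x y = 0"
    "canonical_variation g E p y y = -1"
    using xy(5) by (simp_all add: canonical_variation_at xy(2-4) yE)
  have "shape p y = 0" using shape_E_at(2)[OF p] yE by simp
  then show ?thesis
    using sectional_curvature_basis[where p = p and g = "canonical_variation g E",
        OF curvature_like_variation[OF lcL] xy(1)]
      sectional_curvature_basis[where p = p and g = g, OF curvature_like_R xy(1)]
    by (simp add: variation_curvature_form[OF lcL] gL gp_simps xy(2-4))
qed

text \<open>Degeneracy means \<open>cos\<^sup>2 \<theta> = sin\<^sup>2 \<theta> = 1/2\<close>, with \<open>y\<close> in the radical. The normalised lightlike vector is
\<open>\<surd>2 y\<close> up to sign, which gives the value \<open>2 K\<^sub>R(\<Pi>) + 4 H\<close> with \<open>H = h(y, y) h(x, x) - h(x, y)\<^sup>2\<close>, and \<open>H\<close> is half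
the difference of the induced and the ambient curvature by \<open>projected_plane\<close>.\<close>

lemma degenerate_plane_curvature:
  assumes lcL: "levi_civita_connection M (canonical_variation g E) D'"
    and P: "is_plane P" "degenerate_on (canonical_variation g E p) P"
    and leaf: "orthogonal_integral_manifold M g E N F"
    and lcN: "levi_civita_connection N (induced_metric N M F g) DN"
    and z: "z \<in> points N" "F z = p"
  defines "P' \<equiv> orth_proj (g p) (E p) ` P"
  shows "lightlike_curvature M (canonical_variation g E) D' E p P =
    2 * sectional_curvature M g D p P +
    2 * (induced_curvature N M F g DN z P' - sectional_curvature M g D p P')"
proof -
  let ?gL = "canonical_variation g E p"
  obtain x y where xy: "span {x, y} = P" "g p x x = 1" "g p y y = 1" "g p x y = 0"
      "g p (E p) x = 0" "g p (E p) y \<ge> 0"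
    using plane_adapted_basis[OF g_bilinear[OF p] g_sym[OF p] g_pos[OF p] P(1)] by blast
  let ?c = "g p (E p) y"
  have gL: "?gL x x = 1" "?gL x y = 0" "?gL y x = 0" "?gL y y = 1 - 2 * ?c\<^sup>2"
    using g_sym[OF p, of y x] by (simp_all add: canonical_variation_at xy power2_eq_square)
  note L = bilinear_ladd[OF bilinear_variation] bilinear_lmul[OF bilinear_variation]
  obtain u where u: "u \<in> P" "u \<noteq> 0" "\<And>v. v \<in> P \<Longrightarrow> ?gL u v = 0"
    using P(2) unfolding degenerate_on_def by blast
  obtain a b where ab: "u = a *\<^sub>R x + b *\<^sub>R y" using u(1) xy(1) span_pair_iff by metis
  have "x \<in> P" "y \<in> P" "y \<noteq> 0" using xy by (auto simp: gp_simps intro: span_base)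
  then have "a = 0" "b * (1 - 2 * ?c\<^sup>2) = 0"
    using u(3)[of x] u(3)[of y] by (simp_all add: ab L gL)
  moreover from this have "b \<noteq> 0" using u(2) ab by auto
  ultimately have c: "?c\<^sup>2 = 1 / 2" by simp
  have "?gL y (E p) = - ?c"
    using E_unitary[OF p] g_sym[OF p, of y "E p"] by (simp add: canonical_variation_at)
  then have "(?gL y (E p))\<^sup>2 = 1 / 2" using c by simp
  then have "lightlike_curvature M (canonical_variation g E) D' E p P
      = 2 * ?gL (curvature_tensor M D' p x y y) x"
    using c gL \<open>y \<noteq> 0\<close>
    by (intro lightlike_curvature_basis curvature_like_variation[OF lcL] xy(1)) auto
  also have "\<dots> = 2 * g p (R x y y) x + 4 * (h y y * h x x - h x y * h y x)"
    by (simp add: variation_curvature_form[OF lcL])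
  finally show ?thesis
    using projected_plane[OF leaf lcN z xy(1-5)] c
      sectional_curvature_basis[where p = p and g = g, OF curvature_like_R xy(1)]
    by (simp add: P'_def xy)
qed

text \<open>Trace of the curvature formula; the two terms of rank one contribute the value of the linear form on the
vector.\<close>

lemma ricci_variation:
  assumes lcL: "levi_civita_connection M (canonical_variation g E) D'"
  shows "ricci M D' p v v = ricci M D p v v + 2 * h v v * divergence D E p
    - 2 * g p (shape p v) (shape p v) - 2 * g p (R v (E p) (E p)) v"
proof -
  have l: "linear (\<lambda>x. g p (R x v (E p)) v)" "linear (\<lambda>x. h x v)"
    unfolding linear_iff
    by (auto simp: R.R_simps gp_simps linear_add[OF linear_shape[OF p]] linear_cmul[OF linear_shape[OF p]])
  have "ricci M D' p v v = endo_trace (\<lambda>x. R x v v) + 2 * endo_trace (\<lambda>x. g p (R x v (E p)) v *\<^sub>R E p)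
     + 2 * h v v * endo_trace (shape p) - 2 * endo_trace (\<lambda>x. h x v *\<^sub>R shape p v)"
    unfolding ricci_def variation_curvature_at[OF p lcL] endo_trace_def
    by (simp add: inner_add_left inner_diff_left sum.distrib sum_subtractf sum_distrib_left algebra_simps)
  also have "\<dots> = ricci M D p v v + 2 * g p (R (E p) v (E p)) v + 2 * h v v * divergence D E p
     - 2 * h (shape p v) v"
    unfolding endo_trace_rank_one[OF l(1)] endo_trace_rank_one[OF l(2)]
    by (simp add: ricci_def divergence_def)
  finally show ?thesis
    using h_sym[of "shape p v" v] by (simp add: R.R_alt[of v "E p"] gp_simps)
qed

lemma bilinear_ricci:
  assumes "levi_civita_connection M g' D'"
  shows "bilinear (ricci M D' p)"
  unfolding bilinear_def linear_iff ricci_def endo_trace_def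
  by (simp add: linear_add[OF curvature_tensor_multilinear(2)[OF assms p]]
      linear_cmul[OF curvature_tensor_multilinear(2)[OF assms p]]
      linear_add[OF curvature_tensor_multilinear(3)[OF assms p]]
      linear_cmul[OF curvature_tensor_multilinear(3)[OF assms p]]
      inner_add_left sum.distrib sum_distrib_left)

text \<open>A \<open>g\<close>-orthonormal frame containing \<open>E\<close> is orthonormal for the varied metric, with \<open>E\<close> timelike. So the
scalar curvature is the sum of the Ricci curvatures over the frame minus \<open>2 Ric\<^sub>L(E, E)\<close>, and
\<open>Ric\<^sub>L(E, E) = Ric(E, E)\<close>; the two contributions of \<open>Ric(E, E)\<close> are evaluated by the Bochner identity.\<close>

lemma scalar_curvature_variation:
  assumes lcL: "levi_civita_connection M (canonical_variation g E) D'"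
  shows "scalar_curvature M (canonical_variation g E) D' p =
     scalar_curvature M g D p + 4 * mdiff M (divergence D E) p (E p)
     + 2 * (metric_trace (g p) (\<lambda>v w. g p (shape p v) (shape p w)) + (divergence D E p)\<^sup>2)"
proof -
  let ?gL = "canonical_variation g E p"
  obtain B where B: "orthonormal_frame (g p) B" "E p \<in> B" "\<And>b. b \<in> B \<Longrightarrow> g p b b = 1"
    using exists_orthonormal_frame[OF g_bilinear[OF p] g_sym[OF p] g_pos[OF p] E_unitary[OF p]] by blast
  have fin: "finite B" using B(1) by (simp add: orthonormal_frame_def)
  have Eb: "g p (E p) b = (if b = E p then 1 else 0)" if "b \<in> B" for b
    using B that by (auto simp: orthonormal_frame_def)
  have gLb: "?gL b b = (if b = E p then -1 else 1)" if "b \<in> B" for b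
    using B(3)[OF that] Eb[OF that] by (simp add: canonical_variation_at)
  have BL: "orthonormal_frame ?gL B"
    using B(1) gLb Eb by (auto simp: orthonormal_frame_def canonical_variation_at)
  have trace: "endo_trace L = (\<Sum>b\<in>B. g p (L b) b)" if "linear L" for L
    unfolding endo_trace_frame[OF g_bilinear[OF p] B(1) that] by (intro sum.cong) (auto simp: B)
  have metr: "metric_trace (g p) b = (\<Sum>e\<in>B. b e e)" if "bilinear b" for b
    unfolding metric_trace_frame[OF g_bilinear[OF p] g_sym[OF p] that B(1)] by (intro sum.cong) (auto simp: B)
  note lA = linear_shape[OF p]
  have blA: "bilinear (\<lambda>v w. g p (shape p v) (shape p w))"
    unfolding bilinear_def linear_iff by (auto simp: gp_simps linear_add[OF lA] linear_cmul[OF lA])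
  have A2: "endo_trace (\<lambda>u. shape p (shape p u)) = (\<Sum>b\<in>B. g p (shape p b) (shape p b))"
    using trace[OF linear_compose[OF lA lA, unfolded o_def]] h_sym by (metis (mono_tags, lifting) sum.cong)
  have RicE: "ricci M D p (E p) (E p) = (\<Sum>b\<in>B. g p (R b (E p) (E p)) b)"
    unfolding ricci_def by (rule trace[OF R.R_lin1])
  have Bochner: "ricci M D p (E p) (E p) = - (\<Sum>b\<in>B. g p (shape p b) (shape p b)) - mdiff M (divergence D E) p (E p)"
    unfolding ricci_def bochner_at[OF p] A2 ..
  have "scalar_curvature M (canonical_variation g E) D' p = (\<Sum>b\<in>B. ?gL b b * ricci M D' p b b)"
    unfolding scalar_curvature_def
    by (rule metric_trace_frame[OF bilinear_variation _ bilinear_ricci[OF lcL] BL])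
      (simp add: canonical_variation_at g_sym[OF p])
  also have "\<dots> = (\<Sum>b\<in>B. ricci M D' p b b - (if b = E p then 2 * ricci M D' p b b else 0))"
    using gLb by (intro sum.cong) auto
  also have "\<dots> = (\<Sum>b\<in>B. ricci M D' p b b) - 2 * ricci M D' p (E p) (E p)"
    using fin B(2) by (simp add: sum_subtractf)
  also have "ricci M D' p (E p) (E p) = ricci M D p (E p) (E p)"
    using ricci_variation[OF lcL, of "E p"] shape_E_at(2)[OF p] by (simp add: gp_simps R.R_same)
  also have "(\<Sum>b\<in>B. ricci M D' p b b) = (\<Sum>b\<in>B. ricci M D p b b) + 2 * (\<Sum>b\<in>B. h b b) * divergence D E p
     - 2 * (\<Sum>b\<in>B. g p (shape p b) (shape p b)) - 2 * (\<Sum>b\<in>B. g p (R b (E p) (E p)) b)"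
    unfolding ricci_variation[OF lcL]
    by (simp add: sum.distrib sum_subtractf sum_distrib_left sum_distrib_right)
  also have "(\<Sum>b\<in>B. ricci M D p b b) = scalar_curvature M g D p"
    unfolding scalar_curvature_def by (rule metr[OF bilinear_ricci[OF lc], symmetric])
  also have "(\<Sum>b\<in>B. h b b) = divergence D E p"
    unfolding divergence_def by (rule trace[OF lA, symmetric])
  finally show ?thesis
    unfolding metr[OF blA] RicE[symmetric] Bochner by (simp add: power2_eq_square algebra_simps)
qed

end

end

theorem proposition5p1:
  fixes M :: "('a, 'b::euclidean_space) manifold"
    and gR gL :: "'a \<Rightarrow> 'b \<Rightarrow> 'b \<Rightarrow> real"
    and E :: "'a \<Rightarrow> 'b"
    and DR DL :: "'a \<Rightarrow> 'b \<Rightarrow> ('a \<Rightarrow> 'b) \<Rightarrow> 'b"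
  assumes "smooth_manifold M"
    and "riemannian_metric M gR"
    and "closed_unitary_field M gR E"
    and gL_def: "gL = canonical_variation gR E"
    and "levi_civita_connection M gR DR"
    and "levi_civita_connection M gL DL"
  shows
    "(\<forall>p\<in>points M. \<forall>P. is_plane P \<longrightarrow> \<not> degenerate_on (gL p) P \<longrightarrow>
       (\<forall>(N :: ('l, 'c::euclidean_space) manifold) F DN y.
          orthogonal_integral_manifold M gR E N F \<longrightarrow>
          levi_civita_connection N (induced_metric N M F gR) DN \<longrightarrow>
          y \<in> points N \<longrightarrow> F y = p \<longrightarrow>
          (let \<theta> = angle_plane (gR p) (E p) P; P' = orth_proj (gR p) (E p) ` P in
           - cos (2 * \<theta>) * sectional_curvature M gL DL p P =
             sectional_curvature M gR DR p P +
             2 * (sin \<theta>)\<^sup>2 *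
               (induced_curvature N M F gR DN y P' - sectional_curvature M gR DR p P')))) \<and>
     (\<forall>p\<in>points M. \<forall>P. is_plane P \<longrightarrow> E p \<in> P \<longrightarrow>
       sectional_curvature M gL DL p P = - sectional_curvature M gR DR p P) \<and>
     (\<forall>p\<in>points M. \<forall>P. is_plane P \<longrightarrow> degenerate_on (gL p) P \<longrightarrow>
       (\<forall>(N :: ('l, 'c::euclidean_space) manifold) F DN y.
          orthogonal_integral_manifold M gR E N F \<longrightarrow>
          levi_civita_connection N (induced_metric N M F gR) DN \<longrightarrow>
          y \<in> points N \<longrightarrow> F y = p \<longrightarrow>
          (let P' = orth_proj (gR p) (E p) ` P in
           lightlike_curvature M gL DL E p P =
             2 * sectional_curvature M gR DR p P +
             2 * (induced_curvature N M F gR DN y P' - sectional_curvature M gR DR p P')))) \<and>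
     (\<forall>p\<in>points M. \<forall>v.
       ricci M DL p v v =
         ricci M DR p v v + 2 * gR p (DR p v E) v * divergence DR E p
         - 2 * gR p (DR p v E) (DR p v E)
         - 2 * gR p (curvature_tensor M DR p v (E p) (E p)) v) \<and>
     (\<forall>p\<in>points M.
       scalar_curvature M gL DL p =
         scalar_curvature M gR DR p + 4 * mdiff M (divergence DR E) p (E p)
         + 2 * (metric_trace (gR p) (\<lambda>v w. gR p (DR p v E) (DR p w E)) + (divergence DR E p)\<^sup>2))"
proof -
  interpret closed_unitary_geometry M gR E DR
    using assms by unfold_locales
  note lcL = assms(6)[unfolded gL_def]
  show ?thesis
    unfolding gL_def Let_def
    by (intro conjI ballI allI impI;
        rule nondegenerate_plane_curvature[OF _ lcL] plane_containing_E_curvature[OF _ lcL]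
          degenerate_plane_curvature[OF _ lcL] ricci_variation[OF _ lcL] scalar_curvature_variation[OF _ lcL];
        assumption)
qed

end
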